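(* Let $\Lambda$ be a finitely aligned $k$-graph and let $\mathcal{E}\subseteq\mathrm{FE}(\Lambda^1)$ be efficient. Suppose that $\{S_\lambda:\lambda\in\Lambda\}$ is a relative Cuntz-Krieger $(\Lambda;\mathcal{E})$-family in a $C^*$-algebra $B$ which satisfies: (G1) $S_v\neq0$ for all $v\in\Lambda^0$; (G2) $\prod_{e\in E}(S_{r(E)}-S_eS_e^* )\neq0$ for all $E\in\mathrm{FE}(\Lambda^1)\setminus\widehat{\mathcal{E}}$; and (G3) there exists an action $\theta:\mathbb{T}^k\to\mathrm{Aut}(B)$ with $\theta_z(S_\lambda)=z^{d(\lambda)}S_\lambda$ for all $z\in\mathbb{T}^k$ and $\lambda\in\Lambda$. Then the homomorphism $\pi_S:C^*(\Lambda;\mathcal{E})\to B$ obtained from the universal property, i.e. the one satisfying $\pi_S(s^{\mathcal{E}}_\lambda)=S_\lambda$ for all $\lambda\in\Lambda$, is injective.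
   Context: A $k$-graph ($k\ge 1$) is a countable category $\Lambda$ with a functor $d:\Lambda\to\mathbb{N}^k$ such that whenever $d(\lambda)=m+n$ there are unique $\mu,\nu\in\Lambda$ with $\lambda=\mu\nu$, $d(\mu)=m$, $d(\nu)=n$; write $\lambda(0,m)=\mu$. $\Lambda^n:=d^{-1}(n)$; $\Lambda^0$ is identified with the objects (vertices); $r,s:\Lambda\to\Lambda^0$ are codomain and domain, so $\lambda\mu$ is defined iff $s(\lambda)=r(\mu)$. $\Lambda^1:=\bigcup_{i=1}^k\Lambda^{e_i}$ is the set of edges ($e_i$ the standard basis of $\mathbb{N}^k$). For $v\in\Lambda^0$, $E\subseteq\Lambda$: $vE:=\{\mu\in E:r(\mu)=v\}$. With $\vee$ the coordinatewise maximum, $\mathrm{MCE}(\lambda,\mu):=\{\tau\in\Lambda^{d(\lambda)\vee d(\mu)}:\tau(0,d(\lambda))=\lambda,\ \tau(0,d(\mu))=\mu\}$ and $\Lambda^{\min}(\lambda,\mu):=\{(\lambda',\mu'):\lambda\lambda'=\mu\mu'\in\mathrm{MCE}(\lambda,\mu)\}$. $\Lambda$ is finitely aligned if every $\Lambda^{\min}(\lambda,\mu)$ is finite. A set $E\subseteq v\Lambda$ is exhaustive if for every $\lambda\in v\Lambda$ there is $\mu\in E$ with $\Lambda^{\min}(\lambda,\mu)\neq\emptyset$. $\mathrm{FE}(\Lambda)$ is the collection of all finite exhaustive sets $E\subseteq v\Lambda\setminus\{v\}$, $v\in\Lambda^0$; for such $E$ put $r(E):=v$. $\mathrm{FE}(\Lambda^1):=\{E\in\mathrm{FE}(\Lambda):E\subseteq\Lambda^1\}$.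 For a collection $\mathcal{E}\subseteq\mathrm{FE}(\Lambda)$, $v\mathcal{E}:=\{E\in\mathcal{E}:r(E)=v\}$. For $E\subseteq r(\lambda)\Lambda$, $\mathrm{Ext}_\Lambda(\lambda;E):=\{g\in s(\lambda)\Lambda:\lambda g\in\mathrm{MCE}(\lambda,e)\text{ for some }e\in E\}$. A subset $\mathcal{E}\subseteq\mathrm{FE}(\Lambda^1)$ is efficient if: (E1) $E,F\in\mathcal{E}$, $E\subseteq F$ imply $E=F$; (E2) if $E\in\mathcal{E}$ and $f\in r(E)\Lambda^1\setminus E$, there is $F\in\mathcal{E}$ with $F\subseteq\mathrm{Ext}_\Lambda(f;E)$; (E3) if $E\in\mathcal{E}$, $e\in E$ and $F\in s(e)\mathcal{E}$, there is $G\in\mathcal{E}$ with $G\subseteq(E\setminus\{e\})\cup\{(ef)(0,d(f)):f\in F\}$. The edge satiation of $\mathcal{E}\subseteq\mathrm{FE}(\Lambda^1)$ is $\widehat{\mathcal{E}}:=\{E\in\mathrm{FE}(\Lambda^1):\text{there exists }F\in\mathcal{E}\text{ with }F\subseteq E\}$. A Toeplitz-Cuntz-Krieger $\Lambda$-family in a $C^*$-algebra is a collection $\{T_\lambda:\lambda\in\Lambda\}$ of partial isometries such that: (TCK1) $\{T_v:v\in\Lambda^0\}$ are mutually orthogonal projections; (TCK2) $T_\lambda T_\mu=T_{\lambda\mu}$ whenever $s(\lambda)=r(\mu)$; (TCK3) $T_\lambda^*T_\mu=\sum_{(\lambda',\mu')\in\Lambda^{\min}(\lambda,\mu)}T_{\lambda'}T_{\mu'}^*$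 for all $\lambda,\mu$ (empty sums are $0$). The projections $T_\lambda T_\lambda^*$ commute. For $\mathcal{E}\subseteq\mathrm{FE}(\Lambda)$, a relative Cuntz-Krieger $(\Lambda;\mathcal{E})$-family is a Toeplitz-Cuntz-Krieger $\Lambda$-family with (CK) $\prod_{\lambda\in E}(T_{r(E)}-T_\lambda T_\lambda^* )=0$ for all $E\in\mathcal{E}$. $C^*(\Lambda;\mathcal{E})$ is the $C^*$-algebra generated by a universal relative Cuntz-Krieger $(\Lambda;\mathcal{E})$-family $\{s^{\mathcal{E}}_\lambda:\lambda\in\Lambda\}$. *)

theory Defs
  imports "HOL-Analysis.Analysis" "HOL-Algebra.Module"
begin

section \<open>Higher-rank graphs\<close>

text \<open>
  A small category is given by its morphisms only: objects are identified with their identity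
  morphisms, so that codomain \<open>rng\<close> and domain \<open>src\<close> are maps from morphisms to morphisms.
  The composite \<open>cmp \<Lambda> \<mu> \<nu>\<close> is meaningful only if \<open>src \<Lambda> \<mu> = rng \<Lambda> \<nu>\<close>.
  The rank \<open>k\<close> is the cardinality of the finite type \<open>'k\<close>.
\<close>

record ('l, 'k::finite) kgraph =
  mor :: "'l set"
  cmp :: "'l \<Rightarrow> 'l \<Rightarrow> 'l"
  rng :: "'l \<Rightarrow> 'l"
  src :: "'l \<Rightarrow> 'l"
  deg :: "'l \<Rightarrow> nat ^ 'k"

definition category :: "('l, 'k::finite) kgraph \<Rightarrow> bool" where
  "category \<Lambda> \<longleftrightarrow>
     (\<forall>\<mu>\<in>mor \<Lambda>. rng \<Lambda> \<mu> \<in> mor \<Lambda> \<and> src \<Lambda> \<mu> \<in> mor \<Lambda> \<and>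
        rng \<Lambda> (rng \<Lambda> \<mu>) = rng \<Lambda> \<mu> \<and> src \<Lambda> (rng \<Lambda> \<mu>) = rng \<Lambda> \<mu> \<and>
        rng \<Lambda> (src \<Lambda> \<mu>) = src \<Lambda> \<mu> \<and> src \<Lambda> (src \<Lambda> \<mu>) = src \<Lambda> \<mu> \<and>
        cmp \<Lambda> (rng \<Lambda> \<mu>) \<mu> = \<mu> \<and> cmp \<Lambda> \<mu> (src \<Lambda> \<mu>) = \<mu>) \<and>
     (\<forall>\<mu>\<in>mor \<Lambda>. \<forall>\<nu>\<in>mor \<Lambda>. src \<Lambda> \<mu> = rng \<Lambda> \<nu> \<longrightarrow>
        cmp \<Lambda> \<mu> \<nu> \<in> mor \<Lambda> \<and> rng \<Lambda> (cmp \<Lambda> \<mu> \<nu>) = rng \<Lambda> \<mu> \<and> src \<Lambda> (cmp \<Lambda> \<mu> \<nu>) = src \<Lambda> \<nu>) \<and>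
     (\<forall>\<mu>\<in>mor \<Lambda>. \<forall>\<nu>\<in>mor \<Lambda>. \<forall>\<tau>\<in>mor \<Lambda>. src \<Lambda> \<mu> = rng \<Lambda> \<nu> \<and> src \<Lambda> \<nu> = rng \<Lambda> \<tau> \<longrightarrow>
        cmp \<Lambda> (cmp \<Lambda> \<mu> \<nu>) \<tau> = cmp \<Lambda> \<mu> (cmp \<Lambda> \<nu> \<tau>))"

definition k_graph :: "('l, 'k::finite) kgraph \<Rightarrow> bool" where
  "k_graph \<Lambda> \<longleftrightarrow> category \<Lambda> \<and> countable (mor \<Lambda>) \<and>
     (\<forall>\<mu>\<in>mor \<Lambda>. deg \<Lambda> (rng \<Lambda> \<mu>) = 0 \<and> deg \<Lambda> (src \<Lambda> \<mu>) = 0) \<and>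
     (\<forall>\<mu>\<in>mor \<Lambda>. \<forall>\<nu>\<in>mor \<Lambda>. src \<Lambda> \<mu> = rng \<Lambda> \<nu> \<longrightarrow>
        deg \<Lambda> (cmp \<Lambda> \<mu> \<nu>) = deg \<Lambda> \<mu> + deg \<Lambda> \<nu>) \<and>
     (\<forall>\<tau>\<in>mor \<Lambda>. \<forall>m n. deg \<Lambda> \<tau> = m + n \<longrightarrow>
        (\<exists>!(\<mu>, \<nu>). \<mu> \<in> mor \<Lambda> \<and> \<nu> \<in> mor \<Lambda> \<and> src \<Lambda> \<mu> = rng \<Lambda> \<nu> \<and>
           \<tau> = cmp \<Lambda> \<mu> \<nu> \<and> deg \<Lambda> \<mu> = m \<and> deg \<Lambda> \<nu> = n))"

definition vertices :: "('l, 'k::finite) kgraph \<Rightarrow> 'l set" where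
  "vertices \<Lambda> = {\<mu> \<in> mor \<Lambda>. deg \<Lambda> \<mu> = 0}"

text \<open>The vertices are exactly the objects, i.e. the identity morphisms.\<close>

lemma vertices_eq_identities:
  assumes "k_graph \<Lambda>"
  shows "vertices \<Lambda> = {v \<in> mor \<Lambda>. rng \<Lambda> v = v}"
    and "vertices \<Lambda> = {v \<in> mor \<Lambda>. src \<Lambda> v = v}"
proof -
  have cat: "category \<Lambda>"
    and deg0: "\<And>\<mu>. \<mu> \<in> mor \<Lambda> \<Longrightarrow> deg \<Lambda> (rng \<Lambda> \<mu>) = 0 \<and> deg \<Lambda> (src \<Lambda> \<mu>) = 0"
    and fact: "\<And>\<tau> m n. \<tau> \<in> mor \<Lambda> \<Longrightarrow> deg \<Lambda> \<tau> = m + n \<Longrightarrow>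
        \<exists>!(\<mu>, \<nu>). \<mu> \<in> mor \<Lambda> \<and> \<nu> \<in> mor \<Lambda> \<and> src \<Lambda> \<mu> = rng \<Lambda> \<nu> \<and>
           \<tau> = cmp \<Lambda> \<mu> \<nu> \<and> deg \<Lambda> \<mu> = m \<and> deg \<Lambda> \<nu> = n"
    using assms unfolding k_graph_def by blast+
  have id: "rng \<Lambda> v = v \<and> src \<Lambda> v = v" if v: "v \<in> mor \<Lambda>" and d: "deg \<Lambda> v = 0" for v
  proof -
    let ?P = "\<lambda>(\<mu>, \<nu>). \<mu> \<in> mor \<Lambda> \<and> \<nu> \<in> mor \<Lambda> \<and> src \<Lambda> \<mu> = rng \<Lambda> \<nu> \<and>
           v = cmp \<Lambda> \<mu> \<nu> \<and> deg \<Lambda> \<mu> = 0 \<and> deg \<Lambda> \<nu> = 0"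
    have c: "rng \<Lambda> v \<in> mor \<Lambda> \<and> src \<Lambda> v \<in> mor \<Lambda> \<and> src \<Lambda> (rng \<Lambda> v) = rng \<Lambda> v \<and>
        rng \<Lambda> (src \<Lambda> v) = src \<Lambda> v \<and> cmp \<Lambda> (rng \<Lambda> v) v = v \<and> cmp \<Lambda> v (src \<Lambda> v) = v"
      using cat v unfolding category_def by blast
    have "deg \<Lambda> v = 0 + 0" using d by simp
    then have "\<exists>!p. ?P p" by (rule fact[OF v])
    moreover have "?P (rng \<Lambda> v, v)" "?P (v, src \<Lambda> v)"
      using c deg0[OF v] d v by auto
    ultimately have "(rng \<Lambda> v, v) = (v, src \<Lambda> v)" by blast
    then show ?thesis by simp
  qed
  show "vertices \<Lambda> = {v \<in> mor \<Lambda>. rng \<Lambda> v = v}"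
    using id deg0 unfolding vertices_def by (auto, metis)
  show "vertices \<Lambda> = {v \<in> mor \<Lambda>. src \<Lambda> v = v}"
    using id deg0 unfolding vertices_def by (auto, metis)
qed

definition edges :: "('l, 'k::finite) kgraph \<Rightarrow> 'l set" where
  "edges \<Lambda> = {\<mu> \<in> mor \<Lambda>. \<exists>i. deg \<Lambda> \<mu> = axis i 1}"

text \<open>\<open>into \<Lambda> v E\<close> is the set written \<open>vE\<close>; \<open>initial \<Lambda> \<tau> m\<close> is \<open>\<tau>(0,m)\<close>, for \<open>m \<le> d(\<tau>)\<close>.\<close>

definition into :: "('l, 'k::finite) kgraph \<Rightarrow> 'l \<Rightarrow> 'l set \<Rightarrow> 'l set" where
  "into \<Lambda> v E = {\<mu> \<in> E. rng \<Lambda> \<mu> = v}"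

definition initial :: "('l, 'k::finite) kgraph \<Rightarrow> 'l \<Rightarrow> nat ^ 'k \<Rightarrow> 'l" where
  "initial \<Lambda> \<tau> m = (THE \<mu>. \<mu> \<in> mor \<Lambda> \<and> deg \<Lambda> \<mu> = m \<and>
     (\<exists>\<nu>\<in>mor \<Lambda>. src \<Lambda> \<mu> = rng \<Lambda> \<nu> \<and> \<tau> = cmp \<Lambda> \<mu> \<nu>))"

definition deg_join :: "nat ^ 'k::finite \<Rightarrow> nat ^ 'k \<Rightarrow> nat ^ 'k" where
  "deg_join m n = (\<chi> i. max (m $ i) (n $ i))"

definition MCE :: "('l, 'k::finite) kgraph \<Rightarrow> 'l \<Rightarrow> 'l \<Rightarrow> 'l set" where
  "MCE \<Lambda> \<mu> \<nu> = {\<tau> \<in> mor \<Lambda>. deg \<Lambda> \<tau> = deg_join (deg \<Lambda> \<mu>) (deg \<Lambda> \<nu>) \<and>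
     initial \<Lambda> \<tau> (deg \<Lambda> \<mu>) = \<mu> \<and> initial \<Lambda> \<tau> (deg \<Lambda> \<nu>) = \<nu>}"

definition Lmin :: "('l, 'k::finite) kgraph \<Rightarrow> 'l \<Rightarrow> 'l \<Rightarrow> ('l \<times> 'l) set" where
  "Lmin \<Lambda> \<mu> \<nu> = {(\<alpha>, \<beta>). \<alpha> \<in> mor \<Lambda> \<and> \<beta> \<in> mor \<Lambda> \<and>
     src \<Lambda> \<mu> = rng \<Lambda> \<alpha> \<and> src \<Lambda> \<nu> = rng \<Lambda> \<beta> \<and>
     cmp \<Lambda> \<mu> \<alpha> = cmp \<Lambda> \<nu> \<beta> \<and> cmp \<Lambda> \<mu> \<alpha> \<in> MCE \<Lambda> \<mu> \<nu>}"

definition finitely_aligned :: "('l, 'k::finite) kgraph \<Rightarrow> bool" where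
  "finitely_aligned \<Lambda> \<longleftrightarrow> (\<forall>\<mu>\<in>mor \<Lambda>. \<forall>\<nu>\<in>mor \<Lambda>. finite (Lmin \<Lambda> \<mu> \<nu>))"

definition exhaustive :: "('l, 'k::finite) kgraph \<Rightarrow> 'l \<Rightarrow> 'l set \<Rightarrow> bool" where
  "exhaustive \<Lambda> v E \<longleftrightarrow> E \<subseteq> into \<Lambda> v (mor \<Lambda>) \<and>
     (\<forall>\<mu>\<in>into \<Lambda> v (mor \<Lambda>). \<exists>\<nu>\<in>E. Lmin \<Lambda> \<mu> \<nu> \<noteq> {})"

definition FE :: "('l, 'k::finite) kgraph \<Rightarrow> 'l set set" where
  "FE \<Lambda> = {E. \<exists>v\<in>vertices \<Lambda>. finite E \<and> E \<subseteq> into \<Lambda> v (mor \<Lambda>) - {v} \<and> exhaustive \<Lambda> v E}"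

definition FE_edges :: "('l, 'k::finite) kgraph \<Rightarrow> 'l set set" where
  "FE_edges \<Lambda> = {E \<in> FE \<Lambda>. E \<subseteq> edges \<Lambda>}"

text \<open>
  The vertex \<open>r(E)\<close>.  Every member of \<open>FE \<Lambda>\<close> is nonempty (an exhaustive subset of \<open>v\<Lambda>\<close> must
  meet \<open>v\<close> itself), so the range of its elements determines the vertex.
\<close>

definition set_rng :: "('l, 'k::finite) kgraph \<Rightarrow> 'l set \<Rightarrow> 'l" where
  "set_rng \<Lambda> E = (THE v. rng \<Lambda> ` E = {v})"

definition Ext :: "('l, 'k::finite) kgraph \<Rightarrow> 'l \<Rightarrow> 'l set \<Rightarrow> 'l set" where
  "Ext \<Lambda> \<mu> E = {g \<in> into \<Lambda> (src \<Lambda> \<mu>) (mor \<Lambda>). \<exists>e\<in>E. cmp \<Lambda> \<mu> g \<in> MCE \<Lambda> \<mu> e}"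

definition efficient :: "('l, 'k::finite) kgraph \<Rightarrow> 'l set set \<Rightarrow> bool" where
  "efficient \<Lambda> \<E> \<longleftrightarrow> \<E> \<subseteq> FE_edges \<Lambda> \<and>
     (\<forall>E\<in>\<E>. \<forall>F\<in>\<E>. E \<subseteq> F \<longrightarrow> E = F) \<and>
     (\<forall>E\<in>\<E>. \<forall>f\<in>into \<Lambda> (set_rng \<Lambda> E) (edges \<Lambda>) - E. \<exists>F\<in>\<E>. F \<subseteq> Ext \<Lambda> f E) \<and>
     (\<forall>E\<in>\<E>. \<forall>e\<in>E. \<forall>F\<in>\<E>. set_rng \<Lambda> F = src \<Lambda> e \<longrightarrow>
        (\<exists>G\<in>\<E>. G \<subseteq> (E - {e}) \<union> {initial \<Lambda> (cmp \<Lambda> e f) (deg \<Lambda> f) | f. f \<in> F}))"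

definition edge_satiation :: "('l, 'k::finite) kgraph \<Rightarrow> 'l set set \<Rightarrow> 'l set set" where
  "edge_satiation \<Lambda> \<E> = {E \<in> FE_edges \<Lambda>. \<exists>F\<in>\<E>. F \<subseteq> E}"


section \<open>C*-algebras\<close>

text \<open>
  Not necessarily unital C*-algebras appear in two forms: as a type class, and as structures on a
  carrier set.  The second form is what allows a universal property to quantify over C*-algebras.
  The structures extend the library's record of modules; as in the library's theory of modules
  (where multiplication is ignored as well), the field \<open>one\<close> of that record is not used.
\<close>

class cstar_algebra = real_normed_algebra + banach +
  fixes scaleC :: "complex \<Rightarrow> 'a \<Rightarrow> 'a"  (infixr \<open>*\<^sub>C\<close> 75)
    and star :: "'a \<Rightarrow> 'a"
  assumes scaleC_add_right: "a *\<^sub>C (x + y) = a *\<^sub>C x + a *\<^sub>C y"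
    and scaleC_add_left: "(a + b) *\<^sub>C x = a *\<^sub>C x + b *\<^sub>C x"
    and scaleC_scaleC: "a *\<^sub>C b *\<^sub>C x = (a * b) *\<^sub>C x"
    and scaleC_of_real: "complex_of_real r *\<^sub>C x = r *\<^sub>R x"
    and scaleC_mult_left: "(a *\<^sub>C x) * y = a *\<^sub>C (x * y)"
    and scaleC_mult_right: "x * (a *\<^sub>C y) = a *\<^sub>C (x * y)"
    and norm_scaleC: "norm (a *\<^sub>C x) = cmod a * norm x"
    and star_add: "star (x + y) = star x + star y"
    and star_scaleC: "star (a *\<^sub>C x) = cnj a *\<^sub>C star x"
    and star_mult: "star (x * y) = star y * star x"
    and star_star: "star (star x) = x"
    and norm_star_mult: "norm (star x * x) = (norm x)\<^sup>2"

record 'b cstar_struct = "(complex, 'b) module" +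
  adj :: "'b \<Rightarrow> 'b"
  nrm :: "'b \<Rightarrow> real"

definition nrm_dist :: "'b cstar_struct \<Rightarrow> 'b \<Rightarrow> 'b \<Rightarrow> real" where
  "nrm_dist A x y = nrm A (x \<ominus>\<^bsub>A\<^esub> y)"

definition cstar_algebra_on :: "'b cstar_struct \<Rightarrow> bool" where
  "cstar_algebra_on A \<longleftrightarrow> abelian_group A \<and>
     (\<forall>x\<in>carrier A. \<forall>y\<in>carrier A. x \<otimes>\<^bsub>A\<^esub> y \<in> carrier A) \<and>
     (\<forall>x\<in>carrier A. \<forall>y\<in>carrier A. \<forall>z\<in>carrier A.
        (x \<otimes>\<^bsub>A\<^esub> y) \<otimes>\<^bsub>A\<^esub> z = x \<otimes>\<^bsub>A\<^esub> (y \<otimes>\<^bsub>A\<^esub> z) \<and>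
        (x \<oplus>\<^bsub>A\<^esub> y) \<otimes>\<^bsub>A\<^esub> z = x \<otimes>\<^bsub>A\<^esub> z \<oplus>\<^bsub>A\<^esub> y \<otimes>\<^bsub>A\<^esub> z \<and>
        z \<otimes>\<^bsub>A\<^esub> (x \<oplus>\<^bsub>A\<^esub> y) = z \<otimes>\<^bsub>A\<^esub> x \<oplus>\<^bsub>A\<^esub> z \<otimes>\<^bsub>A\<^esub> y) \<and>
     (\<forall>a b. \<forall>x\<in>carrier A. a \<odot>\<^bsub>A\<^esub> x \<in> carrier A \<and> 1 \<odot>\<^bsub>A\<^esub> x = x \<and>
        (a + b) \<odot>\<^bsub>A\<^esub> x = a \<odot>\<^bsub>A\<^esub> x \<oplus>\<^bsub>A\<^esub> b \<odot>\<^bsub>A\<^esub> x \<and> (a * b) \<odot>\<^bsub>A\<^esub> x = a \<odot>\<^bsub>A\<^esub> (b \<odot>\<^bsub>A\<^esub> x)) \<and>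
     (\<forall>a. \<forall>x\<in>carrier A. \<forall>y\<in>carrier A.
        a \<odot>\<^bsub>A\<^esub> (x \<oplus>\<^bsub>A\<^esub> y) = a \<odot>\<^bsub>A\<^esub> x \<oplus>\<^bsub>A\<^esub> a \<odot>\<^bsub>A\<^esub> y \<and>
        (a \<odot>\<^bsub>A\<^esub> x) \<otimes>\<^bsub>A\<^esub> y = a \<odot>\<^bsub>A\<^esub> (x \<otimes>\<^bsub>A\<^esub> y) \<and> x \<otimes>\<^bsub>A\<^esub> (a \<odot>\<^bsub>A\<^esub> y) = a \<odot>\<^bsub>A\<^esub> (x \<otimes>\<^bsub>A\<^esub> y)) \<and>
     (\<forall>a. \<forall>x\<in>carrier A. adj A x \<in> carrier A \<and> adj A (adj A x) = x \<and>
        adj A (a \<odot>\<^bsub>A\<^esub> x) = cnj a \<odot>\<^bsub>A\<^esub> adj A x) \<and>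
     (\<forall>x\<in>carrier A. \<forall>y\<in>carrier A. adj A (x \<oplus>\<^bsub>A\<^esub> y) = adj A x \<oplus>\<^bsub>A\<^esub> adj A y \<and>
        adj A (x \<otimes>\<^bsub>A\<^esub> y) = adj A y \<otimes>\<^bsub>A\<^esub> adj A x) \<and>
     (\<forall>a. \<forall>x\<in>carrier A. 0 \<le> nrm A x \<and> (nrm A x = 0 \<longleftrightarrow> x = \<zero>\<^bsub>A\<^esub>) \<and>
        nrm A (a \<odot>\<^bsub>A\<^esub> x) = cmod a * nrm A x \<and> nrm A (adj A x \<otimes>\<^bsub>A\<^esub> x) = (nrm A x)\<^sup>2) \<and>
     (\<forall>x\<in>carrier A. \<forall>y\<in>carrier A. nrm A (x \<oplus>\<^bsub>A\<^esub> y) \<le> nrm A x + nrm A y \<and>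
        nrm A (x \<otimes>\<^bsub>A\<^esub> y) \<le> nrm A x * nrm A y) \<and>
     Metric_space.mcomplete (carrier A) (nrm_dist A)"

definition cstar_of_type :: "'b::cstar_algebra cstar_struct" where
  "cstar_of_type = \<lparr>carrier = UNIV, mult = (*), one = undefined, zero = 0, add = (+),
     smult = (*\<^sub>C), adj = star, nrm = norm\<rparr>"

lemma cstar_of_type_simps [simp]:
  "carrier cstar_of_type = UNIV" "x \<otimes>\<^bsub>cstar_of_type\<^esub> y = x * y" "\<zero>\<^bsub>cstar_of_type\<^esub> = 0"
  "x \<oplus>\<^bsub>cstar_of_type\<^esub> y = x + y" "a \<odot>\<^bsub>cstar_of_type\<^esub> x = a *\<^sub>C x"
  "adj cstar_of_type x = star x" "nrm cstar_of_type x = norm x"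
  by (simp_all add: cstar_of_type_def)

lemma abelian_group_cstar_of_type: "abelian_group (cstar_of_type :: 'b::cstar_algebra cstar_struct)"
  by (rule abelian_groupI)
     (auto simp: algebra_simps intro: exI[of _ "- x" for x] add.left_inverse)

lemma minus_cstar_of_type [simp]:
  "x \<ominus>\<^bsub>cstar_of_type\<^esub> y = x - (y :: 'b::cstar_algebra)"
proof -
  interpret abelian_group "cstar_of_type :: 'b cstar_struct"
    by (rule abelian_group_cstar_of_type)
  have "\<ominus>\<^bsub>cstar_of_type\<^esub> y = - y"
    by (rule minus_equality) auto
  then show ?thesis by (simp add: a_minus_def)
qed

lemma cstar_algebra_on_cstar_of_type:
  "cstar_algebra_on (cstar_of_type :: 'b::cstar_algebra cstar_struct)"
proof -
  have d: "nrm_dist (cstar_of_type :: 'b cstar_struct) = dist"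
    by (intro ext) (simp add: nrm_dist_def dist_norm)
  have one: "1 *\<^sub>C x = x" for x :: 'b
    using scaleC_of_real[of 1 x] by simp
  have "Metric_space.mcomplete UNIV (dist :: 'b \<Rightarrow> 'b \<Rightarrow> real)"
    using complete_UNIV Met_TC.mcomplete_of mcomplete_iff_complete by blast
  then show ?thesis
    unfolding cstar_algebra_on_def d
    by (simp add: abelian_group_cstar_of_type one scaleC_add_right scaleC_add_left scaleC_scaleC
        scaleC_mult_left scaleC_mult_right norm_scaleC star_add star_scaleC star_mult star_star
        norm_star_mult norm_triangle_ineq norm_mult_ineq mult.assoc distrib_left distrib_right)
qed

definition star_hom :: "'a cstar_struct \<Rightarrow> 'b cstar_struct \<Rightarrow> ('a \<Rightarrow> 'b) \<Rightarrow> bool" where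
  "star_hom A B \<pi> \<longleftrightarrow>
     (\<forall>a. \<forall>x\<in>carrier A. \<pi> x \<in> carrier B \<and> \<pi> (a \<odot>\<^bsub>A\<^esub> x) = a \<odot>\<^bsub>B\<^esub> \<pi> x \<and> \<pi> (adj A x) = adj B (\<pi> x)) \<and>
     (\<forall>x\<in>carrier A. \<forall>y\<in>carrier A. \<pi> (x \<oplus>\<^bsub>A\<^esub> y) = \<pi> x \<oplus>\<^bsub>B\<^esub> \<pi> y \<and> \<pi> (x \<otimes>\<^bsub>A\<^esub> y) = \<pi> x \<otimes>\<^bsub>B\<^esub> \<pi> y)"

definition cstar_subalgebra :: "'b cstar_struct \<Rightarrow> 'b set \<Rightarrow> bool" where
  "cstar_subalgebra A C \<longleftrightarrow> \<zero>\<^bsub>A\<^esub> \<in> C \<and>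
     (\<forall>x\<in>C. \<forall>y\<in>C. x \<oplus>\<^bsub>A\<^esub> y \<in> C \<and> x \<otimes>\<^bsub>A\<^esub> y \<in> C) \<and>
     (\<forall>a. \<forall>x\<in>C. a \<odot>\<^bsub>A\<^esub> x \<in> C \<and> adj A x \<in> C) \<and>
     closedin (Metric_space.mtopology (carrier A) (nrm_dist A)) C"

definition generates_cstar :: "'b cstar_struct \<Rightarrow> 'b set \<Rightarrow> bool" where
  "generates_cstar A X \<longleftrightarrow>
     X \<subseteq> carrier A \<and> (\<forall>C. cstar_subalgebra A C \<and> X \<subseteq> C \<longrightarrow> C = carrier A)"


section \<open>Relative Cuntz-Krieger families\<close>

definition TCK_family :: "('l, 'k::finite) kgraph \<Rightarrow> 'b cstar_struct \<Rightarrow> ('l \<Rightarrow> 'b) \<Rightarrow> bool" where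
  "TCK_family \<Lambda> A T \<longleftrightarrow>
     (\<forall>\<mu>\<in>mor \<Lambda>. T \<mu> \<in> carrier A \<and> T \<mu> \<otimes>\<^bsub>A\<^esub> adj A (T \<mu>) \<otimes>\<^bsub>A\<^esub> T \<mu> = T \<mu>) \<and>
     (\<forall>v\<in>vertices \<Lambda>. adj A (T v) = T v \<and> T v \<otimes>\<^bsub>A\<^esub> T v = T v) \<and>
     (\<forall>v\<in>vertices \<Lambda>. \<forall>w\<in>vertices \<Lambda>. v \<noteq> w \<longrightarrow> T v \<otimes>\<^bsub>A\<^esub> T w = \<zero>\<^bsub>A\<^esub>) \<and>
     (\<forall>\<mu>\<in>mor \<Lambda>. \<forall>\<nu>\<in>mor \<Lambda>. src \<Lambda> \<mu> = rng \<Lambda> \<nu> \<longrightarrow> T \<mu> \<otimes>\<^bsub>A\<^esub> T \<nu> = T (cmp \<Lambda> \<mu> \<nu>)) \<and>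
     (\<forall>\<mu>\<in>mor \<Lambda>. \<forall>\<nu>\<in>mor \<Lambda>.
        adj A (T \<mu>) \<otimes>\<^bsub>A\<^esub> T \<nu> = (\<Oplus>\<^bsub>A\<^esub>p\<in>Lmin \<Lambda> \<mu> \<nu>. T (fst p) \<otimes>\<^bsub>A\<^esub> adj A (T (snd p))))"

text \<open>
  The product of the projections \<open>T\<^sub>v - T\<^sub>e T\<^sub>e\<^sup>*\<close> over \<open>e \<in> E\<close>, where \<open>v = r(E)\<close>.  The factors commute,
  so any enumeration of \<open>E\<close> may be used.  Since the algebra need not have a unit, the
  product starts from \<open>T\<^sub>v\<close>, which is a unit for each factor (and \<open>E\<close> is nonempty).
\<close>

definition gap_projection ::
    "('l, 'k::finite) kgraph \<Rightarrow> 'b cstar_struct \<Rightarrow> ('l \<Rightarrow> 'b) \<Rightarrow> 'l set \<Rightarrow> 'b" where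
  "gap_projection \<Lambda> A T E = (let v = set_rng \<Lambda> E in
     foldr (\<lambda>e x. (T v \<ominus>\<^bsub>A\<^esub> T e \<otimes>\<^bsub>A\<^esub> adj A (T e)) \<otimes>\<^bsub>A\<^esub> x)
       (SOME es. distinct es \<and> set es = E) (T v))"

definition relative_CK_family ::
    "('l, 'k::finite) kgraph \<Rightarrow> 'l set set \<Rightarrow> 'b cstar_struct \<Rightarrow> ('l \<Rightarrow> 'b) \<Rightarrow> bool" where
  "relative_CK_family \<Lambda> \<E> A T \<longleftrightarrow>
     TCK_family \<Lambda> A T \<and> (\<forall>E\<in>\<E>. gap_projection \<Lambda> A T E = \<zero>\<^bsub>A\<^esub>)"

text \<open>
  \<open>A\<close> is the universal C*-algebra \<open>C\<^sup>*(\<Lambda>;\<E>)\<close> with universal family \<open>s\<close>.  A formula cannot quantify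
  over types, so the C*-algebras \<open>B\<close> tested are those carried by a set of sequences of reals.
  Up to isomorphism this is no restriction: \<open>\<Lambda>\<close> being countable, any family generates a separable
  C*-algebra, and a separable metric space injects into \<open>nat \<Rightarrow> real\<close> (send a point to its
  distances from a dense sequence), along which the C*-algebra structure can be transported.
  Uniqueness of \<open>\<pi>\<close> follows from generation.
\<close>

definition universal_relative_CK_family ::
    "('l, 'k::finite) kgraph \<Rightarrow> 'l set set \<Rightarrow> 'a cstar_struct \<Rightarrow> ('l \<Rightarrow> 'a) \<Rightarrow> bool" where
  "universal_relative_CK_family \<Lambda> \<E> A s \<longleftrightarrow>
     cstar_algebra_on A \<and> relative_CK_family \<Lambda> \<E> A s \<and> generates_cstar A (s ` mor \<Lambda>) \<and>
     (\<forall>(B :: (nat \<Rightarrow> real) cstar_struct) T. cstar_algebra_on B \<and> relative_CK_family \<Lambda> \<E> B T \<longrightarrow>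
        (\<exists>\<pi>. star_hom A B \<pi> \<and> (\<forall>\<mu>\<in>mor \<Lambda>. \<pi> (s \<mu>) = T \<mu>)))"


section \<open>Torus actions\<close>

definition torus :: "(complex ^ 'k::finite) set" where
  "torus = {z. \<forall>i. cmod (z $ i) = 1}"

definition torus_power :: "complex ^ 'k::finite \<Rightarrow> nat ^ 'k \<Rightarrow> complex" where
  "torus_power z n = (\<Prod>i\<in>UNIV. (z $ i) ^ (n $ i))"

text \<open>
  A group homomorphism from the torus to the *-automorphisms.  Multiplication on
  \<open>complex ^ 'k\<close> is componentwise; no continuity in \<open>z\<close> is required.
\<close>

definition torus_action :: "'b cstar_struct \<Rightarrow> (complex ^ 'k::finite \<Rightarrow> 'b \<Rightarrow> 'b) \<Rightarrow> bool" where
  "torus_action A \<theta> \<longleftrightarrow>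
     (\<forall>z\<in>torus. star_hom A A (\<theta> z) \<and> bij_betw (\<theta> z) (carrier A) (carrier A)) \<and>
     (\<forall>z\<in>torus. \<forall>w\<in>torus. \<forall>x\<in>carrier A. \<theta> (z * w) x = \<theta> z (\<theta> w x))"

end

theory Submission
  imports Defs
begin

text \<open>
  Let \<open>A\<^sub>0\<close> be the dense span of the elements \<open>s\<^sub>\<lambda> s\<^sub>\<mu>\<^sup>*\<close> with \<open>s(\<lambda>) = s(\<mu>)\<close>.  It suffices that \<open>\<pi>\<close> is
  isometric on \<open>A\<^sub>0\<close>.  The \<open>2\<^sup>n\<close>-th power \<open>y\<^sub>n\<close> of \<open>x\<^sup>* x\<close> has norm the \<open>2\<^sup>n\<close>-th power of \<open>\<parallel>x\<parallel>\<^sup>2\<close>, and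
  likewise for \<open>\<pi>\<close>, so that bounds \<open>\<parallel>y\<^sub>n\<parallel> \<le> C D\<^sup>n \<parallel>\<pi>(y\<^sub>n)\<parallel>\<close> already give \<open>\<parallel>x\<parallel> \<le> \<parallel>\<pi>(x)\<parallel>\<close>.  This is used twice.  Elements of degree \<open>0\<close> lie in the span of finitely many
  \<open>s\<^sub>\<lambda> s\<^sub>\<mu>\<^sup>*\<close> closed under products, and there a bound with constant \<open>C\<close> is obtained by reading off
  coefficients.  A general element of \<open>A\<^sub>0\<close> has polynomially many homogeneous components along the
  powers, each of them dominated by means of the gauge action on \<open>B\<close>; neither a gauge action nor a
  conditional expectation on the universal algebra is needed.

  The coefficients can be read off provided that \<open>\<Prod>\<^bsub>e\<in>E\<^esub> (S\<^sub>v - S\<^sub>e S\<^sub>e\<^sup>*) = 0\<close> implies the same for \<open>s\<close>, for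
  every finite \<open>E \<subseteq> v\<Lambda>\<close>.  The hypotheses say so for sets of edges, and the general case reduces to
  the set of initial edges of \<open>E\<close> by induction on the degrees of the members of \<open>E\<close>.
\<close>

section \<open>C*-algebras\<close>

text \<open>Three obstacles shape the proof. A finite set of generators
  \<open>s \<kappa> * star (s \<mu>)\<close> rarely spans an algebra: multiplying extends the inner
  paths to a common extension, and the outer paths are then extended by the same tails. Finite sets
  of paths are therefore closed under minimal common extensions and under exchange of prefixes with
  equal degree and source; the point is that this closure stays finite. The action
  \<open>\<theta>\<close> is not assumed continuous, so homogeneous components are isolated by
  finite averages over roots of unity, one coordinate at a time, instead of by integrals. Degree
  differences bounded by R allow (2R+1)^k components, and squaring doubles R; this is the origin of
  the factor D^n with D = 2^k. Lastly, the universal property speaks of algebras carried by sets of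
  real sequences, so \<open>\<pi>\<close> becomes available only after the separable algebra
  generated by \<open>S\<close> has been copied onto such a carrier.\<close>

interpretation cvs: vector_space "scaleC :: complex \<Rightarrow> 'a \<Rightarrow> 'a::cstar_algebra"
proof
  show "1 *\<^sub>C x = x" for x :: 'a
    using scaleC_of_real[of 1 x] by simp
qed (simp_all add: scaleC_add_right scaleC_add_left scaleC_scaleC)

lemma star_zero [simp]: "star (0::'a::cstar_algebra) = 0"
  using star_add[of "0::'a" 0] by simp

lemma star_minus: "star (- x) = - star (x::'a::cstar_algebra)"
  using star_add[of x "- x"] by (simp add: eq_neg_iff_add_eq_0 add.commute)

lemma star_diff: "star (x - y) = star x - star (y::'a::cstar_algebra)"
  using star_add[of x "- y"] by (simp add: star_minus)

lemma star_sum: "star (sum f A) = (\<Sum>x\<in>A. star (f x :: 'a::cstar_algebra))"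
  by (induction A rule: infinite_finite_induct) (simp_all add: star_add)

lemma norm_star [simp]: "norm (star x) = norm (x::'a::cstar_algebra)"
proof -
  have le: "norm y \<le> norm (star y)" for y :: 'a
  proof (cases "y = 0")
    case False
    have "norm y * norm y \<le> norm (star y) * norm y"
      using norm_star_mult[of y] norm_mult_ineq[of "star y" y] by (simp add: power2_eq_square)
    then show ?thesis using False by simp
  qed simp
  show ?thesis using le[of x] le[of "star x"] by (simp add: star_star)
qed

lemma continuous_star: "continuous_on UNIV (star :: 'a::cstar_algebra \<Rightarrow> 'a)"
  by (rule continuous_on_iff[THEN iffD2]) (auto simp: dist_norm simp flip: star_diff)

lemma continuous_scaleC: "continuous_on UNIV ((*\<^sub>C) a :: 'a::cstar_algebra \<Rightarrow> 'a)"
proof (rule lipschitz_on_continuous_on[of "cmod a"], rule lipschitz_onI)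
  show "dist (a *\<^sub>C x) (a *\<^sub>C y) \<le> cmod a * dist x y" for x y :: 'a
    by (simp add: dist_norm norm_scaleC flip: cvs.scale_right_diff_distrib)
qed simp

lemma star_homD:
  assumes "star_hom cstar_of_type cstar_of_type (\<pi> :: 'a::cstar_algebra \<Rightarrow> 'b::cstar_algebra)"
  shows star_hom_add: "\<pi> (x + y) = \<pi> x + \<pi> y"
    and star_hom_mult: "\<pi> (x * y) = \<pi> x * \<pi> y"
    and star_hom_scaleC: "\<pi> (a *\<^sub>C x) = a *\<^sub>C \<pi> x"
    and star_hom_star: "\<pi> (star x) = star (\<pi> x)"
    and star_hom_zero: "\<pi> 0 = 0"
    and star_hom_diff: "\<pi> (x - y) = \<pi> x - \<pi> y"
    and star_hom_scaleR: "\<pi> (r *\<^sub>R x) = r *\<^sub>R \<pi> x"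
    and star_hom_sum: "\<pi> (sum f A) = (\<Sum>i\<in>A. \<pi> (f i))"
proof -
  show add: "\<pi> (x + y) = \<pi> x + \<pi> y" for x y
    using assms by (simp add: star_hom_def)
  show "\<pi> (x * y) = \<pi> x * \<pi> y" "\<pi> (star x) = star (\<pi> x)"
    using assms by (simp_all add: star_hom_def)
  show sc: "\<pi> (a *\<^sub>C x) = a *\<^sub>C \<pi> x" for a x
    using assms by (simp add: star_hom_def)
  show z: "\<pi> 0 = 0" using add[of 0 0] by simp
  show "\<pi> (x - y) = \<pi> x - \<pi> y" using add[of "x - y" y] by (simp add: algebra_simps)
  show "\<pi> (r *\<^sub>R x) = r *\<^sub>R \<pi> x" using sc[of "complex_of_real r" x] by (simp add: scaleC_of_real)
  show "\<pi> (sum f A) = (\<Sum>i\<in>A. \<pi> (f i))"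
    by (induction A rule: infinite_finite_induct) (simp_all add: add z)
qed

text \<open>The element \<open>1 - y\<close> is a square root of \<open>1 - x\<^sup>2\<close>, found without a unit as a fixed point.\<close>

lemma sqrt_one_minus_square:
  fixes x :: "'a::cstar_algebra"
  assumes sa: "star x = x" and less: "norm x < 1"
  obtains y where "star y = y" "x * y = y * x" "y + y = x * x + y * y"
proof -
  define w where "w = (norm x)\<^sup>2"
  \<comment> \<open>\<open>r\<close> is the smaller root of t^2 - 2t + w. The ball of radius
    \<open>r\<close> is then mapped into itself by \<open>f\<close>, and \<open>r\<close> is also a
    Lipschitz constant of \<open>f\<close> there.\<close>
  define r where "r = 1 - sqrt (1 - w)"
  have w: "0 \<le> w" "w < 1" using less by (auto simp: w_def power_less_one_iff abs_square_less_1)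
  then have r: "0 \<le> r" "r < 1" by (auto simp: r_def)
  have wr: "w + r\<^sup>2 = 2 * r"
    using w by (simp add: r_def power2_eq_square algebra_simps)
  define Y where "Y = {y. norm y \<le> r \<and> star y = y \<and> x * y = y * x}"
  define f where "f = (\<lambda>y. (1/2) *\<^sub>R (x * x + y * y))"
  have "closed Y"
  proof -
    have "Y = cball 0 r \<inter> {y. star y = y} \<inter> {y. x * y = y * x}"
      by (auto simp: Y_def)
    moreover have "closed {y. star y = (y::'a)}"
      by (intro closed_Collect_eq continuous_star continuous_on_id)
    moreover have "closed {y. x * y = y * x}"
      by (intro closed_Collect_eq continuous_intros)
    ultimately show ?thesis by auto
  qed
  then have "complete Y" by (simp add: complete_eq_closed)
  moreover have "Y \<noteq> {}" using r by (auto simp: Y_def intro!: exI[of _ 0])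
  moreover have "f ` Y \<subseteq> Y"
  proof
    fix z assume "z \<in> f ` Y"
    then obtain y where y: "norm y \<le> r" "star y = y" "x * y = y * x" and z: "z = f y"
      by (auto simp: Y_def)
    have st: "star (a *\<^sub>R u) = a *\<^sub>R star u" for a and u :: 'a
      using star_scaleC[of "complex_of_real a" u] by (simp add: scaleC_of_real)
    have "norm (x * x + y * y) \<le> norm x * norm x + norm y * norm y"
      by (meson add_mono norm_mult_ineq norm_triangle_le)
    also have "\<dots> \<le> w + r\<^sup>2"
      using y(1) by (simp add: w_def power2_eq_square mult_mono')
    finally have "norm z \<le> r" by (simp add: z f_def wr)
    moreover have "star z = z" by (simp add: z f_def st star_add star_mult sa y)
    moreover have "x * z = z * x"
    proof -
      have "x * (y * y) = (y * y) * x" using y(3) by (metis mult.assoc)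
      then show ?thesis by (simp add: z f_def distrib_left distrib_right mult.assoc)
    qed
    ultimately show "z \<in> Y" by (simp add: Y_def)
  qed
  moreover have "dist (f y) (f z) \<le> r * dist y z" if "y \<in> Y \<and> z \<in> Y" for y z
  proof -
    have "f y - f z = (1/2) *\<^sub>R (y * (y - z) + (y - z) * z)"
      by (simp add: f_def algebra_simps)
    then have "norm (f y - f z) = (1/2) * norm (y * (y - z) + (y - z) * z)" by simp
    also have "norm (y * (y - z) + (y - z) * z) \<le> norm y * norm (y - z) + norm (y - z) * norm z"
      by (meson add_mono norm_mult_ineq norm_triangle_le)
    also have "\<dots> \<le> r * norm (y - z) + norm (y - z) * r"
      using that by (intro add_mono mult_mono) (auto simp: Y_def r)
    finally show ?thesis by (simp add: dist_norm)
  qed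
  ultimately have "\<exists>!y\<in>Y. f y = y"
    using r by (intro Banach_fix[of Y r f]) blast+
  then obtain y where y: "y \<in> Y" "f y = y" by blast
  have "y + y = 2 *\<^sub>R f y" by (simp add: y(2) scaleR_2)
  then have "y + y = x * x + y * y" by (simp add: f_def)
  with y(1) show ?thesis by (intro that) (auto simp: Y_def)
qed

text \<open>The hypotheses say that \<open>c + \<i>(1 - e)\<close> is unitary, so its real part \<open>c\<close> is a contraction.\<close>

lemma norm_le_one_of_unitary:
  fixes c e :: "'a::cstar_algebra"
  assumes "star c = c" "star e = e" "c * e = e * c" "e + e = c * c + e * e"
  shows "norm c \<le> 1"
proof -
  \<comment> \<open>Formally \<open>L j b\<close> is the product of c + j(1 - e) with
    \<open>b\<close>, multiplied out because there may be no unit. Only j = \<i> and j = -\<i>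
    matter; both give unitaries, since the hypotheses read c^2 + (1 - e)^2 = 1.\<close>
  define L where "L = (\<lambda>j b. c * b + j *\<^sub>C (b - e * b))"
  have iso: "norm (L j b) = norm b" if j: "j * cnj j = 1" "cnj j = - j" for j b
  proof -
    have jj: "j * j = - 1" using j by (metis add.inverse_inverse mult_minus_right)
    have ce: "c * (e * b) = e * (c * b)" using assms(3) by (metis mult.assoc)
    have "(e + e) * b = (c * c + e * e) * b" using assms(4) by simp
    then have ee: "c * (c * b) = e * b + e * b - e * (e * b)"
      by (simp add: algebra_simps)
    have st: "star (L j b) = star b * c - j *\<^sub>C (star b - star b * e)"
      by (simp add: L_def star_add star_mult star_scaleC star_diff assms j cvs.scale_minus_left)
    have "star (L j b) * d = star b * (c * d - j *\<^sub>C (d - e * d))" for d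
      unfolding st by (simp add: left_diff_distrib right_diff_distrib mult.assoc
          scaleC_mult_left scaleC_mult_right)
    then have "star (L j b) * L j b = star b * (c * L j b - j *\<^sub>C (L j b - e * L j b))" .
    also have "c * L j b - j *\<^sub>C (L j b - e * L j b) = b"
      by (simp add: L_def algebra_simps scaleC_mult_left scaleC_mult_right
          cvs.scale_right_distrib cvs.scale_right_diff_distrib scaleC_scaleC jj ce ee
          cvs.scale_minus_left)
    finally have "(norm (L j b))\<^sup>2 = (norm b)\<^sup>2"
      by (metis norm_star_mult)
    then show ?thesis by simp
  qed
  \<comment> \<open>The two unitaries add up to 2c; applying them to \<open>c\<close> keeps the
    computation inside the algebra.\<close>
  have "2 *\<^sub>R (c * c) = L \<i> c + L (- \<i>) c"
    by (simp add: L_def cvs.scale_minus_left scaleR_2)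
  then have "2 * norm (c * c) = norm (L \<i> c + L (- \<i>) c)"
    by (metis abs_numeral norm_scaleR)
  also have "\<dots> \<le> norm c + norm c"
    using norm_triangle_ineq[of "L \<i> c" "L (- \<i>) c"] by (simp add: iso)
  finally have "norm c * norm c \<le> norm c"
    using norm_star_mult[of c] by (simp add: assms power2_eq_square)
  then show ?thesis
    by (metis mult.right_neutral mult_le_cancel_left_pos norm_ge_zero not_one_le_zero
        order_le_less linorder_linear order.trans)
qed

text \<open>The polynomial relations between a self-adjoint \<open>x\<close> with norm below 1 and
  its companion \<open>y\<close> survive under \<open>\<pi>\<close>, and they alone force norm at
  most 1. Scaling reaches all self-adjoint elements, and the C*-identity reaches the rest.\<close>

lemma star_hom_contractive:
  assumes hom: "star_hom cstar_of_type cstar_of_type (\<pi> :: 'a::cstar_algebra \<Rightarrow> 'b::cstar_algebra)"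
  shows "norm (\<pi> x) \<le> norm x"
proof -
  note h = star_homD[OF hom]
  have one: "norm (\<pi> x) \<le> 1" if "star x = x" "norm x < 1" for x
  proof -
    obtain y where y: "star y = y" "x * y = y * x" "y + y = x * x + y * y"
      using sqrt_one_minus_square[OF \<open>star x = x\<close> \<open>norm x < 1\<close>] .
    show ?thesis
      by (rule norm_le_one_of_unitary[of "\<pi> x" "\<pi> y"]) (metis that y h(1,2,4))+
  qed
  have sa: "norm (\<pi> x) \<le> norm x" if "star x = x" for x
  proof (rule dense_ge)
    fix t assume t: "norm x < t"
    then have t0: "t > 0" by (smt (verit) norm_ge_zero)
    have "star ((1/t) *\<^sub>R x) = (1/t) *\<^sub>R x"
      using star_scaleC[of "complex_of_real (1/t)" x] that by (simp only: scaleC_of_real complex_cnj_complex_of_real)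
    moreover have "norm ((1/t) *\<^sub>R x) < 1" using t t0 by simp
    ultimately have "norm (\<pi> ((1/t) *\<^sub>R x)) \<le> 1" by (rule one)
    then show "norm (\<pi> x) \<le> t" using t0 by (simp add: h(7))
  qed
  have "(norm (\<pi> x))\<^sup>2 = norm (\<pi> (star x * x))"
    by (simp add: h norm_star_mult)
  also have "\<dots> \<le> (norm x)\<^sup>2"
    using sa[of "star x * x"] by (simp add: star_mult star_star norm_star_mult)
  finally show ?thesis by simp
qed

text \<open>A ratio a/p above 1 would give doubly exponential growth on the left against a merely
  exponential bound.\<close>

lemma le_of_pow_bound:
  fixes a p C D :: real
  assumes "0 \<le> a" "0 \<le> p" and le: "\<And>n. a ^ 2 ^ n \<le> C * D ^ n * p ^ 2 ^ n"
  shows "a \<le> p"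
proof (rule ccontr)
  assume "\<not> a \<le> p"
  then have ap: "p < a" by simp
  show False
  proof (cases "p = 0")
    case True
    then show False using le[of 0] ap by simp
  next
    case False
    define q where "q = a / p"
    have p: "p > 0" using False assms by simp
    have q: "q > 1" using ap p by (simp add: q_def)
    have bd: "q ^ 2 ^ n \<le> C * D ^ n" for n
      using le[of n] p by (simp add: q_def power_divide divide_le_eq)
    define F where "F = \<bar>C\<bar> + 1"
    define E where "E = max 2 \<bar>D\<bar>"
    have E: "E \<ge> 2" and F: "F \<ge> 1" by (auto simp: E_def F_def)
    \<comment> \<open>A single base for which H^(n+1) dominates C * D^n, whatever the signs of
      \<open>C\<close> and \<open>D\<close>.\<close>
    define H where "H = E * F"
    have H: "E \<le> H" "F \<le> H" "H > 1"
      using mult_mono[of E E 1 F] mult_mono[of 1 E F F] mult_mono[of 2 E 1 F] E F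
      by (auto simp: H_def)
    have bd2: "q ^ 2 ^ n \<le> H ^ Suc n" for n
    proof -
      have "C * D ^ n \<le> \<bar>C\<bar> * \<bar>D\<bar> ^ n" by (metis abs_ge_self abs_mult power_abs)
      also have "\<dots> \<le> F * E ^ n" by (intro mult_mono power_mono) (auto simp: E_def F_def)
      also have "\<dots> \<le> H * H ^ n" using H E F by (intro mult_mono power_mono) auto
      finally show ?thesis using bd[of n] by simp
    qed
    obtain m where m: "H < q ^ m" using real_arch_pow[OF q] by blast
    have "q ^ m \<le> q ^ 2 ^ m" using q by (intro power_increasing) auto
    then have m: "H < q ^ 2 ^ m" using m by simp
    \<comment> \<open>The bound is evaluated at the index 2m+2: it would give 2^(m+2) \<le> 2m+3,
      although 2^(m+2) is at least 4(m+1).\<close>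
    have "H ^ 2 ^ (m + 2) \<le> (q ^ 2 ^ m) ^ 2 ^ (m + 2)"
      using m H by (intro power_mono) auto
    also have "\<dots> = q ^ 2 ^ (m + (m + 2))" by (simp only: power_add power_mult)
    also have "\<dots> \<le> H ^ Suc (m + (m + 2))" by (rule bd2)
    finally have "2 ^ (m + 2) \<le> Suc (m + (m + 2))" using H by (metis power_increasing_iff)
    moreover have "m < 2 ^ m" by (rule less_exp)
    ultimately show False by simp
  qed
qed

text \<open>\<open>V\<close> is a family of subspaces in which squaring costs one index. It is
  constant with D = 1 for elements of degree zero, and records a doubling bound on the degrees in
  the general case. Self-adjointness of the iterated squares makes their norms square exactly, in
  both algebras.\<close>

lemma norm_le_of_growth:
  fixes \<pi> :: "'a::cstar_algebra \<Rightarrow> 'b::cstar_algebra"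
  assumes hom: "star_hom cstar_of_type cstar_of_type \<pi>"
    and sq: "\<And>n x. x \<in> V n \<Longrightarrow> x * x \<in> V (Suc n)"
    and le: "\<And>n x. x \<in> V n \<Longrightarrow> norm x \<le> C * D ^ n * norm (\<pi> x)"
    and h: "star x * x \<in> V 0"
  shows "norm x \<le> norm (\<pi> x)"
proof -
  note hom' = star_homD[OF hom]
  define h where "h = star x * x"
  define f where "f = rec_nat h (\<lambda>_ y. y * y)"
  have f: "f 0 = h" "f (Suc n) = f n * f n" for n by (simp_all add: f_def)
  have inV: "f n \<in> V n" for n
  proof (induction n)
    case (Suc n)
    then show ?case unfolding f by (rule sq)
  qed (use assms(4) in \<open>simp add: f h_def\<close>)
  have sa: "star (f n) = f n" for n
  proof (induction n)
    case (Suc n)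
    then show ?case by (simp add: f star_mult)
  qed (simp add: f h_def star_mult star_star)
  have n1: "norm (f n) = norm h ^ 2 ^ n" for n
  proof (induction n)
    case (Suc n)
    have "norm (f (Suc n)) = (norm (f n))\<^sup>2"
      using norm_star_mult[of "f n"] by (simp only: f sa)
    then show ?case by (simp only: Suc power_Suc2 power_mult)
  qed (simp add: f)
  have n2: "norm (\<pi> (f n)) = norm (\<pi> h) ^ 2 ^ n" for n
  proof (induction n)
    case (Suc n)
    have "norm (\<pi> (f (Suc n))) = (norm (\<pi> (f n)))\<^sup>2"
      using norm_star_mult[of "\<pi> (f n)"] by (simp only: f hom'(2) sa flip: hom'(4))
    then show ?case by (simp only: Suc power_Suc2 power_mult)
  qed (simp add: f)
  have "norm h \<le> norm (\<pi> h)"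
    by (rule le_of_pow_bound[where C = C and D = D]) (use le[OF inV] in \<open>simp_all only: norm_ge_zero n1 n2\<close>)
  then have "(norm x)\<^sup>2 \<le> (norm (\<pi> x))\<^sup>2"
    by (simp add: h_def norm_star_mult hom')
  then show ?thesis by simp
qed

section \<open>Products and adjoints of spans\<close>

lemma span_mult:
  fixes x y :: "'a::cstar_algebra"
  assumes x: "x \<in> cvs.span X" and y: "y \<in> cvs.span Y"
    and XY: "\<And>a b. a \<in> X \<Longrightarrow> b \<in> Y \<Longrightarrow> a * b \<in> cvs.span Z"
  shows "x * y \<in> cvs.span Z"
proof -
  have one: "a * y \<in> cvs.span Z" if "a \<in> X" for a
    using y
  proof (induction rule: cvs.span_induct_alt)
    case (step c b z)
    then show ?case using XY[OF that step(1)]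
      by (auto simp: distrib_left scaleC_mult_right intro!: cvs.span_add cvs.span_scale)
  qed (simp add: cvs.span_zero)
  show ?thesis
    using x
  proof (induction rule: cvs.span_induct_alt)
    case (step c b z)
    then show ?case using one[OF step(1)]
      by (auto simp: distrib_right scaleC_mult_left intro!: cvs.span_add cvs.span_scale)
  qed (simp add: cvs.span_zero)
qed

lemma span_star:
  fixes x :: "'a::cstar_algebra"
  assumes x: "x \<in> cvs.span X" and X: "\<And>a. a \<in> X \<Longrightarrow> star a \<in> cvs.span Z"
  shows "star x \<in> cvs.span Z"
  using x
proof (induction rule: cvs.span_induct_alt)
  case (step c b z)
  then show ?case using X[OF step(1)]
    by (auto simp: star_add star_scaleC intro!: cvs.span_add cvs.span_scale)
qed (simp add: cvs.span_zero)


section \<open>Finitely aligned higher-rank graphs\<close>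

definition deg_sum :: "nat ^ 'k::finite \<Rightarrow> nat" where
  "deg_sum n = (\<Sum>i\<in>UNIV. n $ i)"

lemma deg_sum_add: "deg_sum (m + n) = deg_sum m + deg_sum n"
  by (simp add: deg_sum_def sum.distrib)

lemma deg_sum_eq_0_iff: "deg_sum n = 0 \<longleftrightarrow> n = 0"
  by (auto simp: deg_sum_def vec_eq_iff)

lemma deg_sum_mono: "(\<And>i. m $ i \<le> n $ i) \<Longrightarrow> deg_sum m \<le> deg_sum n"
  by (simp add: deg_sum_def sum_mono)

lemma deg_sum_eqD:
  assumes le: "\<And>i. m $ i \<le> n $ i" and eq: "deg_sum m = deg_sum n"
  shows "m = n"
proof -
  have "n = m + (n - m)" using le by (simp add: vec_eq_iff)
  then have "deg_sum n = deg_sum m + deg_sum (n - m)" by (metis deg_sum_add)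
  then have "n - m = 0" using eq by (simp add: deg_sum_eq_0_iff)
  with \<open>n = m + (n - m)\<close> show ?thesis by simp
qed

lemma deg_join_nth [simp]: "deg_join m n $ i = max (m $ i) (n $ i)"
  by (simp add: deg_join_def)

locale fa_kgraph =
  fixes \<Lambda> :: "('l, 'k::finite) kgraph"
  assumes kg: "k_graph \<Lambda>" and fa: "finitely_aligned \<Lambda>"
begin

abbreviation comp (infixl \<open>\<cdot>\<close> 75) where "\<mu> \<cdot> \<nu> \<equiv> cmp \<Lambda> \<mu> \<nu>"
abbreviation "M \<equiv> mor \<Lambda>"
abbreviation "d \<equiv> deg \<Lambda>"
abbreviation "r \<equiv> rng \<Lambda>"
abbreviation "sc \<equiv> src \<Lambda>"

lemma cat: "category \<Lambda>"
  using kg by (simp add: k_graph_def)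

lemma mor_simps [simp]:
  assumes "\<mu> \<in> M"
  shows "r \<mu> \<in> M" "sc \<mu> \<in> M" "r (r \<mu>) = r \<mu>" "sc (r \<mu>) = r \<mu>" "r (sc \<mu>) = sc \<mu>"
    "sc (sc \<mu>) = sc \<mu>" "r \<mu> \<cdot> \<mu> = \<mu>" "\<mu> \<cdot> sc \<mu> = \<mu>" "d (r \<mu>) = 0" "d (sc \<mu>) = 0"
    "r \<mu> \<in> vertices \<Lambda>" "sc \<mu> \<in> vertices \<Lambda>"
  using cat assms kg by (auto simp: category_def k_graph_def vertices_def)

lemma comp_simps [simp]:
  assumes "\<mu> \<in> M" "\<nu> \<in> M" "sc \<mu> = r \<nu>"
  shows "\<mu> \<cdot> \<nu> \<in> M" "r (\<mu> \<cdot> \<nu>) = r \<mu>" "sc (\<mu> \<cdot> \<nu>) = sc \<nu>" "d (\<mu> \<cdot> \<nu>) = d \<mu> + d \<nu>"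
  using cat assms kg by (auto simp: category_def k_graph_def)

lemma comp_assoc:
  assumes "\<mu> \<in> M" "\<nu> \<in> M" "\<tau> \<in> M" "sc \<mu> = r \<nu>" "sc \<nu> = r \<tau>"
  shows "\<mu> \<cdot> \<nu> \<cdot> \<tau> = \<mu> \<cdot> (\<nu> \<cdot> \<tau>)"
  using cat assms by (auto simp: category_def)

lemma vertexD:
  assumes "v \<in> vertices \<Lambda>" shows "v \<in> M" "r v = v" "sc v = v" "d v = 0"
  using assms vertices_eq_identities[OF kg] by (auto simp: vertices_def)

lemma vertexI: "v \<in> M \<Longrightarrow> d v = 0 \<Longrightarrow> v \<in> vertices \<Lambda>"
  by (simp add: vertices_def)

section \<open>Unique factorisation\<close>

lemma ex1_unique_eq: "\<exists>!x. P x \<Longrightarrow> P x \<Longrightarrow> P y \<Longrightarrow> x = y"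
  by blast

lemma factor_ex1:
  assumes "\<tau> \<in> M" "d \<tau> = m + n"
  shows "\<exists>!p. fst p \<in> M \<and> snd p \<in> M \<and> sc (fst p) = r (snd p) \<and> \<tau> = fst p \<cdot> snd p \<and>
    d (fst p) = m \<and> d (snd p) = n"
proof -
  have "\<forall>\<tau>\<in>M. \<forall>m n. d \<tau> = m + n \<longrightarrow> (\<exists>!(\<mu>, \<nu>). \<mu> \<in> M \<and> \<nu> \<in> M \<and> sc \<mu> = r \<nu> \<and> \<tau> = \<mu> \<cdot> \<nu> \<and> d \<mu> = m \<and> d \<nu> = n)"
    using kg unfolding k_graph_def by (elim conjE)
  with assms show ?thesis unfolding case_prod_unfold by blast
qed

lemma factor_ex:
  assumes "\<tau> \<in> M" "\<And>i. m $ i \<le> d \<tau> $ i"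
  obtains \<mu> \<nu> where "\<mu> \<in> M" "\<nu> \<in> M" "sc \<mu> = r \<nu>" "\<tau> = \<mu> \<cdot> \<nu>" "d \<mu> = m" "d \<nu> = d \<tau> - m"
proof -
  have "d \<tau> = m + (d \<tau> - m)" using assms(2) by (simp add: vec_eq_iff)
  from factor_ex1[OF assms(1) this] show ?thesis using that by (elim ex1E) blast
qed

lemma factor_unique:
  assumes "\<mu> \<in> M" "\<nu> \<in> M" "sc \<mu> = r \<nu>" "\<mu>' \<in> M" "\<nu>' \<in> M" "sc \<mu>' = r \<nu>'"
    and "\<mu> \<cdot> \<nu> = \<mu>' \<cdot> \<nu>'" "d \<mu> = d \<mu>'"
  shows "\<mu> = \<mu>'" "\<nu> = \<nu>'"
proof -
  have dd: "d (\<mu> \<cdot> \<nu>) = d \<mu> + d \<nu>" "d (\<mu> \<cdot> \<nu>) = d \<mu> + d \<nu>'"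
    using comp_simps(4)[OF assms(1-3)] comp_simps(4)[OF assms(4-6), folded assms(7,8)] .
  have "d \<nu> = d \<nu>'" using dd by simp
  then have "(\<mu>, \<nu>) = (\<mu>', \<nu>')"
    using assms by (intro ex1_unique_eq[OF factor_ex1[OF comp_simps(1)[OF assms(1-3)] dd(1)]]) auto
  then show "\<mu> = \<mu>'" "\<nu> = \<nu>'" by auto
qed

lemma initial_comp:
  assumes "\<mu> \<in> M" "\<nu> \<in> M" "sc \<mu> = r \<nu>"
  shows "initial \<Lambda> (\<mu> \<cdot> \<nu>) (d \<mu>) = \<mu>"
  unfolding initial_def
proof (rule the_equality)
  show "\<mu> \<in> M \<and> d \<mu> = d \<mu> \<and> (\<exists>\<nu>'\<in>M. sc \<mu> = r \<nu>' \<and> \<mu> \<cdot> \<nu> = \<mu> \<cdot> \<nu>')"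
    using assms by blast
  show "\<mu>' = \<mu>" if "\<mu>' \<in> M \<and> d \<mu>' = d \<mu> \<and> (\<exists>\<nu>'\<in>M. sc \<mu>' = r \<nu>' \<and> \<mu> \<cdot> \<nu> = \<mu>' \<cdot> \<nu>')" for \<mu>'
    using that factor_unique(1)[OF assms] by metis
qed

lemma initial_eqD:
  assumes "\<tau> \<in> M" "initial \<Lambda> \<tau> (d \<mu>) = \<mu>" "\<And>i. d \<mu> $ i \<le> d \<tau> $ i"
  obtains \<nu> where "\<mu> \<in> M" "\<nu> \<in> M" "sc \<mu> = r \<nu>" "\<tau> = \<mu> \<cdot> \<nu>"
proof -
  obtain \<mu>' \<nu> where f: "\<mu>' \<in> M" "\<nu> \<in> M" "sc \<mu>' = r \<nu>" "\<tau> = \<mu>' \<cdot> \<nu>" "d \<mu>' = d \<mu>"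
    using factor_ex[OF assms(1,3)] .
  then have "\<mu>' = \<mu>" using initial_comp[of \<mu>' \<nu>] assms(2) by simp
  then show ?thesis using f that by blast
qed

section \<open>Minimal common extensions\<close>

lemma MCE_iff:
  assumes "\<mu> \<in> M" "\<nu> \<in> M"
  shows "\<tau> \<in> MCE \<Lambda> \<mu> \<nu> \<longleftrightarrow> d \<tau> = deg_join (d \<mu>) (d \<nu>) \<and>
    (\<exists>\<alpha>\<in>M. sc \<mu> = r \<alpha> \<and> \<tau> = \<mu> \<cdot> \<alpha>) \<and> (\<exists>\<beta>\<in>M. sc \<nu> = r \<beta> \<and> \<tau> = \<nu> \<cdot> \<beta>)" (is "?L \<longleftrightarrow> ?R")
proof
  assume L: ?L
  then have \<tau>: "\<tau> \<in> M" "d \<tau> = deg_join (d \<mu>) (d \<nu>)" "initial \<Lambda> \<tau> (d \<mu>) = \<mu>" "initial \<Lambda> \<tau> (d \<nu>) = \<nu>"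
    by (auto simp: MCE_def)
  have "\<exists>\<alpha>\<in>M. sc \<mu> = r \<alpha> \<and> \<tau> = \<mu> \<cdot> \<alpha>"
    by (rule initial_eqD[OF \<tau>(1,3)]) (auto simp: \<tau>(2))
  moreover have "\<exists>\<beta>\<in>M. sc \<nu> = r \<beta> \<and> \<tau> = \<nu> \<cdot> \<beta>"
    by (rule initial_eqD[OF \<tau>(1,4)]) (auto simp: \<tau>(2))
  ultimately show ?R using \<tau> by blast
next
  assume ?R
  then obtain \<alpha> \<beta> where "d \<tau> = deg_join (d \<mu>) (d \<nu>)" "\<alpha> \<in> M" "sc \<mu> = r \<alpha>" "\<tau> = \<mu> \<cdot> \<alpha>"
    "\<beta> \<in> M" "sc \<nu> = r \<beta>" "\<tau> = \<nu> \<cdot> \<beta>" by blast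
  then show ?L
    using initial_comp[of \<mu> \<alpha>] initial_comp[of \<nu> \<beta>] comp_simps(1)[of \<mu> \<alpha>] assms
    by (simp add: MCE_def)
qed

lemma Lmin_iff:
  assumes "\<mu> \<in> M" "\<nu> \<in> M"
  shows "(\<alpha>, \<beta>) \<in> Lmin \<Lambda> \<mu> \<nu> \<longleftrightarrow> \<alpha> \<in> M \<and> \<beta> \<in> M \<and> sc \<mu> = r \<alpha> \<and> sc \<nu> = r \<beta> \<and>
    \<mu> \<cdot> \<alpha> = \<nu> \<cdot> \<beta> \<and> d \<mu> + d \<alpha> = deg_join (d \<mu>) (d \<nu>)"
proof (cases "\<alpha> \<in> M \<and> sc \<mu> = r \<alpha>")
  case True
  then have "d (\<mu> \<cdot> \<alpha>) = d \<mu> + d \<alpha>" using assms(1) by simp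
  with True show ?thesis
    unfolding Lmin_def mem_Collect_eq case_prod_conv MCE_iff[OF assms] by auto
qed (auto simp: Lmin_def)

lemma LminE:
  assumes "p \<in> Lmin \<Lambda> \<mu> \<nu>" "\<mu> \<in> M" "\<nu> \<in> M"
  obtains "fst p \<in> M" "snd p \<in> M" "sc \<mu> = r (fst p)" "sc \<nu> = r (snd p)"
    "\<mu> \<cdot> fst p = \<nu> \<cdot> snd p" "d \<mu> + d (fst p) = deg_join (d \<mu>) (d \<nu>)"
    "d \<nu> + d (snd p) = deg_join (d \<mu>) (d \<nu>)" "sc (fst p) = sc (snd p)"
proof (rule that)
  have "(fst p, snd p) \<in> Lmin \<Lambda> \<mu> \<nu>" using assms(1) by simp
  note * = this[unfolded Lmin_iff[OF assms(2,3)]]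
  then show "fst p \<in> M" "snd p \<in> M" "sc \<mu> = r (fst p)" "sc \<nu> = r (snd p)"
    "\<mu> \<cdot> fst p = \<nu> \<cdot> snd p" "d \<mu> + d (fst p) = deg_join (d \<mu>) (d \<nu>)" by auto
  then show "d \<nu> + d (snd p) = deg_join (d \<mu>) (d \<nu>)" "sc (fst p) = sc (snd p)"
    using comp_simps(3,4) assms(2,3) by metis+
qed

lemma finite_Lmin: "\<mu> \<in> M \<Longrightarrow> \<nu> \<in> M \<Longrightarrow> finite (Lmin \<Lambda> \<mu> \<nu>)"
  using fa by (auto simp: finitely_aligned_def)

lemma finite_MCE:
  assumes "\<mu> \<in> M" "\<nu> \<in> M"
  shows "finite (MCE \<Lambda> \<mu> \<nu>)"
proof (rule finite_subset)
  show "MCE \<Lambda> \<mu> \<nu> \<subseteq> (\<lambda>p. \<mu> \<cdot> fst p) ` Lmin \<Lambda> \<mu> \<nu>"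
  proof
    fix \<tau> assume \<tau>: "\<tau> \<in> MCE \<Lambda> \<mu> \<nu>"
    then obtain \<alpha> \<beta> where "\<alpha> \<in> M" "sc \<mu> = r \<alpha>" "\<tau> = \<mu> \<cdot> \<alpha>" "\<beta> \<in> M" "sc \<nu> = r \<beta>" "\<tau> = \<nu> \<cdot> \<beta>"
      using assms by (auto simp: MCE_iff)
    with \<tau> have "(\<alpha>, \<beta>) \<in> Lmin \<Lambda> \<mu> \<nu>" by (auto simp: Lmin_def)
    then show "\<tau> \<in> (\<lambda>p. \<mu> \<cdot> fst p) ` Lmin \<Lambda> \<mu> \<nu>" using \<open>\<tau> = \<mu> \<cdot> \<alpha>\<close> by force
  qed
qed (use finite_Lmin assms in auto)

lemma comp_vertex:
  assumes "\<mu> \<in> M" "\<alpha> \<in> M" "sc \<mu> = r \<alpha>" "d \<alpha> = 0"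
  shows "\<alpha> = sc \<mu>" "\<mu> \<cdot> \<alpha> = \<mu>"
  using assms vertexD[OF vertexI[of \<alpha>]] by auto

lemma Lmin_self: "\<mu> \<in> M \<Longrightarrow> Lmin \<Lambda> \<mu> \<mu> = {(sc \<mu>, sc \<mu>)}"
proof -
  assume \<mu>: "\<mu> \<in> M"
  have j: "deg_join (d \<mu>) (d \<mu>) = d \<mu>" by (simp add: vec_eq_iff)
  have "\<alpha> = sc \<mu> \<and> \<beta> = sc \<mu>" if "(\<alpha>, \<beta>) \<in> Lmin \<Lambda> \<mu> \<mu>" for \<alpha> \<beta>
  proof -
    have *: "\<alpha> \<in> M" "\<beta> \<in> M" "sc \<mu> = r \<alpha>" "sc \<mu> = r \<beta>" "\<mu> \<cdot> \<alpha> = \<mu> \<cdot> \<beta>" "d \<mu> + d \<alpha> = d \<mu>"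
      using that[unfolded Lmin_iff[OF \<mu> \<mu>]] by (auto simp: j)
    have "d \<alpha> = 0" using *(6) by simp
    then have "\<alpha> = sc \<mu>" by (rule comp_vertex(1)[OF \<mu> *(1,3)])
    moreover have "\<alpha> = \<beta>" using factor_unique(2)[OF \<mu> *(1,3) \<mu> *(2,4,5) refl] .
    ultimately show ?thesis by simp
  qed
  moreover have "(sc \<mu>, sc \<mu>) \<in> Lmin \<Lambda> \<mu> \<mu>"
    unfolding Lmin_iff[OF \<mu> \<mu>] using \<mu> by (simp add: j)
  ultimately show ?thesis
    by (intro equalityI subsetI) (metis insertI1 surj_pair, blast)
qed

lemma Lmin_same_deg:
  assumes "\<mu> \<in> M" "\<nu> \<in> M" "d \<mu> = d \<nu>" "\<mu> \<noteq> \<nu>"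
  shows "Lmin \<Lambda> \<mu> \<nu> = {}"
proof -
  have j: "deg_join (d \<mu>) (d \<nu>) = d \<mu>" using assms(3) by (simp add: vec_eq_iff)
  have False if "(\<alpha>, \<beta>) \<in> Lmin \<Lambda> \<mu> \<nu>" for \<alpha> \<beta>
    using that[unfolded Lmin_iff[OF assms(1,2)]] factor_unique(1)[of \<mu> \<alpha> \<nu> \<beta>] assms by blast
  then show ?thesis by auto
qed

text \<open>These are the closure conditions under which the generators with both paths in the set,
  of equal degree and source, span an algebra: \<open>MCE\<close> treats the inner paths of a
  product, \<open>swap\<close> the outer ones.\<close>

inductive_set path_closure :: "'l set \<Rightarrow> 'l set" for E where
  base: "\<kappa> \<in> E \<Longrightarrow> \<kappa> \<in> path_closure E"
| MCE: "\<kappa> \<in> path_closure E \<Longrightarrow> \<mu> \<in> path_closure E \<Longrightarrow> \<tau> \<in> MCE \<Lambda> \<kappa> \<mu> \<Longrightarrow> \<tau> \<in> path_closure E"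
| swap: "\<kappa> \<in> path_closure E \<Longrightarrow> \<mu> \<in> path_closure E \<Longrightarrow> \<mu> \<cdot> \<alpha> \<in> path_closure E \<Longrightarrow>
    d \<kappa> = d \<mu> \<Longrightarrow> sc \<kappa> = sc \<mu> \<Longrightarrow> \<alpha> \<in> M \<Longrightarrow> sc \<mu> = r \<alpha> \<Longrightarrow> \<kappa> \<cdot> \<alpha> \<in> path_closure E"

lemma path_closure_mor:
  assumes E: "E \<subseteq> M" and "\<kappa> \<in> path_closure E"
  shows "\<kappa> \<in> M"
  using assms(2)
proof induction
  case (swap \<kappa> \<mu> \<alpha>)
  then show ?case using comp_simps(1) by metis
qed (use E in \<open>auto simp: MCE_def\<close>)

lemma path_closure_deg:
  assumes "E \<subseteq> M" "\<And>\<kappa> i. \<kappa> \<in> E \<Longrightarrow> d \<kappa> $ i \<le> N $ i"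
  shows "\<kappa> \<in> path_closure E \<Longrightarrow> d \<kappa> $ i \<le> N $ i"
proof (induction arbitrary: i rule: path_closure.induct)
  case (swap \<kappa> \<mu> \<alpha>)
  then show ?case using comp_simps(4) path_closure_mor[OF assms(1)] by metis
qed (use assms in \<open>auto simp: MCE_def\<close>)

text \<open>The complement of \<open>initial\<close>. It serves to write all paths obtained by a
  swap as the image of a finite product set.\<close>

definition tail :: "'l \<Rightarrow> nat ^ 'k \<Rightarrow> 'l" where
  "tail \<tau> m = (SOME \<alpha>. \<alpha> \<in> M \<and> (\<exists>\<mu>\<in>M. d \<mu> = m \<and> sc \<mu> = r \<alpha> \<and> \<tau> = \<mu> \<cdot> \<alpha>))"

lemma tail_comp:
  assumes "\<mu> \<in> M" "\<alpha> \<in> M" "sc \<mu> = r \<alpha>"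
  shows "tail (\<mu> \<cdot> \<alpha>) (d \<mu>) = \<alpha>"
  unfolding tail_def
proof (rule some_equality)
  show "\<alpha> \<in> M \<and> (\<exists>\<mu>'\<in>M. d \<mu>' = d \<mu> \<and> sc \<mu>' = r \<alpha> \<and> \<mu> \<cdot> \<alpha> = \<mu>' \<cdot> \<alpha>)"
    using assms by blast
  show "\<beta> = \<alpha>" if "\<beta> \<in> M \<and> (\<exists>\<mu>'\<in>M. d \<mu>' = d \<mu> \<and> sc \<mu>' = r \<beta> \<and> \<mu> \<cdot> \<alpha> = \<mu>' \<cdot> \<beta>)" for \<beta>
    using that factor_unique(2)[OF assms] by metis
qed

text \<open>
  A path of degree \<open>n\<close> reached by two prefix swaps of degrees \<open>m\<^sub>1\<close> and \<open>m\<^sub>2\<close> is either a minimal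
  common extension of shorter paths (when \<open>m\<^sub>1 \<or> m\<^sub>2 = n\<close>) or is reached by a single swap of degree
  \<open>m\<^sub>1 \<or> m\<^sub>2\<close>; so each degree contributes finitely many paths.
\<close>

lemma path_closure_layer:
  fixes E :: "'l set" and t :: nat
  assumes E: "E \<subseteq> M"
  defines "P \<equiv> {\<kappa> \<in> path_closure E. deg_sum (d \<kappa>) < t}"
  defines "X \<equiv> E \<union> (\<Union>\<kappa>\<in>P. \<Union>\<mu>\<in>P. MCE \<Lambda> \<kappa> \<mu>)"
  assumes \<tau>: "\<tau> \<in> path_closure E" "deg_sum (d \<tau>) = t"
  shows "\<tau> \<in> X \<or> (\<exists>\<kappa>\<in>P. \<exists>\<mu>\<in>P. \<exists>\<alpha>\<in>M. d \<kappa> = d \<mu> \<and> sc \<kappa> = sc \<mu> \<and> sc \<mu> = r \<alpha> \<and> \<mu> \<cdot> \<alpha> \<in> X \<and>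
    \<mu> \<cdot> \<alpha> \<in> path_closure E \<and> \<tau> = \<kappa> \<cdot> \<alpha>)"
  using \<tau>
proof (induction rule: path_closure.induct)
  case (base \<kappa>)
  then show ?case by (simp add: X_def)
next
  case (MCE \<kappa> \<mu> \<tau>)
  have m: "\<kappa> \<in> M" "\<mu> \<in> M" using MCE path_closure_mor[OF E] by auto
  have \<tau>: "\<tau> \<in> M" "d \<tau> = deg_join (d \<kappa>) (d \<mu>)" using MCE by (auto simp: MCE_def)
  obtain \<alpha> \<beta> where ab: "\<alpha> \<in> M" "sc \<kappa> = r \<alpha>" "\<tau> = \<kappa> \<cdot> \<alpha>" "\<beta> \<in> M" "sc \<mu> = r \<beta>" "\<tau> = \<mu> \<cdot> \<beta>"
    using MCE(3) m by (auto simp: MCE_iff)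
  have d: "d \<tau> = d \<kappa> + d \<alpha>" "d \<tau> = d \<mu> + d \<beta>" using ab m by (metis comp_simps(4))+
  consider "deg_sum (d \<kappa>) < t" "deg_sum (d \<mu>) < t" | "d \<alpha> = 0" | "d \<beta> = 0"
    using MCE(6) d by (metis add_cancel_left_right deg_sum_add deg_sum_eq_0_iff le_add1 nat_less_le)
  then show ?case
  proof cases
    case 1
    then show ?thesis using MCE by (auto simp: X_def P_def)
  next
    case 2
    then have "\<tau> = \<kappa>" using ab m comp_vertex by metis
    then show ?thesis using MCE by auto
  next
    case 3
    then have "\<tau> = \<mu>" using ab m comp_vertex by metis
    then show ?thesis using MCE by auto
  qed
next
  case (swap \<kappa>' \<mu>' \<alpha>')
  have m: "\<kappa>' \<in> M" "\<mu>' \<in> M" "\<mu>' \<cdot> \<alpha>' \<in> M" using swap path_closure_mor[OF E] by auto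
  have d': "d (\<kappa>' \<cdot> \<alpha>') = d \<mu>' + d \<alpha>'" "d (\<mu>' \<cdot> \<alpha>') = d \<mu>' + d \<alpha>'" using swap m by auto
  show ?case
  proof (cases "d \<alpha>' = 0")
    case True
    then have "\<kappa>' \<cdot> \<alpha>' = \<kappa>'" using swap m comp_vertex by metis
    then show ?thesis using swap by simp
  next
    case False
    then have lt: "deg_sum (d \<mu>') < t"
      using swap(11) d' by (metis add_cancel_left_right deg_sum_add deg_sum_eq_0_iff le_add1 nat_less_le)
    then have P': "\<kappa>' \<in> P" "\<mu>' \<in> P" using swap by (auto simp: P_def)
    have "deg_sum (d (\<mu>' \<cdot> \<alpha>')) = t" using swap(11) d' by simp
    from swap.IH(3)[OF this] show ?thesis
    proof
      assume "\<mu>' \<cdot> \<alpha>' \<in> X"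
      then show ?thesis using P' swap by blast
    next
      assume "\<exists>\<kappa>\<in>P. \<exists>\<mu>\<in>P. \<exists>\<alpha>\<in>M. d \<kappa> = d \<mu> \<and> sc \<kappa> = sc \<mu> \<and> sc \<mu> = r \<alpha> \<and> \<mu> \<cdot> \<alpha> \<in> X \<and>
        \<mu> \<cdot> \<alpha> \<in> path_closure E \<and> \<mu>' \<cdot> \<alpha>' = \<kappa> \<cdot> \<alpha>"
      then obtain \<kappa> \<mu> \<alpha> where s: "\<kappa> \<in> P" "\<mu> \<in> P" "\<alpha> \<in> M" "d \<kappa> = d \<mu>" "sc \<kappa> = sc \<mu>" "sc \<mu> = r \<alpha>"
        "\<mu> \<cdot> \<alpha> \<in> X" "\<mu> \<cdot> \<alpha> \<in> path_closure E" "\<mu>' \<cdot> \<alpha>' = \<kappa> \<cdot> \<alpha>" by blast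
      have ms: "\<kappa> \<in> M" "\<mu> \<in> M" using s path_closure_mor[OF E] by (auto simp: P_def)
      have ds: "d (\<kappa> \<cdot> \<alpha>) = d \<kappa> + d \<alpha>" using s ms by simp
      \<comment> \<open>The induction hypothesis exchanges the prefix \<open>\<kappa>\<close> and
        the present rule exchanges \<open>\<mu>'\<close>, both within one path. Its prefix of degree
        \<open>n\<close> is a minimal common extension of these two.\<close>
      define n where "n = deg_join (d \<kappa>) (d \<mu>')"
      have le: "n $ i \<le> d (\<kappa> \<cdot> \<alpha>) $ i" for i
        using ds d' s(9) by (simp add: n_def) (metis le_add1 vector_add_component)
      obtain \<rho> \<beta> where \<rho>: "\<rho> \<in> M" "\<beta> \<in> M" "sc \<rho> = r \<beta>" "\<kappa> \<cdot> \<alpha> = \<rho> \<cdot> \<beta>" "d \<rho> = n"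
        using factor_ex[OF _ le] s ms by (metis comp_simps(1))
      obtain \<kappa>0 \<gamma> where g: "\<kappa>0 \<in> M" "\<gamma> \<in> M" "sc \<kappa>0 = r \<gamma>" "\<rho> = \<kappa>0 \<cdot> \<gamma>" "d \<kappa>0 = d \<kappa>"
        using factor_ex[OF \<rho>(1), of "d \<kappa>"] \<rho>(5) by (auto simp: n_def)
      have g\<beta>: "sc \<gamma> = r \<beta>" using g \<rho> by (metis comp_simps(3))
      have "\<kappa>0 \<cdot> (\<gamma> \<cdot> \<beta>) = \<kappa> \<cdot> \<alpha>"
        using comp_assoc[OF g(1,2) \<rho>(2) g(3) g\<beta>] g(4) \<rho>(4) by simp
      then have e: "\<kappa>0 = \<kappa>" "\<gamma> \<cdot> \<beta> = \<alpha>"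
        using factor_unique[of \<kappa>0 "\<gamma> \<cdot> \<beta>" \<kappa> \<alpha>] comp_simps(1,2)[OF g(2) \<rho>(2) g\<beta>] g(1,3,5)
          s(3,5,6) ms(1) by metis+
      obtain \<kappa>0' \<gamma>' where g': "\<kappa>0' \<in> M" "\<gamma>' \<in> M" "sc \<kappa>0' = r \<gamma>'" "\<rho> = \<kappa>0' \<cdot> \<gamma>'" "d \<kappa>0' = d \<mu>'"
        using factor_ex[OF \<rho>(1), of "d \<mu>'"] \<rho>(5) by (auto simp: n_def)
      have g\<beta>': "sc \<gamma>' = r \<beta>" using g' \<rho> by (metis comp_simps(3))
      have "\<kappa>0' \<cdot> (\<gamma>' \<cdot> \<beta>) = \<mu>' \<cdot> \<alpha>'"
        using comp_assoc[OF g'(1,2) \<rho>(2) g'(3) g\<beta>'] g'(4) \<rho>(4) s(9) by simp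
      then have e': "\<kappa>0' = \<mu>'" "\<gamma>' \<cdot> \<beta> = \<alpha>'"
        using factor_unique[of \<kappa>0' "\<gamma>' \<cdot> \<beta>" \<mu>' \<alpha>'] comp_simps(1,2)[OF g'(2) \<rho>(2) g\<beta>'] g'(1,3,5)
          swap.hyps(6,7) m(2) by metis+
      note g = g[unfolded e(1)] and g' = g'[unfolded e'(1)]
      have \<rho>M: "\<rho> \<in> MCE \<Lambda> \<kappa> \<mu>'"
        unfolding MCE_iff[OF ms(1) m(2)] using \<rho>(5) g(2-4) g'(2-4) unfolding n_def by blast
      have cl0: "\<kappa> \<in> path_closure E" "\<mu> \<in> path_closure E" using s(1,2) by (auto simp: P_def)
      have \<rho>P: "\<rho> \<in> path_closure E"
        using path_closure.MCE[OF cl0(1) swap.hyps(2) \<rho>M] .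
      \<comment> \<open>Each exchange is carried out inside \<open>\<rho>\<close> instead of the
        whole path. The results have the same degree and source, so exchanging one for the other
        composes the two swaps into one.\<close>
      have cl: "\<mu> \<cdot> \<gamma> \<in> path_closure E" "\<kappa>' \<cdot> \<gamma>' \<in> path_closure E"
        using path_closure.swap[OF cl0(2,1) \<rho>P[unfolded g(4)] s(4)[symmetric] s(5)[symmetric] g(2,3)]
          path_closure.swap[OF swap.hyps(1,2) \<rho>P[unfolded g'(4)] swap.hyps(4,5) g'(2,3)] by auto
      have c: "sc \<mu> = r \<gamma>" "sc \<kappa>' = r \<gamma>'" using g(3) g'(3) s(5) swap.hyps(5) by simp_all
      have dn: "d (\<mu> \<cdot> \<gamma>) = n" "d (\<kappa>' \<cdot> \<gamma>') = n"
        using comp_simps(4)[OF ms(2) g(2) c(1)] comp_simps(4)[OF ms(1) g(2,3)] g(4) \<rho>(5) s(4)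
          comp_simps(4)[OF m(1) g'(2) c(2)] comp_simps(4)[OF m(2) g'(2,3)] g'(4) swap.hyps(4) by metis+
      have "\<mu>' \<cdot> \<alpha>' = \<rho> \<cdot> \<beta>" using \<rho>(4) s(9) by simp
      then have "d (\<kappa>' \<cdot> \<alpha>') = n + d \<beta>"
        using comp_simps(4)[OF \<rho>(1-3)] \<rho>(5) d' by simp
      then have t: "t = deg_sum n + deg_sum (d \<beta>)"
        using swap.prems by (simp add: deg_sum_add)
      show ?thesis
      proof (cases "d \<beta> = 0")
        case True
        then have "\<rho> \<cdot> \<beta> = \<rho>" using \<rho> comp_vertex by metis
        with \<open>\<mu>' \<cdot> \<alpha>' = \<rho> \<cdot> \<beta>\<close> have "\<mu>' \<cdot> \<alpha>' = \<rho>" by simp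
        then have "\<mu>' \<cdot> \<alpha>' \<in> X" unfolding X_def using \<rho>M s(1) P'(2) by blast
        then show ?thesis using P' swap by blast
      next
        case False
        then have "deg_sum n < t" using t deg_sum_eq_0_iff[of "d \<beta>"] by (simp del: deg_sum_eq_0_iff)
        then have "\<mu> \<cdot> \<gamma> \<in> P" "\<kappa>' \<cdot> \<gamma>' \<in> P" using cl dn by (auto simp: P_def)
        moreover have "\<mu> \<cdot> \<gamma> \<cdot> \<beta> = \<mu> \<cdot> \<alpha>" "\<kappa>' \<cdot> \<gamma>' \<cdot> \<beta> = \<kappa>' \<cdot> \<alpha>'"
          using comp_assoc[OF ms(2) g(2) \<rho>(2) c(1) g\<beta>] comp_assoc[OF m(1) g'(2) \<rho>(2) c(2) g\<beta>'] e e'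
          by simp_all
        moreover have "sc (\<mu> \<cdot> \<gamma>) = r \<beta>" "sc (\<kappa>' \<cdot> \<gamma>') = r \<beta>"
          using comp_simps(3)[OF ms(2) g(2) c(1)] comp_simps(3)[OF m(1) g'(2) c(2)] g\<beta> g\<beta>'
          by simp_all
        ultimately show ?thesis using s(7,8) dn \<rho>(2) by metis
      qed
    qed
  qed
qed

text \<open>Layers of fixed total degree are finite by induction. Only finitely many occur, because
  common extensions take joins of degrees and swaps preserve them, so any coordinatewise bound on
  \<open>E\<close> persists. The sum \<open>N\<close> of all degrees is such a bound.\<close>

lemma finite_path_closure:
  assumes E: "finite E" "E \<subseteq> M"
  shows "finite (path_closure E)"
proof -
  have fin: "finite {\<kappa> \<in> path_closure E. deg_sum (d \<kappa>) < t}" for t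
  proof (induction t)
    case (Suc t)
    define P where "P = {\<kappa> \<in> path_closure E. deg_sum (d \<kappa>) < t}"
    define X where "X = E \<union> (\<Union>\<kappa>\<in>P. \<Union>\<mu>\<in>P. MCE \<Lambda> \<kappa> \<mu>)"
    have P: "finite P" using Suc by (simp add: P_def)
    have PM: "P \<subseteq> M" using path_closure_mor[OF E(2)] by (auto simp: P_def)
    have X: "finite X" unfolding X_def using P E finite_MCE subsetD[OF PM] by (intro finite_UnI finite_UN_I) auto
    have "{\<kappa> \<in> path_closure E. deg_sum (d \<kappa>) < Suc t} \<subseteq>
        P \<union> X \<union> (\<lambda>(\<kappa>, \<sigma>). \<kappa> \<cdot> tail \<sigma> (d \<kappa>)) ` (P \<times> X)" (is "_ \<subseteq> ?R")
    proof
      fix \<tau> assume \<tau>: "\<tau> \<in> {\<kappa> \<in> path_closure E. deg_sum (d \<kappa>) < Suc t}"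
      show "\<tau> \<in> ?R"
      proof (cases "deg_sum (d \<tau>) < t")
        case True
        then show ?thesis using \<tau> by (simp add: P_def)
      next
        case False
        then have "deg_sum (d \<tau>) = t" using \<tau> by simp
        moreover have "\<tau> \<in> path_closure E" using \<tau> by simp
        ultimately have "\<tau> \<in> X \<or> (\<exists>\<kappa>\<in>P. \<exists>\<mu>\<in>P. \<exists>\<alpha>\<in>M. d \<kappa> = d \<mu> \<and> sc \<kappa> = sc \<mu> \<and> sc \<mu> = r \<alpha> \<and>
            \<mu> \<cdot> \<alpha> \<in> X \<and> \<mu> \<cdot> \<alpha> \<in> path_closure E \<and> \<tau> = \<kappa> \<cdot> \<alpha>)"
          using path_closure_layer[OF E(2), of \<tau> t] unfolding P_def X_def by simp
        then show ?thesis
        proof (elim disjE bexE conjE)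
          fix \<kappa> \<mu> \<alpha>
          assume *: "\<kappa> \<in> P" "\<mu> \<in> P" "\<alpha> \<in> M" "d \<kappa> = d \<mu>" "sc \<mu> = r \<alpha>" "\<mu> \<cdot> \<alpha> \<in> X" "\<tau> = \<kappa> \<cdot> \<alpha>"
          then have "tail (\<mu> \<cdot> \<alpha>) (d \<kappa>) = \<alpha>" using tail_comp[of \<mu> \<alpha>] PM by auto
          then have "\<tau> = (\<lambda>(\<kappa>, \<sigma>). \<kappa> \<cdot> tail \<sigma> (d \<kappa>)) (\<kappa>, \<mu> \<cdot> \<alpha>)" using *(7) by simp
          then show ?thesis using *(1,6) by blast
        qed simp
      qed
    qed
    moreover have "finite (P \<union> X \<union> (\<lambda>(\<kappa>, \<sigma>). \<kappa> \<cdot> tail \<sigma> (d \<kappa>)) ` (P \<times> X))"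
      using P X by simp
    ultimately show ?case by (rule finite_subset)
  qed simp
  define N where "N = (\<chi> i. \<Sum>\<kappa>\<in>E. d \<kappa> $ i)"
  have "d \<kappa> $ i \<le> N $ i" if "\<kappa> \<in> E" for \<kappa> i
    using member_le_sum[OF that, of "\<lambda>\<kappa>. d \<kappa> $ i"] E by (simp add: N_def)
  then have "deg_sum (d \<kappa>) \<le> deg_sum N" if "\<kappa> \<in> path_closure E" for \<kappa>
    using path_closure_deg[OF E(2) _ that] by (auto intro: deg_sum_mono)
  then have "path_closure E \<subseteq> {\<kappa> \<in> path_closure E. deg_sum (d \<kappa>) < Suc (deg_sum N)}"
    by (auto simp: less_Suc_eq_le)
  then show ?thesis using fin finite_subset by blast
qed

end


section \<open>Toeplitz-Cuntz-Krieger families\<close>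

lemma mult_cstar_of_type: "mult cstar_of_type = (*)"
  by (simp add: cstar_of_type_def)

lemma finsum_cstar_of_type:
  "finite A \<Longrightarrow> finsum (cstar_of_type :: 'b::cstar_algebra cstar_struct) f A = sum f A"
proof (induction A rule: finite_induct)
  case (insert x A)
  interpret abelian_group "cstar_of_type :: 'b cstar_struct"
    by (rule abelian_group_cstar_of_type)
  show ?case using insert by simp
next
  case empty
  interpret abelian_group "cstar_of_type :: 'b cstar_struct"
    by (rule abelian_group_cstar_of_type)
  show ?case by simp
qed

text \<open>
  An order-free form of the Cuntz-Krieger relation at \<open>E \<subseteq> v\<Lambda>\<close>: the product of the
  \<open>T\<^sub>v - T\<^sub>e T\<^sub>e\<^sup>*\<close> vanishes iff \<open>T\<^sub>v\<close> is killed by whatever kills all \<open>T\<^sub>e\<close>.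
\<close>

definition covers :: "('l \<Rightarrow> 'a::cstar_algebra) \<Rightarrow> 'l \<Rightarrow> 'l set \<Rightarrow> bool" where
  "covers T v E \<longleftrightarrow> (\<forall>y. (\<forall>e\<in>E. y * T e = 0) \<longrightarrow> y * T v = 0)"

locale tck_family = fa_kgraph \<Lambda> for \<Lambda> :: "('l, 'k::finite) kgraph" +
  fixes T :: "'l \<Rightarrow> 'a::cstar_algebra"
  assumes tck: "TCK_family \<Lambda> cstar_of_type T"
begin

lemma T_vertex: "v \<in> vertices \<Lambda> \<Longrightarrow> star (T v) = T v" "v \<in> vertices \<Lambda> \<Longrightarrow> T v * T v = T v"
  using tck by (auto simp: TCK_family_def)

lemma T_orth: "v \<in> vertices \<Lambda> \<Longrightarrow> w \<in> vertices \<Lambda> \<Longrightarrow> v \<noteq> w \<Longrightarrow> T v * T w = 0"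
  using tck by (auto simp: TCK_family_def)

lemma T_mult: "\<mu> \<in> M \<Longrightarrow> \<nu> \<in> M \<Longrightarrow> sc \<mu> = r \<nu> \<Longrightarrow> T \<mu> * T \<nu> = T (\<mu> \<cdot> \<nu>)"
  using tck by (auto simp: TCK_family_def)

lemma T_range: "\<mu> \<in> M \<Longrightarrow> T (r \<mu>) * T \<mu> = T \<mu>"
  using T_mult[of "r \<mu>" \<mu>] by simp

lemma T_source: "\<mu> \<in> M \<Longrightarrow> T \<mu> * T (sc \<mu>) = T \<mu>"
  using T_mult[of \<mu> "sc \<mu>"] by simp

lemma T_star_mult:
  assumes "\<mu> \<in> M" "\<nu> \<in> M"
  shows "star (T \<mu>) * T \<nu> = (\<Sum>p\<in>Lmin \<Lambda> \<mu> \<nu>. T (fst p) * star (T (snd p)))"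
proof -
  have "star (T \<mu>) * T \<nu> = finsum cstar_of_type (\<lambda>p. T (fst p) * star (T (snd p))) (Lmin \<Lambda> \<mu> \<nu>)"
    using tck assms by (simp add: TCK_family_def)
  then show ?thesis using finsum_cstar_of_type finite_Lmin assms by metis
qed

lemma T_isometry: "\<mu> \<in> M \<Longrightarrow> star (T \<mu>) * T \<mu> = T (sc \<mu>)"
  using T_star_mult[of \<mu> \<mu>] T_vertex by (simp add: Lmin_self)

lemma T_star_mult_same_deg:
  "\<mu> \<in> M \<Longrightarrow> \<nu> \<in> M \<Longrightarrow> d \<mu> = d \<nu> \<Longrightarrow> \<mu> \<noteq> \<nu> \<Longrightarrow> star (T \<mu>) * T \<nu> = 0"
  by (simp add: T_star_mult Lmin_same_deg)

lemma T_partial_isometry: "\<mu> \<in> M \<Longrightarrow> T \<mu> * star (T \<mu>) * T \<mu> = T \<mu>"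
  by (simp add: mult.assoc T_isometry T_source)

lemma T_mult_star_mult:
  assumes "\<kappa> \<in> M" "\<mu> \<in> M" "\<sigma> \<in> M" "\<tau> \<in> M" "sc \<kappa> = sc \<mu>" "sc \<sigma> = sc \<tau>"
  shows "T \<kappa> * star (T \<mu>) * (T \<sigma> * star (T \<tau>)) =
    (\<Sum>p\<in>Lmin \<Lambda> \<mu> \<sigma>. T (\<kappa> \<cdot> fst p) * star (T (\<tau> \<cdot> snd p)))"
proof -
  have "T \<kappa> * star (T \<mu>) * (T \<sigma> * star (T \<tau>)) = T \<kappa> * (star (T \<mu>) * T \<sigma>) * star (T \<tau>)"
    by (simp add: mult.assoc)
  also have "\<dots> = (\<Sum>p\<in>Lmin \<Lambda> \<mu> \<sigma>. T \<kappa> * T (fst p) * star (T \<tau> * T (snd p)))"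
    by (simp add: T_star_mult assms(2,3) sum_distrib_left sum_distrib_right star_mult mult.assoc)
  also have "\<dots> = (\<Sum>p\<in>Lmin \<Lambda> \<mu> \<sigma>. T (\<kappa> \<cdot> fst p) * star (T (\<tau> \<cdot> snd p)))"
  proof (rule sum.cong[OF refl])
    fix p assume "p \<in> Lmin \<Lambda> \<mu> \<sigma>"
    then have "fst p \<in> M" "snd p \<in> M" "sc \<mu> = r (fst p)" "sc \<sigma> = r (snd p)"
      using LminE assms(2,3) by metis+
    then show "T \<kappa> * T (fst p) * star (T \<tau> * T (snd p)) = T (\<kappa> \<cdot> fst p) * star (T (\<tau> \<cdot> snd p))"
      using T_mult[of \<kappa> "fst p"] T_mult[of \<tau> "snd p"] assms by metis
  qed
  finally show ?thesis .
qed

section \<open>Spanning elements and their grading\<close>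

definition gens :: "('l \<times> 'l) set" where
  "gens = {p \<in> M \<times> M. sc (fst p) = sc (snd p)}"

definition G :: "'l \<times> 'l \<Rightarrow> 'a" where "G p = T (fst p) * star (T (snd p))"

lemma star_G: "star (G p) = G (snd p, fst p)"
  by (simp add: G_def star_mult star_star)

lemma T_eq_G: "\<mu> \<in> M \<Longrightarrow> T \<mu> = G (\<mu>, sc \<mu>)"
  by (simp add: G_def T_vertex T_source)

definition deg_diff :: "'l \<times> 'l \<Rightarrow> 'k \<Rightarrow> int" where
  "deg_diff p i = int (d (fst p) $ i) - int (d (snd p) $ i)"

text \<open>These play the role of the spectral subspaces of a gauge action, but are defined as
  spans so that no action on this algebra is presupposed.\<close>

definition homogeneous :: "('k \<Rightarrow> int) \<Rightarrow> 'a set" where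
  "homogeneous m = cvs.span (G ` {p \<in> gens. deg_diff p = m})"

text \<open>The tails supplied by \<open>Lmin\<close> extend \<open>snd p\<close> and
  \<open>fst q\<close> to a common path, so they contribute exactly the difference needed for the
  degree differences to add.\<close>

lemma G_mult:
  assumes p: "p \<in> gens" and q: "q \<in> gens"
  shows "G p * G q \<in> homogeneous (\<lambda>i. deg_diff p i + deg_diff q i)"
proof -
  have p': "fst p \<in> M" "snd p \<in> M" "sc (fst p) = sc (snd p)" using p by (auto simp: gens_def)
  have q': "fst q \<in> M" "snd q \<in> M" "sc (fst q) = sc (snd q)" using q by (auto simp: gens_def)
  have "G p * G q = (\<Sum>t\<in>Lmin \<Lambda> (snd p) (fst q). G (fst p \<cdot> fst t, snd q \<cdot> snd t))"
    using T_mult_star_mult[OF p'(1,2) q'(1,2) p'(3) q'(3)] by (simp add: G_def)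
  also have "\<dots> \<in> homogeneous (\<lambda>i. deg_diff p i + deg_diff q i)"
    unfolding homogeneous_def
  proof (intro cvs.span_sum cvs.span_base imageI)
    fix t assume t: "t \<in> Lmin \<Lambda> (snd p) (fst q)"
    have t': "fst t \<in> M" "snd t \<in> M" "sc (snd p) = r (fst t)" "sc (fst q) = r (snd t)"
      "d (snd p) + d (fst t) = deg_join (d (snd p)) (d (fst q))"
      "d (fst q) + d (snd t) = deg_join (d (snd p)) (d (fst q))" "sc (fst t) = sc (snd t)"
      using LminE[OF t p'(2) q'(1)] by blast+
    have c: "sc (fst p) = r (fst t)" "sc (snd q) = r (snd t)" using p'(3) q'(3) t'(3,4) by simp_all
    note c1 = comp_simps[OF p'(1) t'(1) c(1)] and c2 = comp_simps[OF q'(2) t'(2) c(2)]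
    have "d (snd p) $ i + d (fst t) $ i = d (fst q) $ i + d (snd t) $ i" for i
      using t'(5,6) by (metis vector_add_component)
    then have "deg_diff (fst p \<cdot> fst t, snd q \<cdot> snd t) i = deg_diff p i + deg_diff q i" for i
      using arg_cong[of _ _ int] by (simp add: deg_diff_def c1(4) c2(4)) (smt (verit) of_nat_add)
    then show "(fst p \<cdot> fst t, snd q \<cdot> snd t) \<in> {t \<in> gens. deg_diff t = (\<lambda>i. deg_diff p i + deg_diff q i)}"
      using c1(1,3) c2(1,3) t'(7) by (auto simp: gens_def)
  qed
  finally show ?thesis .
qed

lemma homogeneous_subset: "homogeneous m \<subseteq> cvs.span (G ` gens)"
  unfolding homogeneous_def by (intro cvs.span_mono) auto

lemma span_G_mult:
  assumes "x \<in> cvs.span (G ` gens)" "y \<in> cvs.span (G ` gens)"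
  shows "x * y \<in> cvs.span (G ` gens)"
  by (rule span_mult[OF assms]) (use G_mult homogeneous_subset in blast)

lemma span_G_star:
  assumes "x \<in> cvs.span (G ` gens)"
  shows "star x \<in> cvs.span (G ` gens)"
proof (rule span_star[OF assms])
  fix a assume "a \<in> G ` gens"
  then obtain p where p: "p \<in> gens" "a = G p" by auto
  then have "star a = G (snd p, fst p)" "(snd p, fst p) \<in> gens" by (auto simp: star_G gens_def)
  then show "star a \<in> cvs.span (G ` gens)" by (intro cvs.span_base) simp
qed

section \<open>Range projections and gap projections\<close>

definition P :: "'l \<Rightarrow> 'a" where "P e = T e * star (T e)"

lemma P_mult:
  assumes "e \<in> M" "f \<in> M"
  shows "P e * P f = (\<Sum>p\<in>Lmin \<Lambda> e f. P (e \<cdot> fst p))"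
  unfolding P_def T_mult_star_mult[OF assms(1,1,2,2) refl refl]
  by (rule sum.cong[OF refl]) (metis LminE assms)

lemma star_P: "star (P e) = P e"
  by (simp add: P_def star_mult star_star)

text \<open>The expansion of the product over \<open>Lmin\<close> is a sum of self-adjoint elements,
  hence self-adjoint.\<close>

lemma P_commute:
  assumes "e \<in> M" "f \<in> M"
  shows "P e * P f = P f * P e"
proof -
  have "star (P e * P f) = P e * P f"
    unfolding P_mult[OF assms] by (simp add: star_sum star_P)
  then show ?thesis by (simp add: star_mult star_P)
qed

lemma P_idem: "e \<in> M \<Longrightarrow> P e * P e = P e"
  by (simp add: P_def T_partial_isometry flip: mult.assoc)

lemma P_range:
  assumes "e \<in> M"
  shows "T (r e) * P e = P e" "P e * T (r e) = P e"
proof -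
  show *: "T (r e) * P e = P e" using assms by (simp add: P_def T_range flip: mult.assoc)
  show "P e * T (r e) = P e" using arg_cong[OF *, of star] assms by (simp add: star_mult star_P T_vertex)
qed

text \<open>With the vertex as an explicit argument the empty product is \<open>T v\<close>. This
  case does occur later, for a path without proper extensions in the given finite set.\<close>

definition gap :: "'l \<Rightarrow> 'l list \<Rightarrow> 'a" where
  "gap v es = foldr (\<lambda>e x. (T v - P e) * x) es (T v)"

lemma gap_simps [simp]: "gap v [] = T v" "gap v (e # es) = (T v - P e) * gap v es"
  by (simp_all add: gap_def)

context
  fixes v assumes v: "v \<in> vertices \<Lambda>"
begin

lemma gap_vertex:
  assumes "set es \<subseteq> into \<Lambda> v M"
  shows "T v * gap v es = gap v es" "gap v es * T v = gap v es"
proof -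
  show "T v * gap v es = gap v es"
    using assms
  proof (induction es)
    case (Cons e es)
    have e: "e \<in> M" "r e = v" using Cons by (auto simp: into_def)
    have "T v * (T v - P e) = T v - P e"
      using P_range[OF e(1)] T_vertex[OF v] e(2) by (simp add: right_diff_distrib)
    then show ?case by (metis gap_simps(2) mult.assoc)
  qed (simp add: T_vertex v)
  show "gap v es * T v = gap v es"
    by (induction es) (simp_all add: T_vertex v mult.assoc)
qed

lemma gap_P_commute:
  assumes "set es \<subseteq> into \<Lambda> v M" "f \<in> into \<Lambda> v M"
  shows "gap v es * P f = P f * gap v es"
  using assms(1)
proof (induction es)
  case (Cons e es)
  have e: "e \<in> M" "r e = v" and f: "f \<in> M" "r f = v" using Cons assms by (auto simp: into_def)
  have "(T v - P e) * P f = P f * (T v - P e)"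
    using P_range[OF f(1)] f(2) P_commute[OF e(1) f(1)]
    by (simp add: right_diff_distrib left_diff_distrib)
  moreover have "gap v es * P f = P f * gap v es" using Cons by simp
  ultimately show ?case by (metis gap_simps(2) mult.assoc)
next
  case Nil
  then show ?case using P_range assms(2) by (auto simp: into_def)
qed

lemma gap_annihilates:
  assumes "set es \<subseteq> into \<Lambda> v M" "f \<in> set es"
  shows "gap v es * T f = 0"
  using assms
proof (induction es)
  case (Cons e es)
  have f: "f \<in> into \<Lambda> v M" using Cons by auto
  show ?case
  proof (cases "f \<in> set es")
    case True
    then have "gap v es * T f = 0" using Cons by simp
    then show ?thesis by (simp add: mult.assoc)
  next
    case False
    then have e: "e = f" using Cons by simp
    have fM: "f \<in> M" "r f = v" using f by (auto simp: into_def)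
    have "(T v - P f) * P f = 0"
      using P_range[OF fM(1)] fM(2) P_idem[OF fM(1)] by (simp add: left_diff_distrib)
    \<comment> \<open>Since \<open>T f\<close> equals \<open>P f * T f\<close>, the projection
      \<open>P f\<close> can be moved to the front past the remaining factors, where it meets
      \<open>T v - P f\<close> and is annihilated.\<close>
    moreover have "gap v es * T f = P f * gap v es * T f"
      using gap_P_commute[of es f] T_partial_isometry[OF fM(1)] f Cons
      by (metis P_def mult.assoc set_subset_Cons subset_trans)
    ultimately show ?thesis
      by (metis e gap_simps(2) mult.assoc mult_zero_left)
  qed
qed simp

lemma gap_absorb:
  assumes "set es \<subseteq> into \<Lambda> v M" "\<And>e. e \<in> set es \<Longrightarrow> y * T e = 0"
  shows "y * gap v es = y * T v"
  using assms
proof (induction es)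
  case (Cons e es)
  have "y * P e = 0" using Cons by (simp add: P_def flip: mult.assoc)
  then have "y * gap v (e # es) = y * (T v * gap v es)"
    by (simp add: left_diff_distrib right_diff_distrib flip: mult.assoc)
  then show ?case using gap_vertex Cons by simp
qed simp

text \<open>The gap itself kills every \<open>T e\<close>, which makes it the critical test element
  for \<open>covers\<close>. Conversely \<open>y * gap v es\<close> collapses to
  \<open>y * T v\<close> whenever \<open>y\<close> kills every \<open>T e\<close>.\<close>

lemma gap_eq_0_iff:
  assumes "set es \<subseteq> into \<Lambda> v M"
  shows "gap v es = 0 \<longleftrightarrow> covers T v (set es)"
  using gap_absorb[OF assms] gap_annihilates[OF assms] gap_vertex[OF assms]
  unfolding covers_def by (metis mult_zero_right)

text \<open>Expanding the gap produces products of range projections, which closure under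
  \<open>MCE\<close> keeps in the span. In particular a vanishing gap places \<open>T v\<close>
  itself in that span.\<close>

lemma gap_span:
  assumes "set es \<subseteq> A" "A \<subseteq> into \<Lambda> v M" "\<And>\<alpha> \<beta>. \<alpha> \<in> A \<Longrightarrow> \<beta> \<in> A \<Longrightarrow> MCE \<Lambda> \<alpha> \<beta> \<subseteq> A"
  shows "T v - gap v es \<in> cvs.span (P ` A)"
  using assms(1)
proof (induction es)
  case (Cons e es)
  then have IH: "T v - gap v es \<in> cvs.span (P ` A)" and e: "e \<in> A" by auto
  have eM: "e \<in> M" "r e = v" using e assms by (auto simp: into_def)
  have Pe: "P e \<in> cvs.span (P ` A)" using e by (intro cvs.span_base) simp
  have "P e * (T v - gap v es) \<in> cvs.span (P ` A)"
  proof (rule span_mult[OF cvs.span_base IH])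
    show "P e \<in> {P e}" by simp
    fix a b assume "a \<in> {P e}" "b \<in> P ` A"
    then obtain f where f: "f \<in> A" "a * b = P e * P f" by auto
    have fM: "f \<in> M" using f assms by (auto simp: into_def)
    have "e \<cdot> fst p \<in> A" if "p \<in> Lmin \<Lambda> e f" for p
      using that assms(3)[OF e f(1)] by (auto simp: Lmin_def)
    then show "a * b \<in> cvs.span (P ` A)"
      unfolding f(2) P_mult[OF eM(1) fM] by (intro cvs.span_sum cvs.span_base) simp
  qed
  moreover have "T v - gap v (e # es) = (T v - gap v es) + (P e - P e * (T v - gap v es))"
    using gap_vertex(1)[of es] P_range[OF eM(1)] eM(2) subset_trans[OF _ assms(2), of "set es"] Cons.prems
    by (simp add: left_diff_distrib right_diff_distrib)
  ultimately show ?case using IH Pe by (metis cvs.span_add cvs.span_diff)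
qed (simp add: cvs.span_zero)

end

lemma set_rng_eq:
  assumes "E \<noteq> {}" "E \<subseteq> into \<Lambda> v M"
  shows "set_rng \<Lambda> E = v"
proof -
  have "r ` E = {v}" using assms by (auto simp: into_def)
  then show ?thesis by (simp add: set_rng_def)
qed

lemma gap_projection_eq_0_iff:
  assumes "v \<in> vertices \<Lambda>" "finite E" "E \<noteq> {}" "E \<subseteq> into \<Lambda> v M"
  shows "gap_projection \<Lambda> cstar_of_type T E = 0 \<longleftrightarrow> covers T v E"
proof -
  define es where "es = (SOME es. distinct es \<and> set es = E)"
  have "distinct es \<and> set es = E"
    unfolding es_def by (rule someI_ex) (use finite_distinct_list[OF assms(2)] in blast)
  moreover have "gap_projection \<Lambda> cstar_of_type T E = gap v es"
    unfolding gap_projection_def set_rng_eq[OF assms(3,4)] gap_def es_def P_def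
    by (simp add: mult_cstar_of_type)
  ultimately show ?thesis using gap_eq_0_iff[OF assms(1)] assms(4) by metis
qed

text \<open>If \<open>\<mu>\<close> had no common extension with any member of \<open>E\<close>,
  then \<open>star (T \<mu>)\<close> would kill all \<open>T e\<close> and hence \<open>T v\<close>.
  This makes \<open>T \<mu>\<close> and the vertex projection at its source vanish.\<close>

lemma covers_exhaustive:
  assumes "v \<in> vertices \<Lambda>" "\<forall>v\<in>vertices \<Lambda>. T v \<noteq> 0" "E \<subseteq> into \<Lambda> v M" "covers T v E"
  shows "exhaustive \<Lambda> v E"
  unfolding exhaustive_def
proof (intro conjI ballI assms(3), rule ccontr)
  fix \<mu> assume \<mu>: "\<mu> \<in> into \<Lambda> v M" and "\<not> (\<exists>\<nu>\<in>E. Lmin \<Lambda> \<mu> \<nu> \<noteq> {})"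
  have \<mu>M: "\<mu> \<in> M" "r \<mu> = v" using \<mu> by (auto simp: into_def)
  have "star (T \<mu>) * T e = 0" if "e \<in> E" for e
  proof -
    have "e \<in> M" "Lmin \<Lambda> \<mu> e = {}"
      using that assms(3) \<open>\<not> (\<exists>\<nu>\<in>E. Lmin \<Lambda> \<mu> \<nu> \<noteq> {})\<close> by (auto simp: into_def)
    then show ?thesis by (simp add: T_star_mult[OF \<mu>M(1)])
  qed
  then have "star (T \<mu>) * T v = 0" using assms(4) by (simp add: covers_def)
  then have "T v * T \<mu> = 0"
    using arg_cong[of _ _ star] by (metis T_vertex(1) assms(1) star_mult star_star star_zero)
  then have "T \<mu> = 0" using T_range \<mu>M by metis
  then have "T (sc \<mu>) = 0" using T_isometry \<mu>M by (metis mult_zero_right)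
  then show False using assms(2) \<mu>M by simp
qed

text \<open>The relation at \<open>E\<close> is tested on \<open>y * star (T f)\<close>: moving
  \<open>star (T f)\<close> past \<open>T e\<close> leaves only terms that begin with a member of
  \<open>Ext \<Lambda> f E\<close>.\<close>

lemma covers_Ext:
  assumes f: "f \<in> M" "r f = v" and E: "E \<subseteq> into \<Lambda> v M" and "covers T v E"
  shows "covers T (sc f) (Ext \<Lambda> f E)"
  unfolding covers_def
proof (intro allI impI)
  fix y assume y: "\<forall>g\<in>Ext \<Lambda> f E. y * T g = 0"
  have "y * star (T f) * T e = 0" if e: "e \<in> E" for e
  proof -
    have eM: "e \<in> M" using e E by (auto simp: into_def)
    have "y * star (T f) * T e = (\<Sum>p\<in>Lmin \<Lambda> f e. y * T (fst p) * star (T (snd p)))"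
      by (simp add: mult.assoc T_star_mult[OF f(1) eM] sum_distrib_left)
    also have "\<dots> = 0"
    proof (rule sum.neutral, rule ballI)
      fix p assume p: "p \<in> Lmin \<Lambda> f e"
      then have "fst p \<in> Ext \<Lambda> f E"
        using e by (auto simp: Ext_def Lmin_def into_def)
      then show "y * T (fst p) * star (T (snd p)) = 0" using y by simp
    qed
    finally show ?thesis .
  qed
  then have "y * star (T f) * T v = 0" using assms(4) by (simp add: covers_def)
  then have "y * (star (T f) * (T v * T f)) = 0" by (metis mult.assoc mult_zero_left)
  then show "y * T (sc f) = 0" using T_range T_isometry f by metis
qed

text \<open>The relation is checked locally: for \<open>g\<close> in
  \<open>Ext \<Lambda> f E\<close> the path \<open>f \<cdot> g\<close> factors through a member of
  \<open>E\<close>, so \<open>y * T f\<close> kills \<open>T g\<close>.\<close>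

lemma covers_of_Ext:
  assumes F: "F \<subseteq> into \<Lambda> v M" and E: "E \<subseteq> into \<Lambda> v M" and "covers T v F"
    and "\<And>f. f \<in> F \<Longrightarrow> covers T (sc f) (Ext \<Lambda> f E)"
  shows "covers T v E"
  unfolding covers_def
proof (intro allI impI)
  fix y assume y: "\<forall>e\<in>E. y * T e = 0"
  have "y * T f = 0" if f: "f \<in> F" for f
  proof -
    have fM: "f \<in> M" using f F by (auto simp: into_def)
    have "y * T f * T g = 0" if gE: "g \<in> Ext \<Lambda> f E" for g
    proof -
      obtain e where e: "e \<in> E" "f \<cdot> g \<in> MCE \<Lambda> f e" and g: "g \<in> M" "r g = sc f"
        using gE by (auto simp: Ext_def into_def)
      have eM: "e \<in> M" using e E by (auto simp: into_def)
      obtain \<beta> where \<beta>: "\<beta> \<in> M" "sc e = r \<beta>" "f \<cdot> g = e \<cdot> \<beta>"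
        using e(2) unfolding MCE_iff[OF fM eM] by blast
      have "y * T f * T g = y * T e * T \<beta>"
        using T_mult[OF fM g(1)] T_mult[OF eM \<beta>(1,2)] g(2) \<beta>(3) by (simp add: mult.assoc)
      then show ?thesis using y e by simp
    qed
    then have "y * T f * T (sc f) = 0" using assms(4)[OF f] by (simp add: covers_def)
    then show ?thesis using T_source[OF fM] by (simp add: mult.assoc)
  qed
  then show "y * T v = 0" using assms(3) by (simp add: covers_def)
qed

end

section \<open>Transfer of the Cuntz-Krieger relations from \<open>S\<close> to
  \<open>s\<close>\<close>

context fa_kgraph
begin

lemma finite_Ext:
  assumes "f \<in> M" "finite E" "E \<subseteq> M"
  shows "finite (Ext \<Lambda> f E)"
proof (rule finite_subset)
  show "Ext \<Lambda> f E \<subseteq> (\<Union>e\<in>E. fst ` Lmin \<Lambda> f e)"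
  proof
    fix g assume "g \<in> Ext \<Lambda> f E"
    then obtain e where e: "e \<in> E" "f \<cdot> g \<in> MCE \<Lambda> f e" and g: "g \<in> M" "r g = sc f"
      by (auto simp: Ext_def into_def)
    have eM: "e \<in> M" using e assms by auto
    obtain \<beta> where "\<beta> \<in> M" "sc e = r \<beta>" "f \<cdot> g = e \<cdot> \<beta>"
      using e(2) unfolding MCE_iff[OF assms(1) eM] by blast
    then have "(g, \<beta>) \<in> Lmin \<Lambda> f e" using e g by (simp add: Lmin_def)
    then show "g \<in> (\<Union>e\<in>E. fst ` Lmin \<Lambda> f e)" using e(1) by force
  qed
  show "finite (\<Union>e\<in>E. fst ` Lmin \<Lambda> f e)"
    using assms finite_Lmin by (intro finite_UN_I) auto
qed

lemma FE_edgesD: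
  assumes "E \<in> FE_edges \<Lambda>"
  obtains v where "v \<in> vertices \<Lambda>" "finite E" "E \<noteq> {}" "E \<subseteq> into \<Lambda> v M"
proof -
  obtain v where v: "v \<in> vertices \<Lambda>" "finite E" "E \<subseteq> into \<Lambda> v M - {v}" "exhaustive \<Lambda> v E"
    using assms by (auto simp: FE_edges_def FE_def)
  have "v \<in> into \<Lambda> v M" using vertexD[OF v(1)] by (simp add: into_def)
  then have "E \<noteq> {}" using v(4) by (auto simp: exhaustive_def)
  then show ?thesis using that v by blast
qed

text \<open>
  Every element of \<open>E\<close> passes through one of its initial edges, so the set \<open>F\<close> of initial edges
  inherits the relation from \<open>E\<close> and contains a member of \<open>\<E>\<close>.  Passing to \<open>Ext(f;E)\<close> for
  \<open>f \<in> F\<close> lowers the join of the degrees, which makes the induction work.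
\<close>

lemma covers_transfer:
  fixes s :: "'l \<Rightarrow> 'a::cstar_algebra" and S :: "'l \<Rightarrow> 'b::cstar_algebra"
  assumes \<E>: "\<E> \<subseteq> FE_edges \<Lambda>"
    and s: "relative_CK_family \<Lambda> \<E> cstar_of_type s"
    and S: "TCK_family \<Lambda> cstar_of_type S"
    and G1: "\<forall>v\<in>vertices \<Lambda>. S v \<noteq> 0"
    and G2: "\<forall>E\<in>FE_edges \<Lambda> - edge_satiation \<Lambda> \<E>. gap_projection \<Lambda> cstar_of_type S E \<noteq> 0"
    and E: "v \<in> vertices \<Lambda>" "finite E" "E \<subseteq> into \<Lambda> v M" "covers S v E"
  shows "covers s v E"
proof -
  interpret s: tck_family \<Lambda> s
    using s by unfold_locales (simp add: relative_CK_family_def)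
  interpret S: tck_family \<Lambda> S by unfold_locales (rule S)
  \<comment> \<open>The induction carries an upper bound \<open>L\<close> for the degrees rather
    than their join. A bound for \<open>Ext \<Lambda> f E\<close> is then obtained by subtracting
    the degree of \<open>f\<close>.\<close>
  have "covers s v E"
    if "v \<in> vertices \<Lambda>" "finite E" "E \<subseteq> into \<Lambda> v M" "covers S v E" "\<And>e i. e \<in> E \<Longrightarrow> d e $ i \<le> L $ i"
    for v E L
    using that
  proof (induction "deg_sum L" arbitrary: L v E rule: less_induct)
    case less
    show ?case
    \<comment> \<open>The vertex is the only possible member of \<open>E\<close> without an initial
      edge; when it is present the relation is immediate.\<close>
    proof (cases "v \<in> E")
      case True
      then show ?thesis by (simp add: covers_def)
    next
      case False
      have EM: "E \<subseteq> M" using less(4) by (auto simp: into_def)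
      define F where "F = {f \<in> into \<Lambda> v (edges \<Lambda>). \<exists>e\<in>E. \<exists>\<beta>\<in>M. sc f = r \<beta> \<and> e = f \<cdot> \<beta>}"
      have Fv: "F \<subseteq> into \<Lambda> v M" and Fe: "F \<subseteq> edges \<Lambda>"
        by (auto simp: F_def edges_def into_def)
      have "F \<subseteq> (\<lambda>(e, i). initial \<Lambda> e (axis i 1)) ` (E \<times> UNIV)"
      proof
        fix f assume "f \<in> F"
        then obtain e \<beta> i where f: "f \<in> M" "d f = axis i 1" "e \<in> E" "\<beta> \<in> M" "sc f = r \<beta>" "e = f \<cdot> \<beta>"
          by (auto simp: F_def into_def edges_def)
        then have "f = (\<lambda>(e, i). initial \<Lambda> e (axis i 1)) (e, i)"
          using initial_comp[of f \<beta>] by simp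
        then show "f \<in> (\<lambda>(e, i). initial \<Lambda> e (axis i 1)) ` (E \<times> UNIV)" using f(3) by blast
      qed
      then have finF: "finite F" by (rule finite_subset) (use less(3) in simp)
      have cF: "covers S v F"
        unfolding covers_def
      proof (intro allI impI)
        fix y assume y: "\<forall>f\<in>F. y * S f = 0"
        have "y * S e = 0" if e: "e \<in> E" for e
        proof -
          have eM: "e \<in> M" "r e = v" using e less(4) by (auto simp: into_def)
          have "d e \<noteq> 0" using vertexD(2)[OF vertexI[OF eM(1)]] eM False e by auto
          then obtain i where i: "d e $ i \<noteq> 0" by (auto simp: vec_eq_iff)
          have "axis i 1 $ j \<le> d e $ j" for j using i by (simp add: axis_def)
          then obtain f \<beta> where f: "f \<in> M" "\<beta> \<in> M" "sc f = r \<beta>" "e = f \<cdot> \<beta>" "d f = axis i 1"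
            using factor_ex[OF eM(1)] by metis
          have "r f = v" using comp_simps(2)[OF f(1-3)] f(4) eM(2) by simp
          then have "f \<in> F" using f e unfolding F_def into_def edges_def by blast
          moreover have "S e = S f * S \<beta>" using S.T_mult[OF f(1-3)] f(4) by simp
          ultimately show ?thesis using y by (simp flip: mult.assoc)
        qed
        then show "y * S v = 0" using less(5) by (simp add: covers_def)
      qed
      have exh: "exhaustive \<Lambda> v F" by (rule S.covers_exhaustive[OF less(2) G1 Fv cF])
      have "axis i (1::nat) \<noteq> 0" for i :: 'k by (metis axis_nth one_neq_zero zero_index)
      then have "v \<notin> F" using Fe vertexD(4)[OF less(2)] by (auto simp: edges_def)
      then have FE: "F \<in> FE_edges \<Lambda>"
        using finF Fv Fe exh less(2) by (auto simp: FE_edges_def FE_def)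
      have "gap_projection \<Lambda> cstar_of_type S F = 0"
      proof -
        have "F \<noteq> {}" using FE_edgesD[OF FE] by metis
        then show ?thesis using S.gap_projection_eq_0_iff[OF less(2) finF _ Fv] cF by simp
      qed
      \<comment> \<open>Here nonvanishing of the gaps of \<open>S\<close> outside the satiation
        enters, in contrapositive form: the vanishing gap at \<open>F\<close> forces a member of
        \<open>\<E>\<close> inside \<open>F\<close>, and there \<open>s\<close> satisfies the
        relation by assumption.\<close>
      then have "F \<in> edge_satiation \<Lambda> \<E>" using G2 FE by blast
      then obtain F0 where F0: "F0 \<in> \<E>" "F0 \<subseteq> F" by (auto simp: edge_satiation_def)
      have F0v: "F0 \<subseteq> into \<Lambda> v M" using F0 Fv by simp
      have "F0 \<noteq> {}" using FE_edgesD F0 \<E> by (metis subsetD)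
      moreover have "gap_projection \<Lambda> cstar_of_type s F0 = 0"
        using s F0 by (simp add: relative_CK_family_def)
      ultimately have c0: "covers s v F0"
        using s.gap_projection_eq_0_iff[OF less(2) _ _ F0v] finite_subset[OF F0(2) finF] by simp
      show ?thesis
      proof (rule s.covers_of_Ext[OF F0v less(4) c0])
        fix f assume "f \<in> F0"
        then have "f \<in> F" using F0 by auto
        then obtain e \<beta> i where f: "f \<in> M" "r f = v" "d f = axis i 1" "e \<in> E" "\<beta> \<in> M" "sc f = r \<beta>" "e = f \<cdot> \<beta>"
          by (auto simp: F_def into_def edges_def)
        have "d e = axis i 1 + d \<beta>" using comp_simps(4)[OF f(1,5,6)] f by simp
        then have "1 \<le> d e $ i" by simp
        \<comment> \<open>Because \<open>f\<close> begins some member of \<open>E\<close>, the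
          truncated subtraction below really lowers \<open>L\<close>.\<close>
        then have Li: "1 \<le> L $ i" using less(6)[OF f(4), of i] by simp
        define L' where "L' = L - axis i 1"
        have L: "L = L' + axis i 1"
          using Li by (simp add: L'_def vec_eq_iff axis_def)
        have "deg_sum (axis i (1::nat)) = 1" by (simp add: deg_sum_def axis_def)
        then have lt: "deg_sum L' < deg_sum L" by (simp add: L deg_sum_add)
        show "covers s (sc f) (Ext \<Lambda> f E)"
        proof (rule less(1)[OF lt])
          show "sc f \<in> vertices \<Lambda>" using f(1) by simp
          show "finite (Ext \<Lambda> f E)" by (rule finite_Ext[OF f(1) less(3) EM])
          show "Ext \<Lambda> f E \<subseteq> into \<Lambda> (sc f) M" by (auto simp: Ext_def)
          show "covers S (sc f) (Ext \<Lambda> f E)" by (rule S.covers_Ext[OF f(1,2) less(4,5)])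
          fix g j assume "g \<in> Ext \<Lambda> f E"
          then obtain e' where g: "e' \<in> E" "f \<cdot> g \<in> MCE \<Lambda> f e'" "g \<in> M" "r g = sc f"
            by (auto simp: Ext_def into_def)
          have "d (f \<cdot> g) = deg_join (d f) (d e')" using g(2) by (simp add: MCE_def)
          then have "d f + d g = deg_join (d f) (d e')"
            unfolding comp_simps(4)[OF f(1) g(3) g(4)[symmetric]] .
          then have *: "axis i 1 $ j + d g $ j = max (axis i 1 $ j) (d e' $ j)"
            unfolding f(3) by (metis deg_join_nth vector_add_component)
          have "d e' $ j \<le> L $ j" by (rule less(6)[OF g(1)])
          with * show "d g $ j \<le> L' $ j"
            using Li unfolding L'_def vector_minus_component by linarith
        qed
      qed
    qed
  qed
  note main = this
  have "d e $ i \<le> (\<chi> i. \<Sum>e\<in>E. d e $ i) $ i" if "e \<in> E" for e i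
    using member_le_sum[OF that, of "\<lambda>e. d e $ i"] E by simp
  then show ?thesis using main[OF E] by blast
qed

end


section \<open>The core\<close>

lemma span_image_explicit:
  fixes G :: "'i \<Rightarrow> 'a::cstar_algebra"
  assumes "finite A" "x \<in> cvs.span (G ` A)"
  obtains c where "x = (\<Sum>p\<in>A. c p *\<^sub>C G p)"
proof -
  have "\<exists>c. x = (\<Sum>p\<in>A. c p *\<^sub>C G p)"
    using assms(2)
  proof (induction rule: cvs.span_induct_alt)
    case base
    show ?case by (rule exI[of _ "\<lambda>_. 0"]) simp
  next
    case (step a b y)
    then obtain q c where q: "q \<in> A" "b = G q" "y = (\<Sum>p\<in>A. c p *\<^sub>C G p)" by auto
    have "a *\<^sub>C b + y = (\<Sum>p\<in>A. (if p = q then a *\<^sub>C G p else 0) + c p *\<^sub>C G p)"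
      using q assms(1) by (simp add: sum.distrib)
    also have "\<dots> = (\<Sum>p\<in>A. ((if p = q then a else 0) + c p) *\<^sub>C G p)"
      by (intro sum.cong) (auto simp: cvs.scale_left_distrib)
    finally show ?case by (intro exI)
  qed
  then show ?thesis using that by blast
qed

lemma span_finite_subset:
  assumes "x \<in> cvs.span (S :: 'a::cstar_algebra set)"
  obtains t where "finite t" "t \<subseteq> S" "x \<in> cvs.span t"
proof -
  obtain t u where t: "finite t" "t \<subseteq> S" "x = (\<Sum>a\<in>t. u a *\<^sub>C a)"
    using assms unfolding cvs.span_explicit by blast
  have "x \<in> cvs.span t"
    unfolding t(3) by (intro cvs.span_sum cvs.span_scale cvs.span_base)
  then show ?thesis using that t by blast
qed

text \<open>The condition \<open>cov\<close> amounts to \<open>\<pi>\<close> killing no nonzero gap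
  projection of a finite set of paths with common range; this is what \<open>gap_hom_nonzero\<close>
  extracts.\<close>

locale covering_hom = tck_family \<Lambda> s for \<Lambda> :: "('l, 'k::finite) kgraph"
    and s :: "'l \<Rightarrow> 'a::cstar_algebra" +
  fixes \<pi> :: "'a \<Rightarrow> 'b::cstar_algebra"
  assumes hom: "star_hom cstar_of_type cstar_of_type \<pi>"
    and cov: "\<And>v E. v \<in> vertices \<Lambda> \<Longrightarrow> finite E \<Longrightarrow> E \<subseteq> into \<Lambda> v M \<Longrightarrow>
      covers (\<lambda>\<mu>. \<pi> (s \<mu>)) v E \<Longrightarrow> covers s v E"
begin

lemmas hom_simps = star_homD[OF hom]

lemma tck_hom: "TCK_family \<Lambda> cstar_of_type (\<lambda>\<mu>. \<pi> (s \<mu>))"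
proof -
  have "star (\<pi> (s \<mu>)) * \<pi> (s \<nu>) =
      finsum cstar_of_type (\<lambda>p. \<pi> (s (fst p)) * star (\<pi> (s (snd p)))) (Lmin \<Lambda> \<mu> \<nu>)"
    if "\<mu> \<in> M" "\<nu> \<in> M" for \<mu> \<nu>
  proof -
    have "star (\<pi> (s \<mu>)) * \<pi> (s \<nu>) = \<pi> (star (s \<mu>) * s \<nu>)" by (simp add: hom_simps)
    also have "\<dots> = (\<Sum>p\<in>Lmin \<Lambda> \<mu> \<nu>. \<pi> (s (fst p)) * star (\<pi> (s (snd p))))"
      unfolding T_star_mult[OF that] by (simp add: hom_simps)
    finally show ?thesis by (simp add: finsum_cstar_of_type finite_Lmin that)
  qed
  then show ?thesis
    by (simp add: TCK_family_def T_partial_isometry T_vertex T_orth T_mult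
        flip: hom_simps(2,4,5))
qed

lemma gap_hom_nonzero:
  assumes "v \<in> vertices \<Lambda>" "set es \<subseteq> into \<Lambda> v M" "gap v es \<noteq> 0"
  shows "\<pi> (gap v es) \<noteq> 0"
proof -
  interpret pi: tck_family \<Lambda> "\<lambda>\<mu>. \<pi> (s \<mu>)"
    by unfold_locales (rule tck_hom)
  have "\<pi> (gap v es) = pi.gap v es"
    by (induction es) (simp_all add: hom_simps P_def pi.P_def)
  then show ?thesis
    using gap_eq_0_iff pi.gap_eq_0_iff cov assms by (metis List.finite_set)
qed

end

locale closed_paths = covering_hom \<Lambda> s \<pi> for \<Lambda> :: "('l, 'k::finite) kgraph"
    and s :: "'l \<Rightarrow> 'a::cstar_algebra" and \<pi> :: "'a \<Rightarrow> 'b::cstar_algebra" +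
  fixes X :: "'l set"
  assumes finX: "finite X" and XM: "X \<subseteq> M"
    and X_MCE: "\<And>\<kappa> \<mu>. \<kappa> \<in> X \<Longrightarrow> \<mu> \<in> X \<Longrightarrow> MCE \<Lambda> \<kappa> \<mu> \<subseteq> X"
    and X_swap: "\<And>\<kappa> \<mu> \<alpha>. \<kappa> \<in> X \<Longrightarrow> \<mu> \<in> X \<Longrightarrow> \<mu> \<cdot> \<alpha> \<in> X \<Longrightarrow> d \<kappa> = d \<mu> \<Longrightarrow> sc \<kappa> = sc \<mu> \<Longrightarrow>
      \<alpha> \<in> M \<Longrightarrow> sc \<mu> = r \<alpha> \<Longrightarrow> \<kappa> \<cdot> \<alpha> \<in> X"
begin

definition pairs :: "(nat ^ 'k) set \<Rightarrow> ('l \<times> 'l) set" where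
  "pairs U = {p \<in> X \<times> X. d (fst p) = d (snd p) \<and> sc (fst p) = sc (snd p) \<and> d (fst p) \<in> U}"

lemma finite_pairs: "finite (pairs U)"
  using finX by (simp add: pairs_def)

lemma pairsD:
  assumes "p \<in> pairs U"
  shows "fst p \<in> X" "snd p \<in> X" "fst p \<in> M" "snd p \<in> M" "d (fst p) = d (snd p)"
    "sc (fst p) = sc (snd p)" "d (fst p) \<in> U"
  using assms XM by (auto simp: pairs_def)

lemma Lmin_X:
  assumes "\<kappa> \<in> X" "\<mu> \<in> X" "p \<in> Lmin \<Lambda> \<kappa> \<mu>"
  shows "\<kappa> \<cdot> fst p \<in> X"
  using assms(3) X_MCE[OF assms(1,2)] by (auto simp: Lmin_def)

definition exts :: "'l \<Rightarrow> 'l set" where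
  "exts \<kappa> = {\<alpha> \<in> M. sc \<kappa> = r \<alpha> \<and> \<kappa> \<cdot> \<alpha> \<in> X \<and> d \<alpha> \<noteq> 0}"

text \<open>The part of the source projection of \<open>\<kappa>\<close> orthogonal to the ranges of
  all proper continuations of \<open>\<kappa>\<close> inside \<open>X\<close>. Compressing by it
  isolates a single degree.\<close>

definition Q :: "'l \<Rightarrow> 'a" where
  "Q \<kappa> = gap (sc \<kappa>) (SOME es. set es = exts \<kappa>)"

lemma exts_into: "exts \<kappa> \<subseteq> into \<Lambda> (sc \<kappa>) M"
  by (auto simp: exts_def into_def)

lemma exts_list:
  assumes "\<kappa> \<in> M"
  shows "set (SOME es. set es = exts \<kappa>) = exts \<kappa>"
proof -
  have "inj_on ((\<cdot>) \<kappa>) (exts \<kappa>)"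
  proof (rule inj_onI)
    fix \<alpha> \<beta> assume *: "\<alpha> \<in> exts \<kappa>" "\<beta> \<in> exts \<kappa>" "\<kappa> \<cdot> \<alpha> = \<kappa> \<cdot> \<beta>"
    then have "\<alpha> \<in> M" "\<beta> \<in> M" "sc \<kappa> = r \<alpha>" "sc \<kappa> = r \<beta>" by (simp_all add: exts_def)
    then show "\<alpha> = \<beta>" using factor_unique(2)[OF assms _ _ assms] *(3) by metis
  qed
  moreover have "(\<cdot>) \<kappa> ` exts \<kappa> \<subseteq> X" by (auto simp: exts_def)
  ultimately have "finite (exts \<kappa>)" using finX finite_imageD finite_subset by blast
  then have "\<exists>es. set es = exts \<kappa>" by (rule finite_list)
  then show ?thesis by (rule someI_ex)
qed

lemma Q_annihilates: "\<kappa> \<in> M \<Longrightarrow> \<alpha> \<in> exts \<kappa> \<Longrightarrow> Q \<kappa> * s \<alpha> = 0"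
  unfolding Q_def
  by (rule gap_annihilates) (simp_all add: exts_list exts_into)

lemma Q_source: "\<kappa> \<in> M \<Longrightarrow> Q \<kappa> * s (sc \<kappa>) = Q \<kappa>"
  unfolding Q_def
  by (rule gap_vertex(2)) (simp_all add: exts_list exts_into)

lemma Q_hom_nonzero: "\<kappa> \<in> M \<Longrightarrow> Q \<kappa> \<noteq> 0 \<Longrightarrow> \<pi> (Q \<kappa>) \<noteq> 0"
  unfolding Q_def
  by (rule gap_hom_nonzero) (simp_all add: exts_list exts_into)

text \<open>Composing with \<open>\<kappa>\<close> carries
  \<open>MCE \<Lambda> \<alpha> \<beta>\<close> into the minimal common extensions of the two
  composites, so closure of \<open>X\<close> gives closure of \<open>exts \<kappa>\<close>, as
  \<open>gap_span\<close> requires.\<close>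

lemma Q_span:
  assumes \<kappa>: "\<kappa> \<in> X"
  shows "s (sc \<kappa>) - Q \<kappa> \<in> cvs.span (P ` exts \<kappa>)"
proof -
  have \<kappa>M: "\<kappa> \<in> M" using \<kappa> XM by auto
  have "MCE \<Lambda> \<alpha> \<beta> \<subseteq> exts \<kappa>" if ab: "\<alpha> \<in> exts \<kappa>" "\<beta> \<in> exts \<kappa>" for \<alpha> \<beta>
  proof
    fix \<tau> assume \<tau>: "\<tau> \<in> MCE \<Lambda> \<alpha> \<beta>"
    have a: "\<alpha> \<in> M" "sc \<kappa> = r \<alpha>" "\<kappa> \<cdot> \<alpha> \<in> X" "d \<alpha> \<noteq> 0"
      and b: "\<beta> \<in> M" "sc \<kappa> = r \<beta>" "\<kappa> \<cdot> \<beta> \<in> X"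
      using ab by (simp_all add: exts_def)
    obtain \<alpha>' \<beta>' where \<alpha>': "\<alpha>' \<in> M" "sc \<alpha> = r \<alpha>'" "\<tau> = \<alpha> \<cdot> \<alpha>'"
      and \<beta>': "\<beta>' \<in> M" "sc \<beta> = r \<beta>'" "\<tau> = \<beta> \<cdot> \<beta>'"
      and d\<tau>: "d \<tau> = deg_join (d \<alpha>) (d \<beta>)"
      using \<tau> unfolding MCE_iff[OF a(1) b(1)] by blast
    have \<tau>M: "\<tau> \<in> M" "r \<tau> = sc \<kappa>" using comp_simps[OF a(1) \<alpha>'(1,2)] a(2) \<alpha>'(3) by simp_all
    have M2: "\<kappa> \<cdot> \<alpha> \<in> M" "\<kappa> \<cdot> \<beta> \<in> M" using a b XM by auto
    have "\<kappa> \<cdot> \<tau> = \<kappa> \<cdot> \<alpha> \<cdot> \<alpha>'" "\<kappa> \<cdot> \<tau> = \<kappa> \<cdot> \<beta> \<cdot> \<beta>'"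
      using comp_assoc[OF \<kappa>M a(1) \<alpha>'(1) a(2) \<alpha>'(2)] comp_assoc[OF \<kappa>M b(1) \<beta>'(1) b(2) \<beta>'(2)]
        \<alpha>'(3) \<beta>'(3) by simp_all
    moreover have "sc (\<kappa> \<cdot> \<alpha>) = r \<alpha>'" "sc (\<kappa> \<cdot> \<beta>) = r \<beta>'"
      using comp_simps(3)[OF \<kappa>M a(1,2)] comp_simps(3)[OF \<kappa>M b(1,2)] \<alpha>'(2) \<beta>'(2) by simp_all
    moreover have "d (\<kappa> \<cdot> \<tau>) = deg_join (d (\<kappa> \<cdot> \<alpha>)) (d (\<kappa> \<cdot> \<beta>))"
      using comp_simps(4)[OF \<kappa>M \<tau>M(1) \<tau>M(2)[symmetric]] comp_simps(4)[OF \<kappa>M a(1,2)]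
        comp_simps(4)[OF \<kappa>M b(1,2)] d\<tau> by (simp add: vec_eq_iff nat_add_max_right)
    ultimately have "\<kappa> \<cdot> \<tau> \<in> MCE \<Lambda> (\<kappa> \<cdot> \<alpha>) (\<kappa> \<cdot> \<beta>)"
      unfolding MCE_iff[OF M2] using \<alpha>'(1) \<beta>'(1) by blast
    then have "\<kappa> \<cdot> \<tau> \<in> X" using X_MCE a(3) b(3) by blast
    moreover have "d \<tau> \<noteq> 0" using a(4) d\<tau> by (auto simp: vec_eq_iff)
    ultimately show "\<tau> \<in> exts \<kappa>" using \<tau>M by (simp add: exts_def)
  qed
  then show ?thesis
    unfolding Q_def using exts_list[OF \<kappa>M] exts_into \<kappa>M by (intro gap_span) auto
qed

text \<open>If \<open>Q\<close> vanishes, the source projection is a combination of range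
  projections of proper continuations \<open>\<alpha>\<close>. Inserted between the two factors of
  \<open>G p\<close>, each of them lengthens both paths by \<open>\<alpha>\<close>; closure under
  swaps keeps the second path in \<open>X\<close>.\<close>

lemma G_in_span_of_Q_zero:
  assumes p: "p \<in> pairs U" and Q0: "Q (fst p) = 0"
    and U': "\<And>\<tau>. \<tau> \<in> X \<Longrightarrow> d \<tau> \<noteq> d (fst p) \<Longrightarrow> (\<And>i. d (fst p) $ i \<le> d \<tau> $ i) \<Longrightarrow> d \<tau> \<in> U'"
  shows "G p \<in> cvs.span (G ` pairs U')"
proof -
  define \<kappa> \<mu> where "\<kappa> = fst p" "\<mu> = snd p"
  have k: "\<kappa> \<in> X" "\<mu> \<in> X" "\<kappa> \<in> M" "\<mu> \<in> M" "d \<kappa> = d \<mu>" "sc \<kappa> = sc \<mu>"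
    using pairsD[OF p] by (simp_all add: \<kappa>_\<mu>_def)
  have "s (sc \<kappa>) \<in> cvs.span (P ` exts \<kappa>)" using Q_span[OF k(1)] Q0 by (simp add: \<kappa>_\<mu>_def)
  moreover have "star (s \<mu>) \<in> cvs.span {star (s \<mu>)}" by (intro cvs.span_base) simp
  ultimately have y: "s (sc \<kappa>) * star (s \<mu>) \<in> cvs.span ((\<lambda>\<alpha>. P \<alpha> * star (s \<mu>)) ` exts \<kappa>)"
    by (rule span_mult) (auto intro: cvs.span_base)
  have "s \<kappa> \<in> cvs.span {s \<kappa>}" by (intro cvs.span_base) simp
  from this y have "s \<kappa> * (s (sc \<kappa>) * star (s \<mu>)) \<in> cvs.span (G ` pairs U')"
  proof (rule span_mult)
    fix a b assume "a \<in> {s \<kappa>}" "b \<in> (\<lambda>\<alpha>. P \<alpha> * star (s \<mu>)) ` exts \<kappa>"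
    then obtain \<alpha> where ab: "a * b = s \<kappa> * (P \<alpha> * star (s \<mu>))" and "\<alpha> \<in> exts \<kappa>" by auto
    then have \<alpha>: "\<alpha> \<in> M" "sc \<kappa> = r \<alpha>" "\<kappa> \<cdot> \<alpha> \<in> X" "d \<alpha> \<noteq> 0" by (simp_all add: exts_def)
    have \<mu>\<alpha>: "sc \<mu> = r \<alpha>" "\<mu> \<cdot> \<alpha> \<in> X"
      using X_swap[OF k(2,1) \<alpha>(3) k(5)[symmetric] k(6)[symmetric] \<alpha>(1,2)] \<alpha>(2) k(6) by simp_all
    have "a * b = (s \<kappa> * s \<alpha>) * star (s \<mu> * s \<alpha>)"
      by (simp add: ab P_def star_mult mult.assoc)
    also have "\<dots> = G (\<kappa> \<cdot> \<alpha>, \<mu> \<cdot> \<alpha>)"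
      using T_mult[OF k(3) \<alpha>(1,2)] T_mult[OF k(4) \<alpha>(1) \<mu>\<alpha>(1)] by (simp add: G_def)
    finally have "a * b = G (\<kappa> \<cdot> \<alpha>, \<mu> \<cdot> \<alpha>)" .
    moreover have "(\<kappa> \<cdot> \<alpha>, \<mu> \<cdot> \<alpha>) \<in> pairs U'"
    proof -
      have dd: "d (\<kappa> \<cdot> \<alpha>) = d \<kappa> + d \<alpha>" "d (\<mu> \<cdot> \<alpha>) = d \<kappa> + d \<alpha>" "sc (\<kappa> \<cdot> \<alpha>) = sc \<alpha>" "sc (\<mu> \<cdot> \<alpha>) = sc \<alpha>"
        using comp_simps[OF k(3) \<alpha>(1,2)] comp_simps[OF k(4) \<alpha>(1) \<mu>\<alpha>(1)] k(5) by simp_all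
      have "d (\<kappa> \<cdot> \<alpha>) \<in> U'"
        by (rule U'[OF \<alpha>(3)]) (use dd(1) \<alpha>(4) in \<open>simp_all add: \<kappa>_\<mu>_def\<close>)
      then show ?thesis using dd \<alpha>(3) \<mu>\<alpha>(2) by (simp add: pairs_def)
    qed
    ultimately show "a * b \<in> cvs.span (G ` pairs U')" by (intro cvs.span_base) simp
  qed
  then show ?thesis using T_source k(3) by (simp add: G_def \<kappa>_\<mu>_def flip: mult.assoc)
qed

text \<open>In the same degree, distinct paths have orthogonal ranges. In any other degree of
  \<open>U\<close>, minimality means that a common extension with \<open>fst p\<close> properly
  continues it inside \<open>X\<close>, and \<open>Q\<close> kills that continuation.\<close>

lemma compress_G:
  assumes p: "p \<in> pairs U" and q: "q \<in> pairs U"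
    and min: "\<And>m. m \<in> U \<Longrightarrow> (\<And>i. m $ i \<le> d (fst p) $ i) \<Longrightarrow> m = d (fst p)"
  shows "Q (fst p) * star (s (fst p)) * G q * s (snd p) = (if q = p then Q (fst p) else 0)"
proof -
  define \<kappa> \<mu> \<sigma> \<tau> where "\<kappa> = fst p" "\<mu> = snd p" "\<sigma> = fst q" "\<tau> = snd q"
  note defs = \<kappa>_\<mu>_\<sigma>_\<tau>_def
  have k: "\<kappa> \<in> X" "\<mu> \<in> X" "\<kappa> \<in> M" "\<mu> \<in> M" "d \<kappa> = d \<mu>" "sc \<kappa> = sc \<mu>" "d \<kappa> \<in> U"
    using pairsD[OF p] by (simp_all add: defs)
  have l: "\<sigma> \<in> X" "\<tau> \<in> X" "\<sigma> \<in> M" "\<tau> \<in> M" "d \<sigma> = d \<tau>" "sc \<sigma> = sc \<tau>" "d \<sigma> \<in> U"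
    using pairsD[OF q] by (simp_all add: defs)
  have eq: "Q \<kappa> * star (s \<kappa>) * G q * s \<mu> = Q \<kappa> * (star (s \<kappa>) * s \<sigma>) * (star (s \<tau>) * s \<mu>)"
    by (simp add: G_def defs mult.assoc)
  have "Q \<kappa> * star (s \<kappa>) * G q * s \<mu> = (if q = p then Q \<kappa> else 0)"
  proof (cases "d \<sigma> = d \<kappa>")
    case True
    consider "\<sigma> \<noteq> \<kappa>" | "\<tau> \<noteq> \<mu>" | "\<sigma> = \<kappa>" "\<tau> = \<mu>" by blast
    then show ?thesis
    proof cases
      case 1
      then have "star (s \<kappa>) * s \<sigma> = 0" using T_star_mult_same_deg[OF k(3) l(3)] True by metis
      moreover have "q \<noteq> p" using 1 by (auto simp: defs)
      ultimately show ?thesis by (simp add: eq)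
    next
      case 2
      then have "star (s \<tau>) * s \<mu> = 0" using T_star_mult_same_deg[OF l(4) k(4)] True k(5) l(5) by metis
      moreover have "q \<noteq> p" using 2 by (auto simp: defs)
      ultimately show ?thesis by (simp add: eq)
    next
      case 3
      then have "q = p" by (simp add: defs prod_eq_iff)
      moreover have "Q \<kappa> * (star (s \<kappa>) * s \<sigma>) * (star (s \<tau>) * s \<mu>) = Q \<kappa>"
        using T_isometry[OF k(3)] T_isometry[OF k(4)] Q_source[OF k(3)] 3 k(6) by metis
      ultimately show ?thesis using eq by simp
    qed
  next
    case False
    have "Q \<kappa> * (star (s \<kappa>) * s \<sigma>) = (\<Sum>a\<in>Lmin \<Lambda> \<kappa> \<sigma>. Q \<kappa> * s (fst a) * star (s (snd a)))"
      by (simp add: T_star_mult[OF k(3) l(3)] sum_distrib_left mult.assoc)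
    also have "\<dots> = 0"
    proof (rule sum.neutral, rule ballI)
      fix a assume a: "a \<in> Lmin \<Lambda> \<kappa> \<sigma>"
      have aM: "fst a \<in> M" "sc \<kappa> = r (fst a)" "d \<kappa> + d (fst a) = deg_join (d \<kappa>) (d \<sigma>)"
        using LminE[OF a k(3) l(3)] by blast+
      have "d (fst a) \<noteq> 0"
      proof
        assume "d (fst a) = 0"
        then have "d \<kappa> = deg_join (d \<kappa>) (d \<sigma>)" using aM(3) by simp
        then have "d \<sigma> $ i \<le> d \<kappa> $ i" for i by (metis deg_join_nth max.cobounded2)
        then show False using min[OF l(7)] False by (simp add: defs)
      qed
      then have "fst a \<in> exts \<kappa>" using aM Lmin_X[OF k(1) l(1) a] by (simp add: exts_def)
      then show "Q \<kappa> * s (fst a) * star (s (snd a)) = 0" by (simp add: Q_annihilates k(3))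
    qed
    finally have "Q \<kappa> * (star (s \<kappa>) * s \<sigma>) = 0" .
    moreover have "q \<noteq> p" using False by (auto simp: defs)
    ultimately show ?thesis by (simp add: eq)
  qed
  then show ?thesis by (simp add: defs)
qed

text \<open>
  Degrees are removed from below: compressing by \<open>Q\<close> reads off the coefficients in a minimal
  degree \<open>n\<close>, unless \<open>Q = 0\<close>, when the generator is a combination of generators of larger degree.
\<close>

lemma upper_set_bound:
  assumes "finite U" "\<And>m \<tau>. m \<in> U \<Longrightarrow> \<tau> \<in> X \<Longrightarrow> (\<And>i. m $ i \<le> d \<tau> $ i) \<Longrightarrow> d \<tau> \<in> U"
  shows "\<exists>C\<ge>0. \<forall>x\<in>cvs.span (G ` pairs U). norm x \<le> C * norm (\<pi> x)"
  using assms
proof (induction U rule: finite_psubset_induct)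
  case (psubset U)
  show ?case
  proof (cases "U = {}")
    case True
    have "norm x \<le> 0 * norm (\<pi> x)" if "x \<in> cvs.span (G ` pairs U)" for x
      using that by (simp add: True pairs_def)
    then show ?thesis by (metis order_refl)
  next
    case False
    \<comment> \<open>A degree of minimal total size is coordinatewise minimal in \<open>U\<close>,
      and deleting it leaves an upward closed set.\<close>
    obtain n where n: "n \<in> U" "\<And>m. m \<in> U \<Longrightarrow> deg_sum n \<le> deg_sum m"
      using ex_min_if_finite[of "deg_sum ` U"] psubset(1) False
      by (metis (no_types, lifting) empty_is_image finite_imageI imageE image_eqI not_le_imp_less)
    have min: "m = n" if "m \<in> U" "\<And>i. m $ i \<le> n $ i" for m
      using deg_sum_eqD[OF that(2)] deg_sum_mono[OF that(2)] n(2)[OF that(1)] by simp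
    define U' where "U' = U - {n}"
    have up: "d \<tau> \<in> U'" if "m \<in> U'" "\<tau> \<in> X" "\<And>i. m $ i \<le> d \<tau> $ i" for m \<tau>
      using psubset(3)[OF _ that(2,3)] that min by (auto simp: U'_def)
    have "\<exists>C\<ge>0. \<forall>x\<in>cvs.span (G ` pairs U'). norm x \<le> C * norm (\<pi> x)"
      by (rule psubset(2)) (use n up in \<open>auto simp: U'_def\<close>)
    then obtain C where C: "C \<ge> 0" "\<And>x. x \<in> cvs.span (G ` pairs U') \<Longrightarrow> norm x \<le> C * norm (\<pi> x)"
      by blast
    \<comment> \<open>\<open>A\<close> consists of the generators in degree \<open>n\<close> whose
      coefficients compression can recover. \<open>K p\<close> is the resulting constant after
      division by the norm of \<open>\<pi> (Q (fst p))\<close>, nonzero by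
      \<open>Q_hom_nonzero\<close>.\<close>
    define A where "A = {p \<in> pairs U. d (fst p) = n \<and> Q (fst p) \<noteq> 0}"
    define K where "K p = norm (\<pi> (Q (fst p) * star (s (fst p)))) * norm (\<pi> (s (snd p))) / norm (\<pi> (Q (fst p)))" for p
    define C1 where "C1 = (\<Sum>p\<in>A. K p * norm (G p))"
    have finA: "finite A" using finite_pairs by (simp add: A_def)
    have AU: "A \<subseteq> pairs U" by (auto simp: A_def)
    have C1: "C1 \<ge> 0" unfolding C1_def K_def by (intro sum_nonneg) simp
    \<comment> \<open>The part \<open>y\<close> over \<open>A\<close> costs \<open>C1\<close>. The
      remainder lies over \<open>U'\<close> and costs \<open>C\<close> times the sum of the norms of
      \<open>\<pi> x\<close> and \<open>\<pi> y\<close>, the latter again controlled by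
      \<open>C1\<close>.\<close>
    have "norm x \<le> (C1 + C * (1 + C1)) * norm (\<pi> x)" if x: "x \<in> cvs.span (G ` pairs U)" for x
    proof -
      obtain c where c: "x = (\<Sum>p\<in>pairs U. c p *\<^sub>C G p)"
        using span_image_explicit[OF finite_pairs x] .
      define y where "y = (\<Sum>p\<in>A. c p *\<^sub>C G p)"
      have cp: "cmod (c p) \<le> K p * norm (\<pi> x)" if p: "p \<in> A" for p
      proof -
        have pU: "p \<in> pairs U" and pn: "d (fst p) = n" and Q0: "Q (fst p) \<noteq> 0"
          using p by (simp_all add: A_def)
        have "Q (fst p) * star (s (fst p)) * x * s (snd p)
            = (\<Sum>q\<in>pairs U. c q *\<^sub>C (Q (fst p) * star (s (fst p)) * G q * s (snd p)))"
          by (simp add: c sum_distrib_left sum_distrib_right scaleC_mult_left scaleC_mult_right)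
        also have "\<dots> = (\<Sum>q\<in>pairs U. if q = p then c p *\<^sub>C Q (fst p) else 0)"
          by (intro sum.cong refl) (use compress_G[OF pU] min pn in auto)
        also have "\<dots> = c p *\<^sub>C Q (fst p)" using pU finite_pairs by simp
        finally have "c p *\<^sub>C \<pi> (Q (fst p)) = \<pi> (Q (fst p) * star (s (fst p))) * \<pi> x * \<pi> (s (snd p))"
          by (metis hom_simps(2,3))
        then have "cmod (c p) * norm (\<pi> (Q (fst p)))
            = norm (\<pi> (Q (fst p) * star (s (fst p))) * \<pi> x * \<pi> (s (snd p)))"
          by (metis norm_scaleC)
        also have "\<dots> \<le> norm (\<pi> (Q (fst p) * star (s (fst p)))) * norm (\<pi> x) * norm (\<pi> (s (snd p)))"
          by (meson mult_right_mono norm_ge_zero norm_mult_ineq order_trans)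
        finally show ?thesis
          using Q_hom_nonzero[OF pairsD(3)[OF pU] Q0] by (simp add: K_def field_simps)
      qed
      have "norm y \<le> (\<Sum>p\<in>A. norm (c p *\<^sub>C G p))" unfolding y_def by (rule norm_sum)
      also have "\<dots> \<le> (\<Sum>p\<in>A. K p * norm (\<pi> x) * norm (G p))"
        using cp by (intro sum_mono) (simp add: norm_scaleC mult_right_mono)
      also have "\<dots> = C1 * norm (\<pi> x)" by (simp add: C1_def sum_distrib_left mult_ac)
      finally have y: "norm y \<le> C1 * norm (\<pi> x)" .
      have "x - y = (\<Sum>p\<in>pairs U - A. c p *\<^sub>C G p)"
        using sum.subset_diff[OF AU finite_pairs, of "\<lambda>p. c p *\<^sub>C G p"] by (simp add: c y_def)
      also have "\<dots> \<in> cvs.span (G ` pairs U')"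
      proof (intro cvs.span_sum cvs.span_scale)
        fix p assume p: "p \<in> pairs U - A"
        show "G p \<in> cvs.span (G ` pairs U')"
        proof (cases "d (fst p) = n")
          case True
          then have "Q (fst p) = 0" using p by (auto simp: A_def)
          then show ?thesis
            using p True psubset(3)[OF n(1)] by (intro G_in_span_of_Q_zero) (auto simp: U'_def)
        next
          case False
          then have "p \<in> pairs U'" using p by (auto simp: pairs_def U'_def)
          then show ?thesis by (intro cvs.span_base) simp
        qed
      qed
      finally have "norm (x - y) \<le> C * norm (\<pi> (x - y))" by (rule C(2))
      also have "\<dots> \<le> C * (norm (\<pi> x) + norm (\<pi> y))"
        using C(1) norm_triangle_ineq4[of "\<pi> x" "\<pi> y"] by (intro mult_left_mono) (simp_all add: hom_simps)
      also have "\<dots> \<le> C * (norm (\<pi> x) + C1 * norm (\<pi> x))"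
        using star_hom_contractive[OF hom, of y] y C(1) by (intro mult_left_mono) auto
      finally show ?thesis
        using y norm_triangle_ineq[of "x - y" y] by (simp add: algebra_simps)
    qed
    then show ?thesis using C(1) C1 by (intro exI[of _ "C1 + C * (1 + C1)"]) auto
  qed
qed

text \<open>The common extension of the inner paths is in \<open>X\<close> by closure under
  \<open>MCE\<close>. Replacing its prefix \<open>snd p\<close> by \<open>fst p\<close>, and its
  prefix \<open>fst q\<close> by \<open>snd q\<close>, are the two swaps that bring in the outer
  paths.\<close>

lemma span_pairs_mult:
  assumes "x \<in> cvs.span (G ` pairs UNIV)" "y \<in> cvs.span (G ` pairs UNIV)"
  shows "x * y \<in> cvs.span (G ` pairs UNIV)"
proof (rule span_mult[OF assms])
  fix a b assume "a \<in> G ` pairs UNIV" "b \<in> G ` pairs UNIV"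
  then obtain p q where p: "p \<in> pairs UNIV" "a = G p" and q: "q \<in> pairs UNIV" "b = G q" by auto
  note p' = pairsD[OF p(1)] and q' = pairsD[OF q(1)]
  have "a * b = (\<Sum>t\<in>Lmin \<Lambda> (snd p) (fst q). G (fst p \<cdot> fst t, snd q \<cdot> snd t))"
    using T_mult_star_mult[OF p'(3,4) q'(3,4) p'(6) q'(6)] p(2) q(2) by (simp add: G_def)
  also have "\<dots> \<in> cvs.span (G ` pairs UNIV)"
  proof (intro cvs.span_sum cvs.span_base imageI)
    fix t assume t: "t \<in> Lmin \<Lambda> (snd p) (fst q)"
    have t': "fst t \<in> M" "snd t \<in> M" "sc (snd p) = r (fst t)" "sc (fst q) = r (snd t)"
      "snd p \<cdot> fst t = fst q \<cdot> snd t" "d (snd p) + d (fst t) = deg_join (d (snd p)) (d (fst q))"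
      "d (fst q) + d (snd t) = deg_join (d (snd p)) (d (fst q))" "sc (fst t) = sc (snd t)"
      using LminE[OF t p'(4) q'(3)] by blast+
    have X: "snd p \<cdot> fst t \<in> X" by (rule Lmin_X[OF p'(2) q'(1) t])
    have "fst p \<cdot> fst t \<in> X"
      by (rule X_swap[OF p'(1,2) X p'(5,6) t'(1,3)])
    moreover have "snd q \<cdot> snd t \<in> X"
      by (rule X_swap[OF q'(2,1) _ q'(5)[symmetric] q'(6)[symmetric] t'(2,4)]) (use X t'(5) in simp)
    moreover have "d (fst p \<cdot> fst t) = d (snd q \<cdot> snd t)" "sc (fst p \<cdot> fst t) = sc (snd q \<cdot> snd t)"
      using comp_simps[of "fst p" "fst t"] comp_simps[of "snd q" "snd t"] p' q' t' by metis+
    ultimately show "(fst p \<cdot> fst t, snd q \<cdot> snd t) \<in> pairs UNIV" by (simp add: pairs_def)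
  qed
  finally show "a * b \<in> cvs.span (G ` pairs UNIV)" .
qed

lemma norm_le_on_pairs:
  assumes x: "x \<in> cvs.span (G ` pairs UNIV)"
  shows "norm x \<le> norm (\<pi> x)"
proof -
  \<comment> \<open>The induction over degrees needs a finite set; the degrees that occur in
    \<open>X\<close> impose no restriction.\<close>
  have eq: "pairs (d ` X) = pairs UNIV" by (auto simp: pairs_def)
  have "\<exists>C\<ge>0. \<forall>x\<in>cvs.span (G ` pairs (d ` X)). norm x \<le> C * norm (\<pi> x)"
    by (rule upper_set_bound) (use finX in auto)
  then obtain C where C: "\<And>x. x \<in> cvs.span (G ` pairs UNIV) \<Longrightarrow> norm x \<le> C * norm (\<pi> x)"
    unfolding eq by blast
  have "star x \<in> cvs.span (G ` pairs UNIV)"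
  proof (rule span_star[OF x])
    fix a assume "a \<in> G ` pairs UNIV"
    then obtain p where "p \<in> pairs UNIV" "a = G p" by auto
    then have "star a = G (snd p, fst p)" "(snd p, fst p) \<in> pairs UNIV"
      by (auto simp: star_G pairs_def)
    then show "star a \<in> cvs.span (G ` pairs UNIV)" by (metis cvs.span_base imageI)
  qed
  then show ?thesis
    using C span_pairs_mult x
    by (intro norm_le_of_growth[OF hom, where V = "\<lambda>_. cvs.span (G ` pairs UNIV)" and C = C and D = 1]) auto
qed

end

context covering_hom
begin

text \<open>Only finitely many paths occur in a given element, and their closure is a finite set
  satisfying \<open>closed_paths\<close>. The constant 1 no longer depends on that set.\<close>

lemma norm_le_on_core:
  assumes x: "x \<in> cvs.span (G ` {p \<in> M \<times> M. d (fst p) = d (snd p) \<and> sc (fst p) = sc (snd p)})"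
  shows "norm x \<le> norm (\<pi> x)"
proof -
  obtain t where t: "finite t" "t \<subseteq> G ` {p \<in> M \<times> M. d (fst p) = d (snd p) \<and> sc (fst p) = sc (snd p)}"
    "x \<in> cvs.span t"
    using span_finite_subset[OF x] .
  obtain B where B: "B \<subseteq> {p \<in> M \<times> M. d (fst p) = d (snd p) \<and> sc (fst p) = sc (snd p)}"
    "finite B" "t = G ` B"
    using finite_subset_image[OF t(1,2)] by blast
  define E where "E = fst ` B \<union> snd ` B"
  have E: "finite E" "E \<subseteq> M" using B by (auto simp: E_def)
  interpret closed_paths \<Lambda> s \<pi> "path_closure E"
  proof unfold_locales
    show "finite (path_closure E)" by (rule finite_path_closure[OF E])
    show "path_closure E \<subseteq> M" using path_closure_mor[OF E(2)] by blast
    show "MCE \<Lambda> \<kappa> \<mu> \<subseteq> path_closure E" if "\<kappa> \<in> path_closure E" "\<mu> \<in> path_closure E" for \<kappa> \<mu>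
      using path_closure.MCE[OF that] by blast
  qed (rule path_closure.swap)
  have "B \<subseteq> pairs UNIV"
  proof
    fix p assume p: "p \<in> B"
    then have "fst p \<in> E" "snd p \<in> E" by (auto simp: E_def)
    moreover have "d (fst p) = d (snd p)" "sc (fst p) = sc (snd p)" using B(1) p by auto
    ultimately show "p \<in> pairs UNIV" by (simp add: pairs_def path_closure.base mem_Times_iff)
  qed
  then have "t \<subseteq> G ` pairs UNIV" using B(3) by auto
  then have "x \<in> cvs.span (G ` pairs UNIV)" using t(3) cvs.span_mono by blast
  then show ?thesis by (rule norm_le_on_pairs)
qed

end


section \<open>The gauge action\<close>

text \<open>A geometric sum over powers of an \<open>N\<close>-th root of unity; the strict bound
  leaves 0 as the only multiple of \<open>N\<close>.\<close>

lemma sum_cis_int: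
  fixes a :: int and N :: nat
  assumes "\<bar>a\<bar> < int N"
  shows "(\<Sum>t<N. cis (2 * pi * real t * real_of_int a / real N)) = (if a = 0 then of_nat N else 0)"
proof (cases "a = 0")
  case False
  define w where "w = cis (2 * pi * real_of_int a / real N)"
  have N: "N > 0" using assms by simp
  have pow: "cis (2 * pi * real t * real_of_int a / real N) = w ^ t" for t
    unfolding w_def Complex.DeMoivre by (simp add: mult_ac)
  have "w \<noteq> 1"
  proof
    assume "w = 1"
    then have "cos (2 * pi * real_of_int a / real N) = 1" by (simp add: w_def complex_eq_iff)
    then obtain n :: int where n: "2 * pi * real_of_int a / real N = of_int n * 2 * pi"
      unfolding cos_one_2pi_int by blast
    then have "real_of_int a = of_int n * real N" using N by (simp add: field_simps)
    then have *: "a = n * int N" by (metis of_int_eq_iff of_int_mult of_int_of_nat_eq)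
    then have "n \<noteq> 0" using False by auto
    then have "int N \<le> \<bar>n\<bar> * int N" using mult_right_mono[of 1 "\<bar>n\<bar>" "int N"] by simp
    then show False using assms * by (simp add: abs_mult)
  qed
  moreover have "w ^ N = 1"
  proof -
    have "w ^ N = cis (2 * pi * real_of_int a)"
      unfolding w_def Complex.DeMoivre using N by simp
    then show ?thesis by simp
  qed
  ultimately show ?thesis unfolding pow using False by (simp add: sum_gp_strict)
qed (simp add: assms)

text \<open>The component is the average of \<open>N\<close> rotated copies of the sum, each
  weighted by a phase. A finite average suffices because only finitely many values of
  \<open>\<phi>\<close> occur.\<close>

lemma norm_isotypic_le:
  fixes g :: "'m \<Rightarrow> 'b::cstar_algebra" and \<phi> :: "'m \<Rightarrow> int"
  assumes B: "finite B"
    and le: "\<And>a. norm (\<Sum>m\<in>B. cis (a * real_of_int (\<phi> m)) *\<^sub>C g m) \<le> R"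
  shows "norm (\<Sum>m\<in>{m \<in> B. \<phi> m = j}. g m) \<le> R"
proof -
  define N where "N = Suc (\<Sum>m\<in>B. nat \<bar>\<phi> m - j\<bar>)"
  have N: "\<bar>\<phi> m - j\<bar> < int N" if "m \<in> B" for m
  proof -
    have "nat \<bar>\<phi> m - j\<bar> < N"
      unfolding N_def by (rule le_imp_less_Suc, rule member_le_sum[OF that]) (use B in auto)
    then show ?thesis by linarith
  qed
  define u where "u t = cis (- (2 * pi * real t * real_of_int j / real N))" for t
  define y where "y t = (\<Sum>m\<in>B. cis (2 * pi * real t / real N * real_of_int (\<phi> m)) *\<^sub>C g m)" for t
  have "(\<Sum>t<N. u t *\<^sub>C y t) = (\<Sum>m\<in>B. (\<Sum>t<N. cis (2 * pi * real t * real_of_int (\<phi> m - j) / real N)) *\<^sub>C g m)"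
    unfolding y_def cvs.scale_sum_right scaleC_scaleC cvs.scale_sum_left
    by (subst sum.swap) (simp add: u_def cis_mult diff_divide_distrib algebra_simps)
  also have "\<dots> = (\<Sum>m\<in>B. if \<phi> m = j then complex_of_real (real N) *\<^sub>C g m else 0)"
    by (intro sum.cong refl, subst sum_cis_int[OF N]) simp_all
  also have "\<dots> = (\<Sum>m\<in>{m \<in> B. \<phi> m = j}. real N *\<^sub>R g m)"
    by (simp only: sum.inter_filter[OF B] scaleC_of_real)
  finally have eq: "real N *\<^sub>R (\<Sum>m\<in>{m \<in> B. \<phi> m = j}. g m) = (\<Sum>t<N. u t *\<^sub>C y t)"
    by (simp add: scaleR_sum_right)
  have "norm (y t) \<le> R" for t unfolding y_def by (rule le)
  then have "norm (\<Sum>t<N. u t *\<^sub>C y t) \<le> (\<Sum>t<N. R)"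
    by (intro sum_norm_le) (simp add: norm_scaleC u_def)
  then have "real N * norm (\<Sum>m\<in>{m \<in> B. \<phi> m = j}. g m) \<le> real N * R"
    unfolding eq[symmetric] by simp
  then show ?thesis by (simp add: N_def del: of_nat_Suc)
qed

locale gauge_hom = covering_hom \<Lambda> s \<pi> for \<Lambda> :: "('l, 'k::finite) kgraph"
    and s :: "'l \<Rightarrow> 'a::cstar_algebra" and \<pi> :: "'a \<Rightarrow> 'b::cstar_algebra" +
  fixes \<theta> :: "complex ^ 'k \<Rightarrow> 'b \<Rightarrow> 'b"
  assumes action: "torus_action cstar_of_type \<theta>"
    and equivariant: "\<And>z \<mu>. z \<in> torus \<Longrightarrow> \<mu> \<in> M \<Longrightarrow> \<theta> z (\<pi> (s \<mu>)) = torus_power z (d \<mu>) *\<^sub>C \<pi> (s \<mu>)"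
begin

definition deg_box :: "nat \<Rightarrow> ('k \<Rightarrow> int) set" where
  "deg_box R = (UNIV \<rightarrow>\<^sub>E {- int R..int R})"

definition bounded_part :: "nat \<Rightarrow> 'a set" where
  "bounded_part R = cvs.span (G ` {p \<in> gens. deg_diff p \<in> deg_box R})"

lemma deg_box_iff: "m \<in> deg_box R \<longleftrightarrow> (\<forall>i. \<bar>m i\<bar> \<le> int R)"
  by (auto simp: deg_box_def PiE_iff abs_le_iff minus_le_iff)

lemma card_deg_box: "card (deg_box R) = (2 * R + 1) ^ CARD('k)"
proof -
  have "card {- int R..int R} = 2 * R + 1" by simp
  then show ?thesis unfolding deg_box_def by (subst card_PiE) simp_all
qed

lemma finite_deg_box: "finite (deg_box R)"
  by (simp add: deg_box_def finite_PiE)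

lemma star_homogeneous:
  assumes "x \<in> homogeneous m"
  shows "star x \<in> homogeneous (\<lambda>i. - m i)"
  using assms unfolding homogeneous_def
proof (rule span_star)
  fix a assume "a \<in> G ` {p \<in> gens. deg_diff p = m}"
  then obtain p where "p \<in> gens" "deg_diff p = m" "a = G p" by auto
  then have "star a = G (snd p, fst p)" "(snd p, fst p) \<in> gens" "deg_diff (snd p, fst p) = (\<lambda>i. - m i)"
    by (auto simp: star_G gens_def deg_diff_def)
  then show "star a \<in> cvs.span (G ` {p \<in> gens. deg_diff p = (\<lambda>i. - m i)})"
    by (intro cvs.span_base) simp
qed

text \<open>\<open>star x * x\<close> has degree zero and so belongs to the core; the C*-identity
  returns the estimate to \<open>x\<close>.\<close>

lemma norm_le_on_homogeneous:
  assumes x: "x \<in> homogeneous m"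
  shows "norm x \<le> norm (\<pi> x)"
proof -
  have "star x * x \<in> homogeneous (\<lambda>i. 0)"
    using star_homogeneous[OF x] x unfolding homogeneous_def
  proof (rule span_mult)
    fix a b assume "a \<in> G ` {p \<in> gens. deg_diff p = (\<lambda>i. - m i)}" "b \<in> G ` {p \<in> gens. deg_diff p = m}"
    then show "a * b \<in> cvs.span (G ` {p \<in> gens. deg_diff p = (\<lambda>i. 0)})"
      using G_mult by (force simp: homogeneous_def)
  qed
  moreover have "{p \<in> gens. deg_diff p = (\<lambda>i. 0)} =
      {p \<in> M \<times> M. d (fst p) = d (snd p) \<and> sc (fst p) = sc (snd p)}"
    by (auto simp: gens_def deg_diff_def fun_eq_iff vec_eq_iff)
  ultimately have "norm (star x * x) \<le> norm (\<pi> (star x * x))"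
    unfolding homogeneous_def by (simp only: norm_le_on_core)
  then have "(norm x)\<^sup>2 \<le> (norm (\<pi> x))\<^sup>2"
    by (simp add: norm_star_mult hom_simps)
  then show ?thesis by simp
qed

text \<open>The torus element with \<open>cis a\<close> in coordinate \<open>i\<close> and 1
  elsewhere turns the action into a one-parameter rotation that sees only coordinate
  \<open>i\<close> of the degree. It acts on the image of \<open>\<pi>\<close>.\<close>

lemma rotate:
  obtains \<rho> where "star_hom cstar_of_type cstar_of_type \<rho>"
    "\<And>m x. x \<in> homogeneous m \<Longrightarrow> \<rho> (\<pi> x) = cis (a * real_of_int (m i)) *\<^sub>C \<pi> x"
proof
  define z :: "complex ^ 'k" where "z = (\<chi> j. if j = i then cis a else 1)"
  have z: "z \<in> torus" by (simp add: torus_def z_def)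
  then show hz: "star_hom cstar_of_type cstar_of_type (\<theta> z)"
    using action by (simp add: torus_action_def)
  have tp: "torus_power z n = cis (a * real (n $ i))" for n
  proof -
    have "torus_power z n = (\<Prod>j\<in>UNIV. if j = i then cis a ^ (n $ i) else 1)"
      unfolding torus_power_def by (intro prod.cong) (auto simp: z_def)
    also have "\<dots> = cis a ^ (n $ i)" by simp
    also have "\<dots> = cis (a * real (n $ i))" by (simp only: Complex.DeMoivre mult.commute)
    finally show ?thesis .
  qed
  fix m x assume "x \<in> homogeneous m"
  then show "\<theta> z (\<pi> x) = cis (a * real_of_int (m i)) *\<^sub>C \<pi> x"
    unfolding homogeneous_def
  proof (induction rule: cvs.span_induct_alt)
    case base
    then show ?case by (simp add: hom_simps star_homD[OF hz])
  next
    case (step c b y)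
    then obtain p where p: "p \<in> gens" "deg_diff p = m" "b = G p" by auto
    have pM: "fst p \<in> M" "snd p \<in> M" using p(1) by (auto simp: gens_def)
    have "\<theta> z (\<pi> b) = (torus_power z (d (fst p)) * cnj (torus_power z (d (snd p)))) *\<^sub>C \<pi> b"
      by (simp add: p(3) G_def hom_simps star_homD[OF hz] equivariant[OF z] pM star_scaleC
          scaleC_mult_left scaleC_mult_right scaleC_scaleC mult.commute)
    also have "torus_power z (d (fst p)) * cnj (torus_power z (d (snd p))) = cis (a * real_of_int (m i))"
      by (simp add: tp cis_cnj cis_mult deg_diff_def flip: p(2)) (simp add: algebra_simps)
    finally have "\<theta> z (\<pi> b) = cis (a * real_of_int (m i)) *\<^sub>C \<pi> b" .
    then show ?case using step(2)
      by (simp add: hom_simps star_homD[OF hz] scaleC_add_right scaleC_scaleC mult.commute)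
  qed
qed

text \<open>Coordinates of the degree are fixed one after another. Each restriction is an average of
  images under *-homomorphisms, which are contractive, so the norm never grows.\<close>

lemma norm_component_le:
  assumes B: "finite B" and g: "\<And>m. g m \<in> homogeneous m" and n: "n \<in> B"
  shows "norm (\<pi> (g n)) \<le> norm (\<pi> (\<Sum>m\<in>B. g m))"
proof -
  have "norm (\<Sum>m\<in>{m \<in> B. \<forall>i\<in>I. m i = n i}. \<pi> (g m)) \<le> norm (\<Sum>m\<in>B. \<pi> (g m))" if "finite I" for I
    using that
  proof (induction I rule: finite_induct)
    case (insert i I)
    define B' where "B' = {m \<in> B. \<forall>i\<in>I. m i = n i}"
    have "norm (\<Sum>m\<in>{m \<in> B'. m i = n i}. \<pi> (g m)) \<le> norm (\<Sum>m\<in>B'. \<pi> (g m))"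
    proof (rule norm_isotypic_le)
      show "finite B'" using B by (simp add: B'_def)
      fix a
      obtain \<rho> where \<rho>: "star_hom cstar_of_type cstar_of_type \<rho>"
        "\<And>m x. x \<in> homogeneous m \<Longrightarrow> \<rho> (\<pi> x) = cis (a * real_of_int (m i)) *\<^sub>C \<pi> x"
        using rotate[of a i] by blast
      have "(\<Sum>m\<in>B'. cis (a * real_of_int (m i)) *\<^sub>C \<pi> (g m)) = \<rho> (\<Sum>m\<in>B'. \<pi> (g m))"
        by (simp add: star_homD(8)[OF \<rho>(1)] \<rho>(2)[OF g])
      then show "norm (\<Sum>m\<in>B'. cis (a * real_of_int (m i)) *\<^sub>C \<pi> (g m)) \<le> norm (\<Sum>m\<in>B'. \<pi> (g m))"
        using star_hom_contractive[OF \<rho>(1)] by simp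
    qed
    also have "\<dots> \<le> norm (\<Sum>m\<in>B. \<pi> (g m))" using insert.IH unfolding B'_def .
    also have "{m \<in> B'. m i = n i} = {m \<in> B. \<forall>i\<in>insert i I. m i = n i}"
      by (auto simp: B'_def)
    finally show ?case .
  qed simp
  from this[of UNIV] have "norm (\<Sum>m\<in>{m \<in> B. \<forall>i. m i = n i}. \<pi> (g m)) \<le> norm (\<Sum>m\<in>B. \<pi> (g m))" by simp
  moreover have "{m \<in> B. \<forall>i. m i = n i} = {n}" using n by (auto simp: fun_eq_iff)
  ultimately show ?thesis by (simp add: hom_simps)
qed

text \<open>Components are chosen, not determined: independence of the homogeneous subspaces is not
  established, and the estimates hold for any choice.\<close>

lemma bounded_part_decompose:
  assumes "x \<in> bounded_part R"
  shows "\<exists>g. (\<forall>m. g m \<in> homogeneous m) \<and> x = (\<Sum>m\<in>deg_box R. g m)"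
  using assms unfolding bounded_part_def
proof (induction rule: cvs.span_induct_alt)
  case base
  show ?case by (rule exI[of _ "\<lambda>_. 0"]) (simp add: homogeneous_def cvs.span_zero)
next
  case (step c b y)
  then obtain p g where p: "p \<in> gens" "deg_diff p \<in> deg_box R" "b = G p"
    and g: "\<And>m. g m \<in> homogeneous m" "y = (\<Sum>m\<in>deg_box R. g m)" by auto
  have b: "b \<in> homogeneous (deg_diff p)"
    unfolding homogeneous_def p(3) using p(1) by (intro cvs.span_base) simp
  define h where "h m = (if m = deg_diff p then c *\<^sub>C b else 0) + g m" for m
  have "h m \<in> homogeneous m" for m
    using g(1)[of m] b unfolding h_def homogeneous_def
    by (auto intro!: cvs.span_add cvs.span_scale)
  moreover have "c *\<^sub>C b + y = (\<Sum>m\<in>deg_box R. h m)"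
    using p(2) finite_deg_box by (simp add: h_def sum.distrib g(2))
  ultimately show ?case by blast
qed

lemma norm_le_on_bounded_part:
  assumes x: "x \<in> bounded_part R"
  shows "norm x \<le> (2 * real R + 1) ^ CARD('k) * norm (\<pi> x)"
proof -
  obtain g where g: "\<And>m. g m \<in> homogeneous m" "x = (\<Sum>m\<in>deg_box R. g m)"
    using bounded_part_decompose[OF x] by blast
  have "norm x \<le> (\<Sum>m\<in>deg_box R. norm (\<pi> x))"
    unfolding g(2)
  proof (rule sum_norm_le)
    fix n assume n: "n \<in> deg_box R"
    show "norm (g n) \<le> norm (\<pi> (\<Sum>m\<in>deg_box R. g m))"
      using norm_le_on_homogeneous[OF g(1)] norm_component_le[OF finite_deg_box g(1) n]
      by (rule order_trans)
  qed
  then show ?thesis by (simp add: card_deg_box add.commute)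
qed

lemma bounded_part_mult:
  assumes "x \<in> bounded_part R" "y \<in> bounded_part R"
  shows "x * y \<in> bounded_part (2 * R)"
  using assms unfolding bounded_part_def
proof (rule span_mult)
  fix a b assume "a \<in> G ` {p \<in> gens. deg_diff p \<in> deg_box R}" "b \<in> G ` {p \<in> gens. deg_diff p \<in> deg_box R}"
  then obtain p q where p: "p \<in> gens" "deg_diff p \<in> deg_box R" "a = G p"
    and q: "q \<in> gens" "deg_diff q \<in> deg_box R" "b = G q" by auto
  have "\<bar>deg_diff p i + deg_diff q i\<bar> \<le> int (2 * R)" for i
  proof -
    have "\<bar>deg_diff p i\<bar> \<le> int R" "\<bar>deg_diff q i\<bar> \<le> int R" using p q by (auto simp: deg_box_iff)
    then show ?thesis by linarith
  qed
  then have "(\<lambda>i. deg_diff p i + deg_diff q i) \<in> deg_box (2 * R)" unfolding deg_box_iff by blast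
  then have "homogeneous (\<lambda>i. deg_diff p i + deg_diff q i) \<subseteq> cvs.span (G ` {p \<in> gens. deg_diff p \<in> deg_box (2 * R)})"
    unfolding homogeneous_def by (intro cvs.span_mono) auto
  then show "a * b \<in> cvs.span (G ` {p \<in> gens. deg_diff p \<in> deg_box (2 * R)})"
    using G_mult[OF p(1) q(1)] p(3) q(3) by auto
qed

lemma star_bounded_part:
  assumes "x \<in> bounded_part R"
  shows "star x \<in> bounded_part R"
  using assms unfolding bounded_part_def
proof (rule span_star)
  fix a assume "a \<in> G ` {p \<in> gens. deg_diff p \<in> deg_box R}"
  then obtain p where p: "p \<in> gens" "deg_diff p \<in> deg_box R" "a = G p" by auto
  then have "star a = G (snd p, fst p)" "(snd p, fst p) \<in> gens" by (auto simp: star_G gens_def)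
  moreover have "deg_diff (snd p, fst p) \<in> deg_box R"
    using p(2) by (simp add: deg_box_iff deg_diff_def abs_minus_commute)
  ultimately show "star a \<in> cvs.span (G ` {p \<in> gens. deg_diff p \<in> deg_box R})"
    by (intro cvs.span_base) simp
qed

lemma bounded_part_exhausts:
  assumes "x \<in> cvs.span (G ` gens)"
  obtains R where "x \<in> bounded_part R"
proof -
  obtain t where t: "finite t" "t \<subseteq> G ` gens" "x \<in> cvs.span t"
    using span_finite_subset[OF assms] .
  obtain B where B: "B \<subseteq> gens" "finite B" "t = G ` B"
    using finite_subset_image[OF t(1,2)] by blast
  define R where "R = (\<Sum>p\<in>B. \<Sum>i\<in>UNIV. nat \<bar>deg_diff p i\<bar>)"
  have "deg_diff p \<in> deg_box R" if p: "p \<in> B" for p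
    unfolding deg_box_iff
  proof
    fix i
    have "nat \<bar>deg_diff p i\<bar> \<le> (\<Sum>i\<in>UNIV. nat \<bar>deg_diff p i\<bar>)" by (rule member_le_sum) auto
    also have "\<dots> \<le> R" unfolding R_def by (rule member_le_sum[OF p]) (use B in auto)
    finally show "\<bar>deg_diff p i\<bar> \<le> int R" by simp
  qed
  then have "t \<subseteq> G ` {p \<in> gens. deg_diff p \<in> deg_box R}" using B by auto
  then have "x \<in> bounded_part R" using t(3) cvs.span_mono unfolding bounded_part_def by blast
  then show ?thesis by (rule that)
qed

text \<open>
  The bound by the number of homogeneous components grows only polynomially along the powers of
  \<open>x\<^sup>* x\<close>, and hence improves to the constant \<open>1\<close>.
\<close>

lemma norm_le_on_span:
  assumes "x \<in> cvs.span (G ` gens)"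
  shows "norm x \<le> norm (\<pi> x)"
proof -
  obtain R where R: "x \<in> bounded_part R" using bounded_part_exhausts[OF assms] .
  \<comment> \<open>Degree differences of \<open>star x * x\<close> are bounded by 2R, and every
    squaring doubles the bound. The estimate 2 * 2^n * R2 + 1 \<le> (2 * R2 + 1) * 2^n, raised to
    the power k, gives the constants \<open>C\<close> and \<open>D\<close>.\<close>
  define R2 where "R2 = 2 * R"
  show ?thesis
  proof (rule norm_le_of_growth[OF hom, where V = "\<lambda>n. bounded_part (2 ^ n * R2)" and
        C = "(2 * real R2 + 1) ^ CARD('k)" and D = "2 ^ CARD('k)"])
    show "star x * x \<in> bounded_part (2 ^ 0 * R2)"
      using bounded_part_mult[OF star_bounded_part[OF R] R] by (simp add: R2_def)
    fix n y assume y: "y \<in> bounded_part (2 ^ n * R2)"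
    show "y * y \<in> bounded_part (2 ^ Suc n * R2)"
      using bounded_part_mult[OF y y] by (simp add: mult.assoc)
    have "(2 * real (2 ^ n * R2) + 1) \<le> (2 * real R2 + 1) * 2 ^ n"
      by (simp add: algebra_simps)
    then have "(2 * real (2 ^ n * R2) + 1) ^ CARD('k) \<le> ((2 * real R2 + 1) * 2 ^ n) ^ CARD('k)"
      by (intro power_mono) auto
    also have "\<dots> = (2 * real R2 + 1) ^ CARD('k) * (2 ^ CARD('k)) ^ n"
      by (simp only: power_mult_distrib power_mult[symmetric] mult.commute)
    finally have "(2 * real (2 ^ n * R2) + 1) ^ CARD('k) * norm (\<pi> y)
        \<le> (2 * real R2 + 1) ^ CARD('k) * (2 ^ CARD('k)) ^ n * norm (\<pi> y)"
      by (intro mult_right_mono) auto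
    with norm_le_on_bounded_part[OF y]
    show "norm y \<le> (2 * real R2 + 1) ^ CARD('k) * (2 ^ CARD('k)) ^ n * norm (\<pi> y)"
      by (rule order_trans)
  qed
qed

end


section \<open>Separable C*-algebras as sets of sequences\<close>

text \<open>A point of \<open>D\<close> closer to \<open>x\<close> than half of
  \<open>dist x y\<close> would be equally close to \<open>y\<close>, against the triangle
  inequality.\<close>

lemma inj_on_dist_from_dense:
  fixes D :: "'b::metric_space set"
  assumes "countable D" "D \<noteq> {}"
  shows "inj_on (\<lambda>x n. dist x (from_nat_into D n)) (closure D)"
proof (rule inj_onI)
  fix x y assume x: "x \<in> closure D" and y: "y \<in> closure D"
    and eq: "(\<lambda>n. dist x (from_nat_into D n)) = (\<lambda>n. dist y (from_nat_into D n))"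
  have eqD: "dist x z = dist y z" if "z \<in> D" for z
    using from_nat_into_surj[OF assms(1) that] fun_cong[OF eq] by metis
  show "x = y"
  proof (rule ccontr)
    assume "x \<noteq> y"
    then have "dist x y / 2 > 0" by simp
    then obtain z where z: "z \<in> D" "dist z x < dist x y / 2"
      using x closure_approachable by blast
    then show False
      using eqD[OF z(1)] dist_triangle2[of x y z] by (simp add: dist_commute)
  qed
qed

lemma countable_dense_in_span:
  fixes B :: "'b::cstar_algebra set"
  assumes "countable B"
  obtains D where "countable D" "D \<noteq> {}" "cvs.span B \<subseteq> closure D"
proof -
  obtain Q :: "complex set" where Q: "countable Q" "\<And>X. open X \<Longrightarrow> X \<noteq> {} \<Longrightarrow> \<exists>q\<in>Q. q \<in> X"
    by (rule countable_dense_setE) blast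
  define f :: "(complex \<times> 'b) list \<Rightarrow> 'b" where "f l = (\<Sum>p\<leftarrow>l. fst p *\<^sub>C snd p)" for l
  define D where "D = f ` lists (Q \<times> B)"
  have "x \<in> closure D" if "x \<in> cvs.span B" for x
    using that
  proof (induction rule: cvs.span_induct_alt)
    case base
    have "f [] \<in> D" unfolding D_def by (intro imageI) simp
    then show ?case using closure_subset by (auto simp: f_def)
  next
    case (step c b y)
    show ?case
      unfolding closure_approachable
    proof (intro allI impI)
      fix e :: real assume e: "e > 0"
      \<comment> \<open>The added 1 keeps the denominator positive when \<open>b\<close> is
        zero.\<close>
      define \<delta> where "\<delta> = e / (2 * (norm b + 1))"
      have b1: "norm b + 1 > 0" by (rule add_nonneg_pos) simp_all
      have "\<delta> > 0" using e b1 by (simp add: \<delta>_def)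
      then obtain q where q: "q \<in> Q" "dist c q < \<delta>" using Q(2)[of "ball c \<delta>"] by auto
      obtain z where z: "z \<in> D" "dist z y < e / 2"
        using step.IH e unfolding closure_approachable by (metis half_gt_zero)
      obtain l where l: "l \<in> lists (Q \<times> B)" "z = f l" using z(1) by (auto simp: D_def)
      have "f ((q, b) # l) \<in> D"
        unfolding D_def by (intro imageI) (use l(1) q(1) step.hyps in simp)
      then have inD: "q *\<^sub>C b + z \<in> D" by (simp add: f_def l(2))
      have "q *\<^sub>C b + z - (c *\<^sub>C b + y) = (q - c) *\<^sub>C b + (z - y)"
        by (simp add: cvs.scale_left_diff_distrib)
      then have "dist (q *\<^sub>C b + z) (c *\<^sub>C b + y) \<le> cmod (q - c) * norm b + dist z y"
        unfolding dist_norm by (metis norm_scaleC norm_triangle_ineq)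
      also have "cmod (q - c) * norm b \<le> \<delta> * (norm b + 1)"
        using q(2) \<open>\<delta> > 0\<close> by (intro mult_mono) (auto simp: dist_norm norm_minus_commute)
      also have "\<dots> = e / 2" using b1 by (simp add: \<delta>_def field_simps)
      finally have "dist (q *\<^sub>C b + z) (c *\<^sub>C b + y) < e" using z(2) by simp
      then show "\<exists>y'\<in>D. dist y' (c *\<^sub>C b + y) < e" using inD by blast
    qed
  qed
  moreover have "countable D" unfolding D_def using Q(1) assms by (intro countable_image) auto
  moreover have "D \<noteq> {}" by (auto simp: D_def)
  ultimately show ?thesis using that by blast
qed

text \<open>A closed *-subalgebra is carried along an injection into another type, so that the
  universal property can be applied to the copy.\<close>

locale cstar_transport =
  fixes C :: "'b::cstar_algebra set" and \<iota> :: "'b \<Rightarrow> 'c"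
  assumes inj: "inj_on \<iota> C" and avoid: "(THE x. False) \<notin> \<iota> ` C" and closedC: "closed C" and zeroC: "0 \<in> C"
    and addC: "\<And>x y. x \<in> C \<Longrightarrow> y \<in> C \<Longrightarrow> x + y \<in> C"
    and multC: "\<And>x y. x \<in> C \<Longrightarrow> y \<in> C \<Longrightarrow> x * y \<in> C"
    and scaleC: "\<And>a x. x \<in> C \<Longrightarrow> a *\<^sub>C x \<in> C"
    and starC: "\<And>x. x \<in> C \<Longrightarrow> star x \<in> C"
begin

abbreviation \<kappa> where "\<kappa> \<equiv> inv_into C \<iota>"

text \<open>
  Completeness of a metric space presupposes a distance that is symmetric on the whole type, so the
  structure has to be defined suitably off the carrier.  There the additive inverse, a definite
  description without solutions, is \<open>THE x. False\<close>; it must not lie in the carrier.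
\<close>

definition copy :: "'c cstar_struct" where
  "copy = \<lparr>carrier = \<iota> ` C, mult = (\<lambda>x y. \<iota> (\<kappa> x * \<kappa> y)), one = undefined, zero = \<iota> 0,
     add = (\<lambda>x y. if x \<in> \<iota> ` C \<and> y \<in> \<iota> ` C then \<iota> (\<kappa> x + \<kappa> y) else (THE x. False)), smult = (\<lambda>a x. \<iota> (a *\<^sub>C \<kappa> x)), adj = (\<lambda>x. \<iota> (star (\<kappa> x))),
     nrm = (\<lambda>x. if x \<in> \<iota> ` C then norm (\<kappa> x) else 0)\<rparr>"

lemma \<kappa>_\<iota> [simp]: "x \<in> C \<Longrightarrow> \<kappa> (\<iota> x) = x"
  using inj by simp

lemma \<iota>_eq_iff [simp]: "x \<in> C \<Longrightarrow> y \<in> C \<Longrightarrow> \<iota> x = \<iota> y \<longleftrightarrow> x = y"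
  using inj by (auto dest: inj_onD)

lemma copy_simps [simp]:
  "carrier copy = \<iota> ` C"
  "\<zero>\<^bsub>copy\<^esub> = \<iota> 0"
  "x \<in> C \<Longrightarrow> y \<in> C \<Longrightarrow> \<iota> x \<otimes>\<^bsub>copy\<^esub> \<iota> y = \<iota> (x * y)"
  "x \<in> C \<Longrightarrow> y \<in> C \<Longrightarrow> \<iota> x \<oplus>\<^bsub>copy\<^esub> \<iota> y = \<iota> (x + y)"
  "x \<in> C \<Longrightarrow> a \<odot>\<^bsub>copy\<^esub> \<iota> x = \<iota> (a *\<^sub>C x)"
  "x \<in> C \<Longrightarrow> adj copy (\<iota> x) = \<iota> (star x)"
  "x \<in> C \<Longrightarrow> nrm copy (\<iota> x) = norm x"
  by (simp_all add: copy_def)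

lemmas memC [simp] = zeroC addC multC scaleC starC

lemma uminusC [simp]: "x \<in> C \<Longrightarrow> - x \<in> C"
  using scaleC[of x "- 1"] by simp

lemma diffC [simp]: "x \<in> C \<Longrightarrow> y \<in> C \<Longrightarrow> x - y \<in> C"
  using addC[of x "- y"] by simp

lemma abelian_group_copy: "abelian_group copy"
proof (rule abelian_groupI)
  fix x assume "x \<in> carrier copy"
  then obtain a where a: "a \<in> C" "x = \<iota> a" by auto
  then have "\<iota> (- a) \<in> carrier copy" "\<iota> (- a) \<oplus>\<^bsub>copy\<^esub> x = \<zero>\<^bsub>copy\<^esub>" by auto
  then show "\<exists>y\<in>carrier copy. y \<oplus>\<^bsub>copy\<^esub> x = \<zero>\<^bsub>copy\<^esub>" by blast
qed (auto simp: add_ac)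

sublocale copy: abelian_group copy
  by (rule abelian_group_copy)

lemma minus_copy [simp]:
  assumes "x \<in> C" "y \<in> C"
  shows "\<iota> x \<ominus>\<^bsub>copy\<^esub> \<iota> y = \<iota> (x - y)"
proof -
  have "\<ominus>\<^bsub>copy\<^esub> \<iota> y = \<iota> (- y)"
    using assms by (intro copy.minus_equality) auto
  then show ?thesis using assms by (simp add: a_minus_def)
qed

lemma nrm_dist_copy [simp]: "x \<in> C \<Longrightarrow> y \<in> C \<Longrightarrow> nrm_dist copy (\<iota> x) (\<iota> y) = dist x y"
  by (simp add: nrm_dist_def dist_norm)

text \<open>A constant value 0 makes the distance symmetric and nonnegative everywhere; separation
  of points and the triangle inequality are required only on the carrier.\<close>

lemma nrm_dist_off_carrier:
  assumes "x \<notin> \<iota> ` C \<or> y \<notin> \<iota> ` C"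
  shows "nrm_dist copy x y = 0"
proof -
  have add: "a \<oplus>\<^bsub>copy\<^esub> b = (THE x. False)" if "a \<notin> \<iota> ` C \<or> b \<notin> \<iota> ` C" for a b
    using that by (auto simp: copy_def)
  have inv: "\<ominus>\<^bsub>copy\<^esub> y = (THE x. False)" if "y \<notin> \<iota> ` C"
  proof -
    have "y \<oplus>\<^bsub>copy\<^esub> z = (THE x. False)" for z using that by (simp add: add)
    moreover have "(THE x. False) \<noteq> \<iota> 0" using avoid zeroC by force
    ultimately show ?thesis by (simp add: a_inv_def m_inv_def)
  qed
  have "x \<ominus>\<^bsub>copy\<^esub> y = (THE x. False)"
    unfolding a_minus_def by (rule add) (use assms inv avoid in metis)
  then show ?thesis using avoid by (simp add: nrm_dist_def copy_def)
qed

lemma Metric_space_copy: "Metric_space (carrier copy) (nrm_dist copy)"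
proof
  show "0 \<le> nrm_dist copy x y" for x y by (simp add: nrm_dist_def copy_def)
  show "nrm_dist copy x y = nrm_dist copy y x" for x y
  proof (cases "x \<in> \<iota> ` C \<and> y \<in> \<iota> ` C")
    case True
    then show ?thesis by (auto simp: dist_commute)
  qed (auto simp: nrm_dist_off_carrier)
  show "nrm_dist copy x y = 0 \<longleftrightarrow> x = y" if "x \<in> carrier copy" "y \<in> carrier copy" for x y
    using that by auto
  show "nrm_dist copy x z \<le> nrm_dist copy x y + nrm_dist copy y z"
    if "x \<in> carrier copy" "y \<in> carrier copy" "z \<in> carrier copy" for x y z
    using that by (auto simp: dist_triangle)
qed

lemma mcomplete_copy: "Metric_space.mcomplete (carrier copy) (nrm_dist copy)"
proof -
  interpret ms: Metric_space "carrier copy" "nrm_dist copy"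
    by (rule Metric_space_copy)
  show ?thesis
    unfolding ms.mcomplete_def
  proof (intro allI impI)
    fix \<sigma> assume \<sigma>: "ms.MCauchy \<sigma>"
    have ran: "range \<sigma> \<subseteq> carrier copy"
      and *: "\<forall>\<epsilon>>0. \<exists>N. \<forall>n n'. N \<le> n \<longrightarrow> N \<le> n' \<longrightarrow> nrm_dist copy (\<sigma> n) (\<sigma> n') < \<epsilon>"
      using \<sigma> unfolding ms.MCauchy_def by blast+
    have "\<exists>x. x \<in> C \<and> \<sigma> n = \<iota> x" for n
      using subsetD[OF ran, of "\<sigma> n"] by auto
    then obtain x where x: "\<And>n. x n \<in> C" "\<And>n. \<sigma> n = \<iota> (x n)" by metis
    have "Cauchy x"
      unfolding Cauchy_def using * by (simp add: x)
    then obtain l where l: "x \<longlonglongrightarrow> l" using Cauchy_convergent_iff convergent_def by blast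
    then have lC: "l \<in> C" using closedC x(1) closed_sequentially by blast
    then have "limitin ms.mtopology \<sigma> (\<iota> l) sequentially"
      unfolding ms.limit_metric_sequentially using l x by (simp add: lim_sequentially)
    then show "\<exists>x. limitin ms.mtopology \<sigma> x sequentially" by blast
  qed
qed

lemma cstar_algebra_on_copy: "cstar_algebra_on copy"
proof -
  have b: "(\<forall>x\<in>carrier copy. Q x) \<longleftrightarrow> (\<forall>x\<in>C. Q (\<iota> x))" for Q by simp
  show ?thesis
    unfolding cstar_algebra_on_def b
    by (intro conjI abelian_group_copy mcomplete_copy)
      (auto simp: scaleC_add_right scaleC_add_left scaleC_scaleC
        scaleC_mult_left scaleC_mult_right norm_scaleC star_add star_scaleC star_mult star_star
        norm_star_mult norm_triangle_ineq norm_mult_ineq mult.assoc distrib_left distrib_right)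
qed

lemma finsum_copy:
  assumes "finite A" "\<And>a. a \<in> A \<Longrightarrow> f a \<in> C"
  shows "finsum copy (\<lambda>a. \<iota> (f a)) A = \<iota> (sum f A) \<and> sum f A \<in> C"
  using assms
proof (induction A rule: finite_induct)
  case (insert a A)
  then show ?case by (subst copy.finsum_insert) (auto simp: Pi_def)
qed simp

lemma relative_CK_family_copy:
  assumes "k_graph \<Lambda>" "finitely_aligned \<Lambda>" and \<E>: "\<E> \<subseteq> FE_edges \<Lambda>"
    and S: "relative_CK_family \<Lambda> \<E> cstar_of_type S" and SC: "\<And>\<mu>. \<mu> \<in> mor \<Lambda> \<Longrightarrow> S \<mu> \<in> C"
  shows "relative_CK_family \<Lambda> \<E> copy (\<lambda>\<mu>. \<iota> (S \<mu>))"
proof -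
  interpret tck_family \<Lambda> S
    using assms by unfold_locales (simp_all add: relative_CK_family_def)
  have sum: "adj copy (\<iota> (S \<mu>)) \<otimes>\<^bsub>copy\<^esub> \<iota> (S \<nu>) =
      (\<Oplus>\<^bsub>copy\<^esub>p\<in>Lmin \<Lambda> \<mu> \<nu>. \<iota> (S (fst p)) \<otimes>\<^bsub>copy\<^esub> adj copy (\<iota> (S (snd p))))"
    if \<mu>\<nu>: "\<mu> \<in> M" "\<nu> \<in> M" for \<mu> \<nu>
  proof -
    have pM: "fst p \<in> M" "snd p \<in> M" if "p \<in> Lmin \<Lambda> \<mu> \<nu>" for p
      using LminE[OF that \<mu>\<nu>] by blast+
    have "(\<Oplus>\<^bsub>copy\<^esub>p\<in>Lmin \<Lambda> \<mu> \<nu>. \<iota> (S (fst p)) \<otimes>\<^bsub>copy\<^esub> adj copy (\<iota> (S (snd p)))) =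
        (\<Oplus>\<^bsub>copy\<^esub>p\<in>Lmin \<Lambda> \<mu> \<nu>. \<iota> (S (fst p) * star (S (snd p))))"
      by (rule copy.finsum_cong') (use pM SC in auto)
    also have "\<dots> = \<iota> (\<Sum>p\<in>Lmin \<Lambda> \<mu> \<nu>. S (fst p) * star (S (snd p)))"
      using finsum_copy[OF finite_Lmin[OF \<mu>\<nu>]] pM SC by simp
    also have "\<dots> = adj copy (\<iota> (S \<mu>)) \<otimes>\<^bsub>copy\<^esub> \<iota> (S \<nu>)"
      using SC \<mu>\<nu> by (simp add: T_star_mult[OF \<mu>\<nu>])
    finally show ?thesis by simp
  qed
  have vM: "v \<in> M" if "v \<in> vertices \<Lambda>" for v using vertexD[OF that] by simp
  have "TCK_family \<Lambda> copy (\<lambda>\<mu>. \<iota> (S \<mu>))"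
    unfolding TCK_family_def
    using sum by (auto simp: SC vM T_partial_isometry T_vertex T_orth T_mult)
  moreover have "gap_projection \<Lambda> copy (\<lambda>\<mu>. \<iota> (S \<mu>)) E = \<zero>\<^bsub>copy\<^esub>" if E: "E \<in> \<E>" for E
  proof -
    obtain v where v: "v \<in> vertices \<Lambda>" "finite E" "E \<noteq> {}" "E \<subseteq> into \<Lambda> v M"
      using FE_edgesD E \<E> by blast
    \<comment> \<open>The enumeration chosen in \<open>gap_projection\<close> depends on
      \<open>E\<close> alone, so both algebras multiply their factors in the same order.\<close>
    define es where "es = (SOME es. distinct es \<and> set es = E)"
    have "distinct es \<and> set es = E"
      unfolding es_def by (rule someI_ex) (use finite_distinct_list[OF v(2)] in blast)
    then have es: "set es \<subseteq> M" using v(4) by (auto simp: into_def)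
    have "foldr (\<lambda>e x. (\<iota> (S v) \<ominus>\<^bsub>copy\<^esub> \<iota> (S e) \<otimes>\<^bsub>copy\<^esub> adj copy (\<iota> (S e))) \<otimes>\<^bsub>copy\<^esub> x) es (\<iota> (S v))
        = \<iota> (gap v es) \<and> gap v es \<in> C"
      using es
    proof (induction es)
      case (Cons e es)
      then show ?case using v(1) by (simp add: SC vM P_def)
    qed (use v(1) in \<open>simp add: SC vM\<close>)
    moreover have "gap v es = 0"
    proof -
      have "gap_projection \<Lambda> cstar_of_type S E = 0" using S E by (simp add: relative_CK_family_def)
      then show ?thesis
        unfolding gap_projection_def set_rng_eq[OF v(3,4)] gap_def es_def P_def
        by (simp add: mult_cstar_of_type)
    qed
    ultimately show ?thesis
      unfolding gap_projection_def set_rng_eq[OF v(3,4)] es_def by simp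
  qed
  ultimately show ?thesis by (simp add: relative_CK_family_def)
qed

lemma star_hom_from_copy:
  assumes "star_hom A copy \<pi>"
  shows "star_hom A cstar_of_type (\<lambda>x. \<kappa> (\<pi> x))"
proof -
  have "\<pi> x \<in> \<iota> ` C" if "x \<in> carrier A" for x
    using assms that by (simp add: star_hom_def)
  then have "\<exists>g. \<forall>x\<in>carrier A. g x \<in> C \<and> \<pi> x = \<iota> (g x)" by (intro bchoice) blast
  then obtain g where g: "\<And>x. x \<in> carrier A \<Longrightarrow> g x \<in> C" "\<And>x. x \<in> carrier A \<Longrightarrow> \<pi> x = \<iota> (g x)"
    by blast
  then show ?thesis
    using assms by (simp add: star_hom_def)
qed

end

section \<open>Existence of the homomorphism\<close>

lemma cstar_subalgebra_iff_closed:
  "cstar_subalgebra (cstar_of_type :: 'b::cstar_algebra cstar_struct) C \<longleftrightarrow> closed C \<and> 0 \<in> C \<and>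
     (\<forall>x\<in>C. \<forall>y\<in>C. x + y \<in> C \<and> x * y \<in> C) \<and> (\<forall>a. \<forall>x\<in>C. a *\<^sub>C x \<in> C \<and> star x \<in> C)"
proof -
  have "nrm_dist (cstar_of_type :: 'b cstar_struct) = dist"
    by (intro ext) (simp add: nrm_dist_def dist_norm)
  then show ?thesis by (auto simp: cstar_subalgebra_def)
qed

context tck_family
begin

lemma cstar_subalgebra_closure: "cstar_subalgebra cstar_of_type (closure (cvs.span (G ` gens)))"
proof -
  let ?V = "cvs.span (G ` gens)"
  have "x + y \<in> closure ?V \<and> x * y \<in> closure ?V" if xy: "x \<in> closure ?V" "y \<in> closure ?V" for x y
  proof -
    obtain a b where a: "\<And>n. a n \<in> ?V" "a \<longlonglongrightarrow> x" and b: "\<And>n. b n \<in> ?V" "b \<longlonglongrightarrow> y"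
      using xy unfolding closure_sequential by blast
    have "x + y \<in> closure ?V"
      unfolding closure_sequential
      by (intro exI[of _ "\<lambda>n. a n + b n"] conjI allI cvs.span_add a b tendsto_add)
    moreover have "x * y \<in> closure ?V"
      unfolding closure_sequential
      by (intro exI[of _ "\<lambda>n. a n * b n"] conjI allI span_G_mult a b tendsto_mult)
    ultimately show ?thesis by (rule conjI)
  qed
  moreover have "a *\<^sub>C x \<in> closure ?V \<and> star x \<in> closure ?V" if x: "x \<in> closure ?V" for a x
  proof -
    have "(*\<^sub>C) a ` closure ?V \<subseteq> closure ?V"
      by (rule image_closure_subset)
        (auto intro: continuous_on_subset[OF continuous_scaleC] cvs.span_scale subsetD[OF closure_subset])
    moreover have "star ` closure ?V \<subseteq> closure ?V"
      by (rule image_closure_subset)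
        (auto intro: continuous_on_subset[OF continuous_star] span_G_star subsetD[OF closure_subset])
    ultimately show ?thesis using x by blast
  qed
  moreover have "0 \<in> closure ?V" using cvs.span_zero closure_subset by blast
  ultimately show ?thesis unfolding cstar_subalgebra_iff_closed by simp
qed

lemma T_in_closure: "\<mu> \<in> M \<Longrightarrow> T \<mu> \<in> closure (cvs.span (G ` gens))"
proof -
  assume \<mu>: "\<mu> \<in> M"
  then have "(\<mu>, sc \<mu>) \<in> gens" by (simp add: gens_def)
  then have "T \<mu> \<in> cvs.span (G ` gens)" unfolding T_eq_G[OF \<mu>] by (intro cvs.span_base imageI)
  then show ?thesis using closure_subset by blast
qed

text \<open>The closed span of the generators built from \<open>T\<close> contains the whole family
  and is separable, so it can be copied onto a set of sequences. The homomorphism into the copy is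
  then composed with the inverse of the encoding.\<close>

lemma ex_star_hom:
  fixes s :: "'l \<Rightarrow> 'c::cstar_algebra"
  assumes univ: "universal_relative_CK_family \<Lambda> \<E> cstar_of_type s"
    and \<E>: "\<E> \<subseteq> FE_edges \<Lambda>" and CK: "relative_CK_family \<Lambda> \<E> cstar_of_type T"
  shows "\<exists>\<pi>. star_hom cstar_of_type cstar_of_type \<pi> \<and> (\<forall>\<mu>\<in>M. \<pi> (s \<mu>) = T \<mu>)"
proof -
  define C where "C = closure (cvs.span (G ` gens))"
  have "countable (G ` gens)"
  proof (intro countable_image)
    have "countable M" using kg by (simp add: k_graph_def)
    then have "countable (M \<times> M)" by simp
    then show "countable gens" by (rule countable_subset[rotated]) (auto simp: gens_def)
  qed
  then obtain D where D: "countable D" "D \<noteq> {}" "cvs.span (G ` gens) \<subseteq> closure D"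
    using countable_dense_in_span by blast
  \<comment> \<open>Entry 0 only makes every code differ from the undefined description
    \<open>THE f. False\<close>; the later entries are the distances from a dense sequence, which
    determine the point.\<close>
  define \<iota> :: "'a \<Rightarrow> nat \<Rightarrow> real" where
    "\<iota> x = case_nat ((THE f :: nat \<Rightarrow> real. False) 0 + 1) (\<lambda>n. dist x (from_nat_into D n))" for x
  have CD: "C \<subseteq> closure D" unfolding C_def using D(3) by (simp add: closure_minimal)
  interpret cstar_transport C \<iota>
  proof unfold_locales
    show "inj_on \<iota> C"
    proof (rule inj_onI)
      fix x y assume xy: "x \<in> C" "y \<in> C" and eq: "\<iota> x = \<iota> y"
      have "(\<lambda>n. dist x (from_nat_into D n)) = (\<lambda>n. dist y (from_nat_into D n))"
        using fun_cong[OF eq, of "Suc n" for n] by (intro ext) (simp add: \<iota>_def)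
      then show "x = y"
        using inj_onD[OF inj_on_dist_from_dense[OF D(1,2)]] CD xy by blast
    qed
    show "(THE f. False) \<notin> \<iota> ` C"
    proof
      assume "(THE f. False) \<in> \<iota> ` C"
      then obtain x where "(THE f. False) = \<iota> x" by auto
      from fun_cong[OF this, of 0] show False by (simp add: \<iota>_def)
    qed
  qed (use cstar_subalgebra_closure in \<open>auto simp: cstar_subalgebra_iff_closed C_def\<close>)
  have TC: "T \<mu> \<in> C" if "\<mu> \<in> M" for \<mu> using T_in_closure that by (simp add: C_def)
  have "relative_CK_family \<Lambda> \<E> copy (\<lambda>\<mu>. \<iota> (T \<mu>))"
    by (rule relative_CK_family_copy[OF kg fa \<E> CK TC])
  then obtain \<pi> where \<pi>: "star_hom cstar_of_type copy \<pi>" "\<forall>\<mu>\<in>M. \<pi> (s \<mu>) = \<iota> (T \<mu>)"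
    using univ cstar_algebra_on_copy unfolding universal_relative_CK_family_def by blast
  have "\<forall>\<mu>\<in>M. \<kappa> (\<pi> (s \<mu>)) = T \<mu>" using \<pi>(2) TC by simp
  then show ?thesis using star_hom_from_copy[OF \<pi>(1)] by blast
qed

lemma closure_span_eq_UNIV:
  assumes "generates_cstar cstar_of_type (T ` M)"
  shows "closure (cvs.span (G ` gens)) = UNIV"
  using assms cstar_subalgebra_closure T_in_closure unfolding generates_cstar_def by auto

end

section \<open>Uniqueness and injectivity\<close>

lemma star_hom_continuous:
  assumes hom: "star_hom cstar_of_type cstar_of_type (\<pi> :: 'a::cstar_algebra \<Rightarrow> 'b::cstar_algebra)"
  shows "continuous_on UNIV \<pi>"
proof (rule lipschitz_on_continuous_on[of 1], rule lipschitz_onI)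
  show "dist (\<pi> x) (\<pi> y) \<le> 1 * dist x y" for x y
    using star_hom_contractive[OF hom, of "x - y"] by (simp add: dist_norm star_homD[OF hom])
qed simp

theorem theorem6p1:
  fixes \<Lambda> :: "('l, 'k::finite) kgraph"
    and \<E> :: "'l set set"
    and s :: "'l \<Rightarrow> 'a::cstar_algebra"
    and S :: "'l \<Rightarrow> 'b::cstar_algebra"
  assumes "k_graph \<Lambda>" and "finitely_aligned \<Lambda>"
    and "efficient \<Lambda> \<E>"
    and "universal_relative_CK_family \<Lambda> \<E> cstar_of_type s"
    and "relative_CK_family \<Lambda> \<E> cstar_of_type S"
    and G1: "\<forall>v\<in>vertices \<Lambda>. S v \<noteq> 0"
    and G2: "\<forall>E\<in>FE_edges \<Lambda> - edge_satiation \<Lambda> \<E>. gap_projection \<Lambda> cstar_of_type S E \<noteq> 0"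
    and G3: "\<exists>\<theta> :: complex ^ 'k \<Rightarrow> 'b \<Rightarrow> 'b. torus_action cstar_of_type \<theta> \<and>
               (\<forall>z\<in>torus. \<forall>\<mu>\<in>mor \<Lambda>. \<theta> z (S \<mu>) = torus_power z (deg \<Lambda> \<mu>) *\<^sub>C S \<mu>)"
  shows "(\<exists>!\<pi> :: 'a \<Rightarrow> 'b. star_hom cstar_of_type cstar_of_type \<pi> \<and> (\<forall>\<mu>\<in>mor \<Lambda>. \<pi> (s \<mu>) = S \<mu>)) \<and>
         (\<forall>\<pi> :: 'a \<Rightarrow> 'b. star_hom cstar_of_type cstar_of_type \<pi> \<and> (\<forall>\<mu>\<in>mor \<Lambda>. \<pi> (s \<mu>) = S \<mu>)
            \<longrightarrow> inj \<pi>)"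
proof -
  note univ = assms(4) and CK_S = assms(5)
  have \<E>: "\<E> \<subseteq> FE_edges \<Lambda>" using assms(3) by (simp add: efficient_def)
  have CK_s: "relative_CK_family \<Lambda> \<E> cstar_of_type s" and gen: "generates_cstar cstar_of_type (s ` mor \<Lambda>)"
    using univ by (simp_all add: universal_relative_CK_family_def)
  interpret S: tck_family \<Lambda> S
    using assms(1,2) CK_S by unfold_locales (simp_all add: relative_CK_family_def)
  interpret s: tck_family \<Lambda> s
    using CK_s by unfold_locales (simp add: relative_CK_family_def)
  note dense = s.closure_span_eq_UNIV[OF gen]
  obtain \<theta> :: "complex ^ 'k \<Rightarrow> 'b \<Rightarrow> 'b" where \<theta>: "torus_action cstar_of_type \<theta>"
    "\<And>z \<mu>. z \<in> torus \<Longrightarrow> \<mu> \<in> mor \<Lambda> \<Longrightarrow> \<theta> z (S \<mu>) = torus_power z (deg \<Lambda> \<mu>) *\<^sub>C S \<mu>"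
    using G3 by blast
  have unique: "\<pi> = \<rho>"
    if \<pi>: "star_hom cstar_of_type cstar_of_type \<pi>" "\<forall>\<mu>\<in>mor \<Lambda>. \<pi> (s \<mu>) = S \<mu>"
      and \<rho>: "star_hom cstar_of_type cstar_of_type \<rho>" "\<forall>\<mu>\<in>mor \<Lambda>. \<rho> (s \<mu>) = S \<mu>" for \<pi> \<rho> :: "'a \<Rightarrow> 'b"
  proof -
    have "\<pi> x = \<rho> x" if "x \<in> cvs.span (s.G ` s.gens)" for x
      using that
    proof (induction rule: cvs.span_induct_alt)
      case base
      show ?case by (simp add: star_homD[OF \<pi>(1)] star_homD[OF \<rho>(1)])
    next
      case (step c b y)
      then obtain p where "fst p \<in> mor \<Lambda>" "snd p \<in> mor \<Lambda>" "b = s.G p" by (auto simp: s.gens_def)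
      then have "\<pi> b = \<rho> b"
        using \<pi>(2) \<rho>(2) by (simp add: s.G_def star_homD[OF \<pi>(1)] star_homD[OF \<rho>(1)])
      then show ?case using step(2) by (simp add: star_homD[OF \<pi>(1)] star_homD[OF \<rho>(1)])
    qed
    moreover have "closed {x. \<pi> x = \<rho> x}"
      by (intro closed_Collect_eq star_hom_continuous \<pi>(1) \<rho>(1))
    ultimately have "closure (cvs.span (s.G ` s.gens)) \<subseteq> {x. \<pi> x = \<rho> x}"
      by (intro closure_minimal) auto
    then show ?thesis unfolding dense by auto
  qed
  have inj: "inj \<pi>"
    if \<pi>: "star_hom cstar_of_type cstar_of_type \<pi>" "\<forall>\<mu>\<in>mor \<Lambda>. \<pi> (s \<mu>) = S \<mu>" for \<pi> :: "'a \<Rightarrow> 'b"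
  proof -
    interpret gauge_hom \<Lambda> s \<pi> \<theta>
    proof unfold_locales
      show "torus_action cstar_of_type \<theta>" by (rule \<theta>(1))
      show "\<theta> z (\<pi> (s \<mu>)) = torus_power z (deg \<Lambda> \<mu>) *\<^sub>C \<pi> (s \<mu>)" if "z \<in> torus" "\<mu> \<in> mor \<Lambda>" for z \<mu>
        using \<theta>(2)[OF that] \<pi>(2) that(2) by simp
      fix v E assume v: "v \<in> vertices \<Lambda>" "finite E" "E \<subseteq> into \<Lambda> v (mor \<Lambda>)" "covers (\<lambda>\<mu>. \<pi> (s \<mu>)) v E"
      have "v \<in> mor \<Lambda>" "E \<subseteq> mor \<Lambda>" using v by (auto simp: vertices_def into_def)
      then have "covers S v E" using v(4) \<pi>(2) unfolding covers_def by (metis subsetD)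
      then show "covers s v E"
        by (rule S.covers_transfer[OF \<E> CK_s S.tck G1 G2 v(1-3)])
    qed (rule \<pi>(1))
    \<comment> \<open>Both sides are continuous in \<open>x\<close>, so the inequality passes from
      the dense span to the whole algebra.\<close>
    have "closed {x. norm x \<le> norm (\<pi> x)}"
      by (intro closed_Collect_le continuous_on_norm star_hom_continuous \<pi>(1) continuous_on_id)
    then have "closure (cvs.span (s.G ` s.gens)) \<subseteq> {x. norm x \<le> norm (\<pi> x)}"
      using norm_le_on_span by (intro closure_minimal) auto
    then have le: "norm x \<le> norm (\<pi> x)" for x unfolding dense by auto
    show ?thesis
    proof (rule injI)
      fix x y assume "\<pi> x = \<pi> y"
      then have "\<pi> (x - y) = 0" by (simp add: hom_simps)
      then show "x = y" using le[of "x - y"] by simp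
    qed
  qed
  show ?thesis
    using S.ex_star_hom[OF univ \<E> CK_S] unique inj by blast
qed

end
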